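(* Let $G$ and $H$ be finitely generated groups with finite collections of infinite subgroups $\mathcal{P}$ and $\mathcal{Q}$ respectively, and let $T$ be a (possibly infinite) generating set of $H$. Suppose $q\colon(G,\mathcal{P})\to(H,\mathcal{Q})$ is a quasi-isometry of pairs such that the quasi-action of $G$ on $H$ induced by $q$ is uniform with respect to $T$. If $\mathcal{Q}\hookrightarrow_h(H,T)$, then $\mathcal{P}^*\hookrightarrow_h G$, where $\mathcal{P}^*$ is a refinement of $\mathcal{P}$ in $G$.
   Context: Finitely generated groups carry word metrics from chosen finite generating sets. For a generating set $T$ of $H$, $\Gamma(H,T)$ is the Cayley graph, with vertex set $H$ and edges $\{h,ht\}$ ($h\in H$, $t\in T$); maps $H\to H$ are called quasi-isometries of $\Gamma(H,T)$ if they are quasi-isometries for the word metric $\mathrm{dist}_{(H,T)}$. For a collection $\mathcal{P}$ of subgroups of $G$, $G/\mathcal{P}$ denotes the set of all left cosets $gP$ with $g\in G$, $P\in\mathcal{P}$. Quasi-isometry of pairs: an $(L,C)$-quasi-isometry $q\colon G\to H$ of finitely generated groups is an $(L,C,M)$-quasi-isometry of pairs $q\colon(G,\mathcal{P})\to(H,\mathcal{Q})$ if the relation $\dot q=\{(A,B)\in G/\mathcal{P}\times H/\mathcal{Q} : \mathrm{hdist}_H(q(A),B)<M\}$ has surjective projections to $G/\mathcal{P}$ and to $H/\mathcal{Q}$, where $\mathrm{hdist}_H$ is Hausdorff distance in $H$ for the finite-generating-set word metric. It is a quasi-isometry of pairs if this holds for some $L,C,M$. Uniform induced quasi-action: let $q\colon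 G\to H$ be a quasi-isometry with quasi-inverse $\bar q\colon H\to G$. The quasi-action of $G$ on $H$ induced by $q$ is uniform with respect to $T$ if there are constants $L\ge1$, $C\ge0$ such that for each $g\in G$ the function $q_g\colon H\to H$, $q_g(h)=q(g\cdot\bar q(h))$, is an $(L,C)$-quasi-isometry $\Gamma(H,T)\to\Gamma(H,T)$. The commensurator of $P\le G$ is $\mathrm{Comm}_G(P)=\{g\in G : P\cap gPg^{-1}$ has finite index in both $P$ and $gPg^{-1}\}$. A refinement $\mathcal{P}^*$ of $\mathcal{P}$ in $G$ is a set of representatives of the conjugacy classes of the collection of subgroups $\{\mathrm{Comm}_G(gPg^{-1}) : P\in\mathcal{P},\ g\in G\}$. Hyperbolically embedded: for a collection $\mathcal{P}$ of infinite subgroups of $G$ and $S\subset G$, the coned-off Cayley graph $\hat\Gamma(G,\mathcal{P},S)$ has vertex set $G\cup G/\mathcal{P}$ and edges $\{g,gs\}$ for $g\in G$, $s\in S$, and $\{x,gP\}$ for $g\in G$, $P\in\mathcal{P}$, $x\in gP$. Vertices $gP$ are cone vertices. A graph $\Gamma$ is fine at a vertex $v$ if the set $T_v\Gamma$ of vertices adjacent to $v$, with the metric $\angle_v(x,y)$ = length of a shortest path from $x$ to $y$ in $\Gamma\setminus\{v\}$ ($\infty$ if none), is locally finite (balls of finite radius are finite). $\mathcal{P}\hookrightarrow_h(G,S)$ means that $\hat\Gamma(G,\mathcal{P},S)$ is a connected (Gromov) hyperbolic graph that is fine at every cone vertex; $\mathcal{P}\hookrightarrow_h G$ means $\mathcal{P}\hookrightarrow_h(G,S)$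 for some $S\subset G$. *)

theory Defs
  imports
    "HOL-Algebra.Left_Coset"
    "HOL-Algebra.Generated_Groups"
    "Graph_Theory.Pair_Digraph"
    "Graph_Theory.Digraph_Component"
    "Graph_Theory.Shortest_Path"
begin

section \<open>Word metrics and quasi-isometries\<close>

definition generating_set :: "('a, 'm) monoid_scheme \<Rightarrow> 'a set \<Rightarrow> bool" where
  "generating_set G S \<longleftrightarrow> S \<subseteq> carrier G \<and> generate G S = carrier G"

text \<open>For an element outside the subgroup generated by \<open>S\<close> the value is unspecified;
  word lengths are only used for sets that generate the group.\<close>
definition word_length :: "('a, 'm) monoid_scheme \<Rightarrow> 'a set \<Rightarrow> 'a \<Rightarrow> nat" where
  "word_length G S g =
     (LEAST n. \<exists>w. length w = n \<and> set w \<subseteq> S \<union> set_inv\<^bsub>G\<^esub> S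
                  \<and> foldr (\<otimes>\<^bsub>G\<^esub>) w \<one>\<^bsub>G\<^esub> = g)"

definition word_dist :: "('a, 'm) monoid_scheme \<Rightarrow> 'a set \<Rightarrow> 'a \<Rightarrow> 'a \<Rightarrow> real" where
  "word_dist G S x y = real (word_length G S (inv\<^bsub>G\<^esub> x \<otimes>\<^bsub>G\<^esub> y))"

definition quasi_isometry ::
  "real \<Rightarrow> real \<Rightarrow> 'a set \<Rightarrow> ('a \<Rightarrow> 'a \<Rightarrow> real) \<Rightarrow> 'b set \<Rightarrow> ('b \<Rightarrow> 'b \<Rightarrow> real) \<Rightarrow> ('a \<Rightarrow> 'b) \<Rightarrow> bool"
where
  "quasi_isometry L C X dX Y dY f \<longleftrightarrow>
     L \<ge> 1 \<and> C \<ge> 0 \<and> f \<in> X \<rightarrow> Y \<and>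
     (\<forall>x\<in>X. \<forall>x'\<in>X. dX x x' / L - C \<le> dY (f x) (f x') \<and> dY (f x) (f x') \<le> L * dX x x' + C) \<and>
     (\<forall>y\<in>Y. \<exists>x\<in>X. dY (f x) y \<le> C)"

definition quasi_inverse ::
  "'a set \<Rightarrow> ('a \<Rightarrow> 'a \<Rightarrow> real) \<Rightarrow> 'b set \<Rightarrow> ('b \<Rightarrow> 'b \<Rightarrow> real) \<Rightarrow> ('a \<Rightarrow> 'b) \<Rightarrow> ('b \<Rightarrow> 'a) \<Rightarrow> bool"
where
  "quasi_inverse X dX Y dY f fbar \<longleftrightarrow>
     (\<exists>L C. quasi_isometry L C Y dY X dX fbar) \<and>
     (\<exists>K. \<forall>x\<in>X. dX (fbar (f x)) x \<le> K) \<and>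
     (\<exists>K. \<forall>y\<in>Y. dY (f (fbar y)) y \<le> K)"

text \<open>The Hausdorff distance of two subsets may be infinite.\<close>
definition hausdorff_dist :: "('a \<Rightarrow> 'a \<Rightarrow> real) \<Rightarrow> 'a set \<Rightarrow> 'a set \<Rightarrow> ereal" where
  "hausdorff_dist d A B =
     (INF r \<in> {r::real. r \<ge> 0 \<and> (\<forall>a\<in>A. \<exists>b\<in>B. d a b \<le> r) \<and> (\<forall>b\<in>B. \<exists>a\<in>A. d a b \<le> r)}. ereal r)"


section \<open>Quasi-isometries of pairs and uniform quasi-actions\<close>

definition left_cosets :: "('a, 'm) monoid_scheme \<Rightarrow> 'a set set \<Rightarrow> 'a set set" where
  "left_cosets G \<P> = (\<Union>P\<in>\<P>. lcosets\<^bsub>G\<^esub> P)"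

text \<open>\<open>A\<close> and \<open>B\<close> are the finite generating sets of \<open>G\<close> and \<open>H\<close> defining the word metrics.\<close>
definition coset_relation ::
  "('a, 'm) monoid_scheme \<Rightarrow> 'a set set \<Rightarrow> ('b, 'n) monoid_scheme \<Rightarrow> 'b set \<Rightarrow> 'b set set
    \<Rightarrow> real \<Rightarrow> ('a \<Rightarrow> 'b) \<Rightarrow> ('a set \<times> 'b set) set"
where
  "coset_relation G \<P> H B \<Q> M q =
     {(X, Y) \<in> left_cosets G \<P> \<times> left_cosets H \<Q>. hausdorff_dist (word_dist H B) (q ` X) Y < ereal M}"

definition quasi_isometry_of_pairs_const ::
  "real \<Rightarrow> real \<Rightarrow> real \<Rightarrow> ('a, 'm) monoid_scheme \<Rightarrow> 'a set \<Rightarrow> 'a set set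
    \<Rightarrow> ('b, 'n) monoid_scheme \<Rightarrow> 'b set \<Rightarrow> 'b set set \<Rightarrow> ('a \<Rightarrow> 'b) \<Rightarrow> bool"
where
  "quasi_isometry_of_pairs_const L C M G A \<P> H B \<Q> q \<longleftrightarrow>
     quasi_isometry L C (carrier G) (word_dist G A) (carrier H) (word_dist H B) q \<and>
     Domain (coset_relation G \<P> H B \<Q> M q) = left_cosets G \<P> \<and>
     Range (coset_relation G \<P> H B \<Q> M q) = left_cosets H \<Q>"

definition quasi_isometry_of_pairs ::
  "('a, 'm) monoid_scheme \<Rightarrow> 'a set \<Rightarrow> 'a set set
    \<Rightarrow> ('b, 'n) monoid_scheme \<Rightarrow> 'b set \<Rightarrow> 'b set set \<Rightarrow> ('a \<Rightarrow> 'b) \<Rightarrow> bool"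
where
  "quasi_isometry_of_pairs G A \<P> H B \<Q> q \<longleftrightarrow>
     (\<exists>L C M. quasi_isometry_of_pairs_const L C M G A \<P> H B \<Q> q)"

text \<open>The vertex set of the Cayley graph of \<open>H\<close> with respect to \<open>T\<close> is the carrier of \<open>H\<close>, and
  its path metric there is the word metric of \<open>T\<close>.\<close>
definition uniform_quasi_action ::
  "('a, 'm) monoid_scheme \<Rightarrow> ('b, 'n) monoid_scheme \<Rightarrow> 'b set \<Rightarrow> ('a \<Rightarrow> 'b) \<Rightarrow> ('b \<Rightarrow> 'a) \<Rightarrow> bool"
where
  "uniform_quasi_action G H T q qbar \<longleftrightarrow>
     (\<exists>L C. \<forall>g\<in>carrier G.
        quasi_isometry L C (carrier H) (word_dist H T) (carrier H) (word_dist H T)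
          (\<lambda>h. q (g \<otimes>\<^bsub>G\<^esub> qbar h)))"


section \<open>Commensurators and refinements\<close>

definition conjugate_by :: "('a, 'm) monoid_scheme \<Rightarrow> 'a \<Rightarrow> 'a set \<Rightarrow> 'a set" where
  "conjugate_by G g P = g <#\<^bsub>G\<^esub> P #>\<^bsub>G\<^esub> inv\<^bsub>G\<^esub> g"

definition finite_index_in :: "('a, 'm) monoid_scheme \<Rightarrow> 'a set \<Rightarrow> 'a set \<Rightarrow> bool" where
  "finite_index_in G K P \<longleftrightarrow>
     subgroup K (G\<lparr>carrier := P\<rparr>) \<and> finite (lcosets\<^bsub>G\<lparr>carrier := P\<rparr>\<^esub> K)"

definition commensurator :: "('a, 'm) monoid_scheme \<Rightarrow> 'a set \<Rightarrow> 'a set" where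
  "commensurator G P =
     {g \<in> carrier G. finite_index_in G (P \<inter> conjugate_by G g P) P
                   \<and> finite_index_in G (P \<inter> conjugate_by G g P) (conjugate_by G g P)}"

definition commensurators_of_conjugates ::
  "('a, 'm) monoid_scheme \<Rightarrow> 'a set set \<Rightarrow> 'a set set" where
  "commensurators_of_conjugates G \<P> =
     {commensurator G (conjugate_by G g P) | g P. g \<in> carrier G \<and> P \<in> \<P>}"

definition is_refinement ::
  "('a, 'm) monoid_scheme \<Rightarrow> 'a set set \<Rightarrow> 'a set set \<Rightarrow> bool" where
  "is_refinement G \<P> \<R> \<longleftrightarrow>
     \<R> \<subseteq> commensurators_of_conjugates G \<P> \<and>
     (\<forall>K \<in> commensurators_of_conjugates G \<P>.
        \<exists>!R. R \<in> \<R> \<and> (\<exists>g\<in>carrier G. R = conjugate_by G g K))"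


section \<open>Hyperbolicity and fineness of graphs\<close>

text \<open>A graph is represented by a symmetric digraph. Its path metric is the shortest-path
  distance \<open>\<mu>\<close> for unit arc costs, which is \<open>\<infinity>\<close> between different components.\<close>
definition graph_dist :: "('v, 'e) pre_digraph \<Rightarrow> 'v \<Rightarrow> 'v \<Rightarrow> ereal" where
  "graph_dist \<Gamma> u v = wf_digraph.\<mu> \<Gamma> (\<lambda>_. 1) u v"

definition geodesic :: "('v, 'e) pre_digraph \<Rightarrow> 'v \<Rightarrow> 'e list \<Rightarrow> 'v \<Rightarrow> bool" where
  "geodesic \<Gamma> u p v \<longleftrightarrow>
     pre_digraph.awalk \<Gamma> u p v \<and> graph_dist \<Gamma> u v = ereal (real (length p))"

text \<open>Geodesic triangles are \<open>\<delta>\<close>-slim. Only the side \<open>p\<close> is mentioned since the condition for the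
  other two sides arises by rotating the triangle. Restricting to triangles with corners at
  vertices, and to the vertices on their sides, affects only the value of \<open>\<delta>\<close>.\<close>
definition hyperbolic_graph :: "('v, 'e) pre_digraph \<Rightarrow> bool" where
  "hyperbolic_graph \<Gamma> \<longleftrightarrow>
     (\<exists>\<delta>::real. \<forall>x y z p q r.
        geodesic \<Gamma> x p y \<and> geodesic \<Gamma> y q z \<and> geodesic \<Gamma> z r x \<longrightarrow>
        (\<forall>u \<in> set (pre_digraph.awalk_verts \<Gamma> x p).
           \<exists>v \<in> set (pre_digraph.awalk_verts \<Gamma> y q) \<union> set (pre_digraph.awalk_verts \<Gamma> z r).
             graph_dist \<Gamma> u v \<le> ereal \<delta>))"

definition angle :: "('v, 'e) pre_digraph \<Rightarrow> 'v \<Rightarrow> 'v \<Rightarrow> 'v \<Rightarrow> ereal" where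
  "angle \<Gamma> v x y = graph_dist (pre_digraph.del_vert \<Gamma> v) x y"

definition fine_at :: "('v, 'e) pre_digraph \<Rightarrow> 'v \<Rightarrow> bool" where
  "fine_at \<Gamma> v \<longleftrightarrow>
     (\<forall>x \<in> {x. v \<rightarrow>\<^bsub>\<Gamma>\<^esub> x}. \<forall>r::real. finite {y \<in> {y. v \<rightarrow>\<^bsub>\<Gamma>\<^esub> y}. angle \<Gamma> v x y \<le> ereal r})"


section \<open>Hyperbolically embedded collections of subgroups\<close>

definition coned_off_arcs ::
  "('a, 'm) monoid_scheme \<Rightarrow> 'a set set \<Rightarrow> 'a set \<Rightarrow> ('a + 'a set) rel" where
  "coned_off_arcs G \<P> S =
     {(Inl g, Inl (g \<otimes>\<^bsub>G\<^esub> s)) | g s. g \<in> carrier G \<and> s \<in> S} \<union>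
     {(Inl x, Inr X) | x X. X \<in> left_cosets G \<P> \<and> x \<in> X}"

text \<open>Each edge is represented by the two arcs joining its endpoints. If \<open>S\<close> contains the
  identity, there are loops at the vertices \<open>Inl g\<close>; they affect neither distances nor angles at
  cone vertices.\<close>
definition coned_off_cayley_graph ::
  "('a, 'm) monoid_scheme \<Rightarrow> 'a set set \<Rightarrow> 'a set \<Rightarrow> ('a + 'a set) pair_pre_digraph" where
  "coned_off_cayley_graph G \<P> S =
     \<lparr> pverts = Inl ` carrier G \<union> Inr ` left_cosets G \<P>,
       parcs = coned_off_arcs G \<P> S \<union> (coned_off_arcs G \<P> S)\<inverse> \<rparr>"

definition hyperbolically_embedded_wrt ::
  "('a, 'm) monoid_scheme \<Rightarrow> 'a set set \<Rightarrow> 'a set \<Rightarrow> bool" where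
  "hyperbolically_embedded_wrt G \<P> S \<longleftrightarrow>
     (\<forall>P\<in>\<P>. subgroup P G \<and> infinite P) \<and> S \<subseteq> carrier G \<and>
     Digraph_Component.connected (with_proj (coned_off_cayley_graph G \<P> S)) \<and>
     hyperbolic_graph (with_proj (coned_off_cayley_graph G \<P> S)) \<and>
     (\<forall>X \<in> left_cosets G \<P>. fine_at (with_proj (coned_off_cayley_graph G \<P> S)) (Inr X))"

definition hyperbolically_embedded :: "('a, 'm) monoid_scheme \<Rightarrow> 'a set set \<Rightarrow> bool" where
  "hyperbolically_embedded G \<P> \<longleftrightarrow> (\<exists>S. hyperbolically_embedded_wrt G \<P> S)"

text \<open>The coned-off Cayley graph satisfies the locale assumptions under which the graph notions
  above have their intended meaning.\<close>
lemma coned_off_cayley_graph_sym_digraph: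
  assumes "group G" "\<And>P. P \<in> \<P> \<Longrightarrow> subgroup P G" "S \<subseteq> carrier G"
  shows "pair_sym_digraph (coned_off_cayley_graph G \<P> S)"
proof -
  interpret group G by fact
  let ?\<Gamma> = "coned_off_cayley_graph G \<P> S"
  have cosets: "X \<subseteq> carrier G" if X: "X \<in> left_cosets G \<P>" for X
  proof -
    from X obtain P where "P \<in> \<P>" "X \<in> lcosets\<^bsub>G\<^esub> P"
      unfolding left_cosets_def by blast
    then show ?thesis using assms(2) subgroup.lcosets_carrier[OF _ assms(1)] by metis
  qed
  have arcs: "coned_off_arcs G \<P> S \<subseteq> pverts ?\<Gamma> \<times> pverts ?\<Gamma>"
  proof
    fix e assume "e \<in> coned_off_arcs G \<P> S"
    then consider g s where "e = (Inl g, Inl (g \<otimes>\<^bsub>G\<^esub> s))" "g \<in> carrier G" "s \<in> S"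
      | x X where "e = (Inl x, Inr X)" "X \<in> left_cosets G \<P>" "x \<in> X"
      unfolding coned_off_arcs_def by blast
    then show "e \<in> pverts ?\<Gamma> \<times> pverts ?\<Gamma>"
    proof cases
      case 1
      moreover from this assms(3) have "g \<otimes>\<^bsub>G\<^esub> s \<in> carrier G" by blast
      ultimately show ?thesis by (simp add: coned_off_cayley_graph_def)
    next
      case 2
      moreover from this cosets have "x \<in> carrier G" by blast
      ultimately show ?thesis by (simp add: coned_off_cayley_graph_def)
    qed
  qed
  have parcs: "parcs ?\<Gamma> = coned_off_arcs G \<P> S \<union> (coned_off_arcs G \<P> S)\<inverse>"
    by (simp add: coned_off_cayley_graph_def)
  have sub: "parcs ?\<Gamma> \<subseteq> pverts ?\<Gamma> \<times> pverts ?\<Gamma>"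
    unfolding parcs using arcs by blast
  show ?thesis
  proof
    show "fst e \<in> pverts ?\<Gamma>" "snd e \<in> pverts ?\<Gamma>" if "e \<in> parcs ?\<Gamma>" for e
      using sub that by (metis (no_types) mem_Times_iff subsetD)+
    show "symmetric (with_proj ?\<Gamma>)"
      unfolding symmetric_def with_proj_simps(3) parcs by (rule sym_Un_converse)
  qed
qed

end

theory Submission
  imports Defs
begin

text \<open>The set \<open>S\<close> that witnesses the conclusion is pulled back from \<open>T\<close>: it consists of those \<open>s\<close> for which
\<open>q s\<close> is close to \<open>q \<one>\<close> in the word metric of \<open>T\<close>. Uniformity of the quasi-action says that
left translation of \<open>G\<close> increases the function \<open>(x, y) \<mapsto> dist\<^sub>T (q x) (q y)\<close> at most by a fixed factor and a fixed summand,
so that \<open>inv x \<otimes> y \<in> S\<close> amounts to \<open>q x\<close> and \<open>q y\<close> being at bounded \<open>T\<close>-distance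
(\<open>pulled_back_generators\<close>). Hence \<open>q\<close> is a quasi-isometry from the Cayley graph of \<open>S\<close> to that
of \<open>T\<close>.

It has to be extended to cone vertices. Call two subsets of a finitely generated group coarsely
equal if their Hausdorff distance in the word metric is finite. Fineness at a cone vertex \<open>hQ\<close> forces
distinct cosets in \<open>H/\<Q>\<close> to be coarsely distinct, since otherwise infinitely many elements of \<open>hQ\<close>
would be joined by short detours through the other cone vertex
(\<open>H_cosets_coarsely_equal_imp_eq\<close>). Therefore every coset in \<open>G/\<P>\<close> belongs to exactly one coset in
\<open>H/\<Q>\<close>, and coarsely equal cosets in \<open>G/\<P>\<close> are close with one common constant.
The commensurator of \<open>gPg\<inverse>\<close> is the stabiliser of the coarse class of \<open>gP\<close>
(\<open>commensurators_of_conjugates_eq\<close>), and the common constant shows that it is itself coarsely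
equal to \<open>gP\<close>. So every coset in \<open>G/\<P>\<close> is coarsely equal to exactly one coset of the
refinement, which yields a bijection \<open>G/\<P>\<^sup>* \<rightarrow> H/\<Q>\<close> (\<open>coset_correspondence\<close>).

Sending group elements by \<open>q\<close> and cone vertices by this bijection is a quasi-isometry of
coned-off Cayley graphs, so connectedness and hyperbolicity carry over (locale
\<open>graph_quasi_isometry\<close>). Because the map is injective on cone vertices, it takes a
path that avoids one cone vertex to a path of comparable length that avoids the corresponding cone
vertex, and fineness carries over as well.

Quasi-isometry invariance of hyperbolicity is derived from Bowditch's criterion of guessing
geodesics (locale \<open>guessed_geodesics\<close>), applied to preimages of neighbourhoods of
geodesics. This replaces the stability of quasi-geodesics and works entirely with distances in
\<open>nat\<close>.\<close>

section \<open>Guessing geodesics\<close>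

text \<open>The sequence \<open>c 0, \<dots>, c n\<close> lists the vertices of a geodesic. Only distances are mentioned, so that the
criterion below applies to any integer-valued pseudometric.\<close>
definition isometric_path :: "'v set \<Rightarrow> ('v \<Rightarrow> 'v \<Rightarrow> nat) \<Rightarrow> (nat \<Rightarrow> 'v) \<Rightarrow> nat \<Rightarrow> bool" where
  "isometric_path V d c n \<longleftrightarrow>
     (\<forall>i\<le>n. c i \<in> V) \<and> (\<forall>j\<le>n. \<forall>i\<le>j. d (c i) (c j) = j - i)"

definition slim_triangles :: "'v set \<Rightarrow> ('v \<Rightarrow> 'v \<Rightarrow> nat) \<Rightarrow> nat \<Rightarrow> bool" where
  "slim_triangles V d \<delta> \<longleftrightarrow>
     (\<forall>a l b m c n. isometric_path V d a l \<and> isometric_path V d b m \<and> isometric_path V d c n \<and>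
        a l = b 0 \<and> b m = c 0 \<and> c n = a 0 \<longrightarrow>
        (\<forall>i\<le>l. (\<exists>j\<le>m. d (a i) (b j) \<le> \<delta>) \<or> (\<exists>j\<le>n. d (a i) (c j) \<le> \<delta>)))"

lemma slim_trianglesD:
  assumes "slim_triangles V d \<delta>" "isometric_path V d a l" "isometric_path V d b m"
    "isometric_path V d c n" "a l = b 0" "b m = c 0" "c n = a 0" "i \<le> l"
  shows "(\<exists>j\<le>m. d (a i) (b j) \<le> \<delta>) \<or> (\<exists>j\<le>n. d (a i) (c j) \<le> \<delta>)"
  using assms unfolding slim_triangles_def by blast

lemma exponential_beats_linear: "\<exists>N. \<forall>k\<ge>N. a * (k + 6) \<le> (2::nat) ^ k"
proof -
  define e :: nat where "e = 2 ^ a"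
  have a: "a \<le> e" unfolding e_def by (rule less_imp_le, rule less_exp)
  have "1 \<le> e" unfolding e_def by simp
  with a have "2 * a + 12 \<le> 64 * e" by linarith
  with a have "a * (2 * a + 12) \<le> e * (64 * e)" by (rule mult_le_mono)
  also have "\<dots> = 2 ^ (a + a + 6)" unfolding e_def power_add by simp
  also have "a + a + 6 = 2 * a + 6" by simp
  finally have base: "a * ((2 * a + 6) + 6) \<le> 2 ^ (2 * a + 6)" by (simp only: add.assoc) simp
  have "a * (k + 6) \<le> 2 ^ k" if "k \<ge> 2 * a + 6" for k
    using that
  proof (induction k rule: dec_induct)
    case base show ?case by fact
  next
    case (step k)
    have "a * (Suc k + 6) \<le> 2 * (a * (k + 6))" by (simp add: algebra_simps)
    also have "\<dots> \<le> 2 * 2 ^ k" using step.IH by (intro mult_le_mono2)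
    finally show ?case by (simp only: power_Suc)
  qed
  then show ?thesis by blast
qed

text \<open>A quantity \<open>t\<close> that is bounded by a multiple of the logarithm of a linear expression in \<open>t\<close> is
bounded. Here \<open>4 * t + 4 * h + 2\<close> and \<open>k + 3\<close> are the values that occur in
\<open>L_close_to_isometric_path\<close>.\<close>
lemma logarithmic_bound: "\<exists>R. \<forall>t>R. \<exists>k. 4 * t + 4 * h + 2 \<le> (2::nat) ^ k \<and> h * (k + 3) < t"
proof -
  obtain N where N: "\<And>k. k \<ge> N \<Longrightarrow> (4 * h + 4) * (k + 6) \<le> (2::nat) ^ k"
    using exponential_beats_linear[of "4 * h + 4"] by blast
  show ?thesis
  proof (rule exI, intro allI impI)
    fix t assume t: "t > (h + 1) * (N + 5)"
    define m where "m = t div (h + 1)"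
    have lo: "(h + 1) * m \<le> t" unfolding m_def by (rule times_div_less_eq_dividend)
    have hi: "t < (h + 1) * (m + 1)"
      unfolding m_def using dividend_less_times_div[of "h + 1" t] by simp
    have "(h + 1) * (N + 5) < (h + 1) * (m + 1)" using t hi by (rule less_trans)
    then have m: "m \<ge> N + 5" by (simp only: mult_less_cancel1) simp
    define k where "k = m - 4"
    have k: "m = k + 4" "k \<ge> N" using m by (auto simp: k_def)
    have "4 * t + 4 * h + 2 \<le> (4 * h + 4) * (k + 6)"
      using hi unfolding k by (simp add: algebra_simps)
    also have "\<dots> \<le> 2 ^ k" by (rule N) fact
    finally have "4 * t + 4 * h + 2 \<le> 2 ^ k" .
    moreover have "h * (k + 3) < t" using lo unfolding k by (simp add: algebra_simps)
    ultimately show "\<exists>k. 4 * t + 4 * h + 2 \<le> 2 ^ k \<and> h * (k + 3) < t" by blast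
  qed
qed

locale nat_pseudometric =
  fixes V :: "'v set" and d :: "'v \<Rightarrow> 'v \<Rightarrow> nat"
  assumes refl: "x \<in> V \<Longrightarrow> d x x = 0"
    and sym: "x \<in> V \<Longrightarrow> y \<in> V \<Longrightarrow> d x y = d y x"
    and tri: "x \<in> V \<Longrightarrow> y \<in> V \<Longrightarrow> z \<in> V \<Longrightarrow> d x z \<le> d x y + d y z"
begin

lemma isometric_path_in: "isometric_path V d c n \<Longrightarrow> i \<le> n \<Longrightarrow> c i \<in> V"
  by (simp add: isometric_path_def)

lemma isometric_path_dist: "isometric_path V d c n \<Longrightarrow> i \<le> j \<Longrightarrow> j \<le> n \<Longrightarrow> d (c i) (c j) = j - i"
  by (simp add: isometric_path_def)

lemma isometric_path_rev:
  assumes "isometric_path V d c n"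
  shows "isometric_path V d (\<lambda>i. c (n - i)) n"
proof -
  have "d (c (n - i)) (c (n - j)) = j - i" if "i \<le> j" "j \<le> n" for i j
    using that isometric_path_dist[OF assms, of "n - j" "n - i"]
      sym[of "c (n - i)" "c (n - j)"] isometric_path_in[OF assms, of "n - i"] isometric_path_in[OF assms, of "n - j"]
    by simp
  with assms show ?thesis by (simp add: isometric_path_def)
qed

end

text \<open>\<open>L x y\<close> is a guess for a neighbourhood of a geodesic from \<open>x\<close> to \<open>y\<close>. Bowditch's criterion demands
connected sets; chains with jumps of length at most \<open>h\<close> are as good and are what a
quasi-isometry preserves.\<close>
locale guessed_geodesics = nat_pseudometric V d
  for V :: "'v set" and d :: "'v \<Rightarrow> 'v \<Rightarrow> nat" +
  fixes L :: "'v \<Rightarrow> 'v \<Rightarrow> 'v set" and h :: nat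
  assumes L_subset: "x \<in> V \<Longrightarrow> y \<in> V \<Longrightarrow> L x y \<subseteq> V"
    and L_slim: "x \<in> V \<Longrightarrow> y \<in> V \<Longrightarrow> z \<in> V \<Longrightarrow> v \<in> L x y \<Longrightarrow> \<exists>u \<in> L x z \<union> L z y. d u v \<le> h"
    and L_small: "x \<in> V \<Longrightarrow> y \<in> V \<Longrightarrow> d x y \<le> 1 \<Longrightarrow> v \<in> L x y \<Longrightarrow> d x v \<le> h"
    and L_chain: "x \<in> V \<Longrightarrow> y \<in> V \<Longrightarrow> \<exists>e m. e 0 = x \<and> e m = y \<and> (\<forall>i\<le>m. e i \<in> L x y) \<and> (\<forall>i<m. d (e i) (e (Suc i)) \<le> h)"
begin

lemma L_in: "x \<in> V \<Longrightarrow> y \<in> V \<Longrightarrow> v \<in> L x y \<Longrightarrow> v \<in> V"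
  using L_subset by blast

text \<open>Halving the parameter interval costs one application of slimness, hence the summand \<open>h\<close>, per
step; an interval of length \<open>n\<close> is used up after about \<open>log n\<close> steps.\<close>
lemma L_logarithmically_close:
  assumes c: "isometric_path V d c n"
  shows "a \<le> b \<Longrightarrow> b \<le> n \<Longrightarrow> b - a \<le> 2 ^ k \<Longrightarrow> v \<in> L (c a) (c b) \<Longrightarrow>
    \<exists>i. a \<le> i \<and> i \<le> b \<and> d v (c i) \<le> h * (k + 1)"
proof (induction k arbitrary: a b v)
  case 0
  then have V: "c a \<in> V" "c b \<in> V" using isometric_path_in[OF c] by auto
  have "d (c a) (c b) \<le> 1" using isometric_path_dist[OF c] 0 by simp
  with V 0 have "d (c a) v \<le> h" using L_small by blast
  moreover have "v \<in> V" using L_in[OF V 0(4)] .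
  ultimately have "d v (c a) \<le> h * (0 + 1)" using sym[OF V(1)] by simp
  then show ?case using 0 by blast
next
  case (Suc k)
  define m where "m = (a + b) div 2"
  have m: "a \<le> m" "m \<le> b" "m - a \<le> 2 ^ k" "b - m \<le> 2 ^ k" "m \<le> n"
    using Suc.prems unfolding m_def by auto
  have V: "c a \<in> V" "c b \<in> V" "c m \<in> V" using isometric_path_in[OF c] Suc.prems m by auto
  have vV: "v \<in> V" using L_in V Suc.prems by blast
  obtain u where u: "u \<in> L (c a) (c m) \<union> L (c m) (c b)" "d u v \<le> h"
    using L_slim[OF V Suc.prems(4)] by blast
  have uV: "u \<in> V" using u V L_in by blast
  have "\<exists>i. a \<le> i \<and> i \<le> b \<and> d u (c i) \<le> h * (k + 1)"
    using u(1)
  proof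
    assume "u \<in> L (c a) (c m)"
    from Suc.IH[OF m(1) m(5) m(3) this] m show ?thesis by auto
  next
    assume "u \<in> L (c m) (c b)"
    from Suc.IH[OF m(2) Suc.prems(2) m(4) this] m show ?thesis by (meson order_trans)
  qed
  then obtain i where i: "a \<le> i" "i \<le> b" "d u (c i) \<le> h * (k + 1)" by blast
  have ciV: "c i \<in> V" using isometric_path_in[OF c] i Suc.prems by auto
  have "d v (c i) \<le> d v u + d u (c i)" using tri vV uV ciV by blast
  also have "\<dots> \<le> h * (Suc k + 1)" using u(2) i(3) sym[OF uV vV] by simp
  finally show ?case using i by blast
qed

text \<open>Bootstrapping turns the logarithmic bound into a constant one. If \<open>v\<close> is as far from the geodesic as
possible, at distance \<open>t\<close> realised at \<open>c w\<close>, cut the geodesic at two points \<open>c p\<close>, \<open>c q\<close> at distance slightly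
more than \<open>2 * t\<close> from \<open>c w\<close>. By slimness \<open>v\<close> is near a guessed set of one of the three pieces. The outer
pieces are too far away, and the middle one has length linear in \<open>t\<close>, so that \<open>t\<close> is at most
logarithmic in \<open>t\<close>.\<close>
lemma L_close_to_isometric_path:
  "\<exists>R. \<forall>c n a b v. isometric_path V d c n \<longrightarrow> a \<le> b \<longrightarrow> b \<le> n \<longrightarrow> v \<in> L (c a) (c b) \<longrightarrow>
     (\<exists>i. a \<le> i \<and> i \<le> b \<and> d v (c i) \<le> R)"
proof -
  obtain R0 where R0: "\<forall>t>R0. \<exists>k. 4 * t + 4 * h + 2 \<le> (2::nat) ^ k \<and> h * (k + 3) < t"
    using logarithmic_bound[of h] ..
  define R where "R = R0 + 3 * h"
  have main: "\<exists>i. a \<le> i \<and> i \<le> b \<and> d v (c i) \<le> R"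
    if c: "isometric_path V d c n" and ab: "a \<le> b" "b \<le> n" and v: "v \<in> L (c a) (c b)" for c n a b v
  proof (rule ccontr)
    assume far: "\<not> ?thesis"
    define P where "P t \<longleftrightarrow> (\<exists>a b v. a \<le> b \<and> b \<le> n \<and> v \<in> L (c a) (c b) \<and>
       (\<forall>i. a \<le> i \<and> i \<le> b \<longrightarrow> t \<le> d v (c i)))" for t
    have bounded: "t \<le> h * (n + 1)" if s: "P t" for t
    proof -
      obtain a b v where *: "a \<le> b" "b \<le> n" "v \<in> L (c a) (c b)" "\<forall>i. a \<le> i \<and> i \<le> b \<longrightarrow> t \<le> d v (c i)"
        using s[unfolded P_def] by (elim exE conjE)
      have "b - a \<le> n" using *(2) by simp
      also have "n \<le> 2 ^ n" by (rule less_imp_le, rule less_exp)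
      finally have "b - a \<le> 2 ^ n" .
      then obtain i where "a \<le> i" "i \<le> b" "d v (c i) \<le> h * (n + 1)"
        using L_logarithmically_close[OF c *(1,2) _ *(3)] by blast
      with *(4) show ?thesis by fastforce
    qed
    then have bnd: "\<forall>t. P t \<longrightarrow> t \<le> h * (n + 1)" by blast
    have "R + 1 \<le> d v (c i)" if "a \<le> i" "i \<le> b" for i
      using far that by (fastforce simp: not_le)
    then have PR: "P (R + 1)" unfolding P_def using ab v
      by (intro exI[of _ a] exI[of _ b] exI[of _ v]) simp
    \<comment> \<open>Work at a pair of parameters for which the guessed set strays as far as possible.\<close>
    define t where "t = (GREATEST t. P t)"
    have Pt: "P t" unfolding t_def by (rule GreatestI_nat[where b = "h * (n + 1)"]) (use PR bnd in auto)
    have t_max: "s \<le> t" if "P s" for s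
      unfolding t_def by (rule Greatest_le_nat[where b = "h * (n + 1)"]) (use that bnd in auto)
    have tR: "t > R" using t_max[OF PR] by simp
    obtain a b v where ab: "a \<le> b" "b \<le> n" and v: "v \<in> L (c a) (c b)"
      and "\<forall>i. a \<le> i \<and> i \<le> b \<longrightarrow> t \<le> d v (c i)"
      using Pt[unfolded P_def] by (elim exE conjE)
    then have far: "\<And>i. a \<le> i \<Longrightarrow> i \<le> b \<Longrightarrow> t \<le> d v (c i)" by simp
    have near: "\<exists>i. a' \<le> i \<and> i \<le> b' \<and> d u (c i) \<le> t" if "a' \<le> b'" "b' \<le> n" "u \<in> L (c a') (c b')" for a' b' u
    proof (rule ccontr)
      assume "\<not> ?thesis"
      then have "\<forall>i. a' \<le> i \<and> i \<le> b' \<longrightarrow> Suc t \<le> d u (c i)" by (fastforce simp: not_le)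
      then have "P (Suc t)" unfolding P_def using that
        by (intro exI[of _ a'] exI[of _ b'] exI[of _ u]) simp
      with t_max[of "Suc t"] show False by simp
    qed
    obtain w where w: "a \<le> w" "w \<le> b" "d v (c w) \<le> t" using near[OF ab v] by blast
    define p where "p = max a (w - (2 * t + 2 * h + 1))"
    define q where "q = min b (w + (2 * t + 2 * h + 1))"
    have pq: "a \<le> p" "p \<le> w" "w \<le> q" "q \<le> b" "p \<le> q" "p \<le> b" "p \<le> n" "q \<le> n"
      "q - p \<le> 4 * t + 4 * h + 2"
      using w ab unfolding p_def q_def by auto
    have cV: "c i \<in> V" if "i \<le> b" for i using isometric_path_in[OF c] that ab by auto
    have V: "c a \<in> V" "c b \<in> V" "c p \<in> V" "c q \<in> V" "c w \<in> V" using cV pq w ab by auto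
    have vV: "v \<in> V" using L_in V v by blast
    \<comment> \<open>A point of the guessed set between \<open>c a\<close> and \<open>c p\<close> near \<open>v\<close> is impossible: either the
      interval is degenerate or \<open>c p\<close> lies too far away from \<open>c w\<close>.\<close>
    have left: False if u: "u \<in> L (c a) (c p)" "d v u \<le> 2 * h" for u
    proof -
      have uV: "u \<in> V" using u L_in V by blast
      show False
      proof (cases "p = a")
        case True
        have "d (c a) u \<le> h" using L_small[OF V(1) V(1)] u True refl[OF V(1)] by simp
        then have "d v (c a) \<le> 3 * h" using tri[OF vV uV V(1)] sym[OF V(1) uV] u(2) by linarith
        with far[of a] tR ab show False unfolding R_def by simp
      next
        case False
        then have pw: "p = w - (2 * t + 2 * h + 1)" "w > 2 * t + 2 * h + 1" using w pq(1) unfolding p_def by linarith+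
        obtain i where i: "a \<le> i" "i \<le> p" "d u (c i) \<le> t" using near[OF pq(1) pq(7) u(1)] by blast
        have ciV: "c i \<in> V" using cV i pq by auto
        have "d (c i) (c w) = w - i" using isometric_path_dist[OF c, of i w] i pq w ab by auto
        moreover have "d (c i) (c w) \<le> d (c i) u + d u v + d v (c w)"
          using tri[OF ciV uV V(5)] tri[OF uV vV V(5)] by linarith
        moreover have "d (c i) u \<le> t" "d u v \<le> 2 * h"
          using i u sym[OF ciV uV] sym[OF uV vV] by simp_all
        ultimately show False using pw i w by linarith
      qed
    qed
    have right: False if u: "u \<in> L (c q) (c b)" "d v u \<le> 2 * h" for u
    proof -
      have uV: "u \<in> V" using u L_in V by blast
      show False
      proof (cases "q = b")
        case True
        have "d (c b) u \<le> h" using L_small[OF V(2) V(2)] u True refl[OF V(2)] by simp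
        then have "d v (c b) \<le> 3 * h" using tri[OF vV uV V(2)] sym[OF V(2) uV] u(2) by linarith
        with far[of b] tR ab show False unfolding R_def by simp
      next
        case False
        then have qw: "q = w + (2 * t + 2 * h + 1)" using pq(4) unfolding q_def by linarith
        obtain i where i: "q \<le> i" "i \<le> b" "d u (c i) \<le> t" using near[OF pq(4) ab(2) u(1)] by blast
        have ciV: "c i \<in> V" using cV i pq by auto
        have "d (c w) (c i) = i - w" using isometric_path_dist[OF c, of w i] i pq w ab by auto
        moreover have "d (c w) (c i) \<le> d (c w) v + d v u + d u (c i)"
          using tri[OF V(5) uV ciV] tri[OF V(5) vV uV] by linarith
        moreover have "d (c w) v \<le> t" "d v u \<le> 2 * h"
          using w u sym[OF vV V(5)] by simp_all
        ultimately show False using qw i w by linarith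
      qed
    qed
    obtain u where u: "u \<in> L (c a) (c p) \<union> L (c p) (c b)" "d u v \<le> h"
      using L_slim[OF V(1) V(2) V(3) v] by blast
    have uV: "u \<in> V" using u V L_in by blast
    have "u \<notin> L (c a) (c p)" using left[of u] u(2) sym[OF uV vV] by auto
    then have u': "u \<in> L (c p) (c b)" using u by blast
    obtain u2 where u2: "u2 \<in> L (c p) (c q) \<union> L (c q) (c b)" "d u2 u \<le> h"
      using L_slim[OF V(3) V(2) V(4) u'] by blast
    have u2V: "u2 \<in> V" using u2 V L_in by blast
    have vu2: "d v u2 \<le> 2 * h" using tri[OF vV uV u2V] sym[OF uV vV] sym[OF uV u2V] u u2 by linarith
    have "u2 \<notin> L (c q) (c b)" using right[of u2] vu2 by auto
    then have u2': "u2 \<in> L (c p) (c q)" using u2 by blast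
    obtain k where k: "4 * t + 4 * h + 2 \<le> (2::nat) ^ k" "h * (k + 3) < t"
      using R0[rule_format, of t] tR unfolding R_def by auto
    obtain i where i: "p \<le> i" "i \<le> q" "d u2 (c i) \<le> h * (k + 1)"
      using L_logarithmically_close[OF c pq(5) pq(8) _ u2'] pq(9) k by force
    have ciV: "c i \<in> V" using cV i pq by auto
    have "d v (c i) \<le> 2 * h + h * (k + 1)" using tri[OF vV u2V ciV] vu2 i by linarith
    then have "d v (c i) < t" using k(2) by (simp add: algebra_simps)
    with far[of i] i pq show False by simp
  qed
  then show ?thesis by blast
qed

text \<open>Every point of the chain in \<open>L (c 0) (c n)\<close> is near the geodesic, either before or after \<open>c w\<close>. Where the
chain changes sides, two close points of the geodesic have \<open>c w\<close> between them.\<close>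
lemma isometric_path_close_to_L:
  "\<exists>R. \<forall>c n w. isometric_path V d c n \<longrightarrow> w \<le> n \<longrightarrow> (\<exists>u \<in> L (c 0) (c n). d u (c w) \<le> R)"
proof -
  obtain R where R: "\<And>c n a b v. isometric_path V d c n \<Longrightarrow> a \<le> b \<Longrightarrow> b \<le> n \<Longrightarrow> v \<in> L (c a) (c b) \<Longrightarrow>
     \<exists>i. a \<le> i \<and> i \<le> b \<and> d v (c i) \<le> R"
    using L_close_to_isometric_path by blast
  have "\<exists>u \<in> L (c 0) (c n). d u (c w) \<le> 3 * R + 4 * h"
    if c: "isometric_path V d c n" and w: "w \<le> n" for c n w
  proof -
    have cV: "c i \<in> V" if "i \<le> n" for i using isometric_path_in[OF c] that by auto
    obtain e m where e: "e 0 = c 0" "e m = c n" "\<And>i. i \<le> m \<Longrightarrow> e i \<in> L (c 0) (c n)"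
      "\<And>i. i < m \<Longrightarrow> d (e i) (e (Suc i)) \<le> h"
      using L_chain[OF cV[of 0] cV[of n]] by auto
    have eV: "e i \<in> V" if "i \<le> m" for i using L_in[OF cV[of 0] cV[of n] e(3)[OF that]] by simp
    define near_start where "near_start i \<longleftrightarrow> (\<exists>j\<le>w. d (e i) (c j) \<le> R + h)" for i
    define near_end where "near_end i \<longleftrightarrow> (\<exists>j\<le>n. w \<le> j \<and> d (e i) (c j) \<le> R + h)" for i
    have either: "near_start i \<or> near_end i" if i: "i \<le> m" for i
    proof -
      obtain u where u: "u \<in> L (c 0) (c w) \<union> L (c w) (c n)" "d u (e i) \<le> h"
        using L_slim[OF cV[of 0] cV[of n] cV[OF w] e(3)[OF i]] by auto
      have uV: "u \<in> V" using u L_in cV w by blast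
      have "(\<exists>j\<le>w. d u (c j) \<le> R) \<or> (\<exists>j\<le>n. w \<le> j \<and> d u (c j) \<le> R)"
        using u(1) R[OF c _ w, of 0 u] R[OF c w, of u] by auto
      moreover have "d (e i) (c j) \<le> R + h" if "d u (c j) \<le> R" "j \<le> n" for j
        using tri[OF eV[OF i] uV cV[OF that(2)]] sym[OF uV eV[OF i]] u(2) that(1) by linarith
      ultimately show ?thesis unfolding near_start_def near_end_def using w by (meson order_trans)
    qed
    \<comment> \<open>The chain starts near the first half and ends near the second half, hence it has two
      consecutive members that are near different halves.\<close>
    have "near_end m" unfolding near_end_def using e(2) refl[OF cV[of n]] w by auto
    define i where "i = (LEAST i. near_end i)"
    have i: "near_end i" "i \<le> m" unfolding i_def using \<open>near_end m\<close> by (auto intro: LeastI Least_le)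
    have "\<exists>i'\<le>m. near_start i' \<and> d (e i') (e i) \<le> h"
    proof (cases i)
      case 0
      have "near_start 0" unfolding near_start_def using e(1) refl[OF cV[of 0]] by auto
      then show ?thesis using 0 refl[OF eV[of 0]] by auto
    next
      case (Suc i')
      have "\<not> near_end i'" using Suc not_less_Least[of i' near_end] unfolding i_def by simp
      then have "near_start i'" using either[of i'] Suc i by auto
      then show ?thesis using Suc i e(4)[of i'] by (intro exI[of _ i']) auto
    qed
    then obtain i' where i': "i' \<le> m" "near_start i'" "d (e i') (e i) \<le> h" by blast
    obtain j where j: "j \<le> w" "d (e i') (c j) \<le> R + h" using i' unfolding near_start_def by blast
    obtain k where k: "w \<le> k" "k \<le> n" "d (e i) (c k) \<le> R + h" using i unfolding near_end_def by blast
    have V: "e i' \<in> V" "e i \<in> V" "c j \<in> V" "c k \<in> V" "c w \<in> V" using i' i j k w eV cV by auto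
    have "d (c j) (c k) \<le> d (c j) (e i') + d (e i') (e i) + d (e i) (c k)"
      using tri[OF V(3) V(1) V(4)] tri[OF V(1) V(2) V(4)] by linarith
    also have "\<dots> \<le> 2 * R + 3 * h" using j k i' sym[OF V(1) V(3)] by linarith
    finally have "d (c j) (c w) \<le> 2 * R + 3 * h"
      using isometric_path_dist[OF c, of j w] isometric_path_dist[OF c, of j k] j k w by simp
    then have "d (e i') (c w) \<le> 3 * R + 4 * h" using tri[OF V(1) V(3) V(5)] j by linarith
    then show ?thesis using e(3)[OF i'(1)] by blast
  qed
  then show ?thesis by blast
qed

lemma slim:
  "\<exists>\<delta>. slim_triangles V d \<delta>"
proof -
  obtain R where R: "\<And>c n a b v. isometric_path V d c n \<Longrightarrow> a \<le> b \<Longrightarrow> b \<le> n \<Longrightarrow> v \<in> L (c a) (c b) \<Longrightarrow>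
     \<exists>i. a \<le> i \<and> i \<le> b \<and> d v (c i) \<le> R"
    using L_close_to_isometric_path by blast
  obtain R' where R': "\<And>c n w. isometric_path V d c n \<Longrightarrow> w \<le> n \<Longrightarrow> \<exists>u \<in> L (c 0) (c n). d u (c w) \<le> R'"
    using isometric_path_close_to_L by blast
  have "(\<exists>j\<le>m. d (a i) (b j) \<le> R + R' + h) \<or> (\<exists>j\<le>n. d (a i) (c j) \<le> R + R' + h)"
    if a: "isometric_path V d a l" and b: "isometric_path V d b m" and c: "isometric_path V d c n"
      and ends: "a l = b 0" "b m = c 0" "c n = a 0" and i: "i \<le> l" for a l b m c n i
  proof -
    have V: "a 0 \<in> V" "a l \<in> V" "b m \<in> V" "a i \<in> V" "c n \<in> V" "b 0 \<in> V"
      using isometric_path_in[OF a] isometric_path_in[OF b] isometric_path_in[OF c] i by auto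
    obtain u where u: "u \<in> L (a 0) (a l)" "d u (a i) \<le> R'" using R'[OF a i] by blast
    obtain v where v: "v \<in> L (a 0) (b m) \<union> L (b m) (a l)" "d v u \<le> h"
      using L_slim[OF V(1) V(2) V(3) u(1)] by blast
    have uv: "u \<in> V" "v \<in> V" using u v V L_in by blast+
    have close: "d (a i) z \<le> R + R' + h" if "d v z \<le> R" "z \<in> V" for z
      using tri[OF V(4) uv(1) that(2)] tri[OF uv that(2)] sym[OF uv] sym[OF uv(1) V(4)] u(2) v(2) that(1)
      by linarith
    \<comment> \<open>The guessed sets are not assumed symmetric, so both other sides are read backwards.\<close>
    show ?thesis using v(1)
    proof
      assume "v \<in> L (a 0) (b m)"
      then have "v \<in> L ((\<lambda>i. c (n - i)) 0) ((\<lambda>i. c (n - i)) n)" using ends by simp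
      from R[OF isometric_path_rev[OF c] _ _ this] obtain j where "j \<le> n" "d v (c (n - j)) \<le> R" by auto
      then show ?thesis using close[of "c (n - j)"] isometric_path_in[OF c, of "n - j"]
        by (intro disjI2 exI[of _ "n - j"]) simp
    next
      assume "v \<in> L (b m) (a l)"
      then have "v \<in> L ((\<lambda>i. b (m - i)) 0) ((\<lambda>i. b (m - i)) m)" using ends by simp
      from R[OF isometric_path_rev[OF b] _ _ this] obtain j where "j \<le> m" "d v (b (m - j)) \<le> R" by auto
      then show ?thesis using close[of "b (m - j)"] isometric_path_in[OF b, of "m - j"]
        by (intro disjI1 exI[of _ "m - j"]) simp
    qed
  qed
  then show ?thesis unfolding slim_triangles_def by blast
qed

end

section \<open>Hop distance and quasi-isometries of graphs\<close>

text \<open>Lengths of paths are tracked by a bound rather than exactly: bounds survive maps that replace edges by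
short paths, including edges that are collapsed to a point.\<close>
definition reach_within :: "'v rel \<Rightarrow> nat \<Rightarrow> 'v rel" where
  "reach_within E n = (\<Union>m\<le>n. E ^^ m)"

definition hop :: "'v rel \<Rightarrow> 'v \<Rightarrow> 'v \<Rightarrow> nat" where
  "hop E x y = (LEAST n. (x, y) \<in> E ^^ n)"

lemma reach_withinI: "(x, y) \<in> E ^^ m \<Longrightarrow> m \<le> n \<Longrightarrow> (x, y) \<in> reach_within E n"
  unfolding reach_within_def by auto

lemma reach_withinE:
  assumes "(x, y) \<in> reach_within E n"
  obtains m where "m \<le> n" "(x, y) \<in> E ^^ m"
  using assms unfolding reach_within_def by auto

lemma reach_within_mono: "(x, y) \<in> reach_within E m \<Longrightarrow> m \<le> n \<Longrightarrow> (x, y) \<in> reach_within E n"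
  by (meson reach_withinE reach_withinI order_trans)

lemma reach_within_refl: "(x, x) \<in> reach_within E n"
  by (rule reach_withinI[where m = 0]) auto

lemma reach_within_edge: "(x, y) \<in> E \<Longrightarrow> (x, y) \<in> reach_within E 1"
  by (rule reach_withinI[where m = 1]) auto

lemma reach_within_trans:
  assumes "(x, y) \<in> reach_within E m" "(y, z) \<in> reach_within E n"
  shows "(x, z) \<in> reach_within E (m + n)"
proof -
  obtain i j where "i \<le> m" "(x, y) \<in> E ^^ i" "j \<le> n" "(y, z) \<in> E ^^ j"
    using assms by (meson reach_withinE)
  then show ?thesis by (intro reach_withinI[where m = "i + j"]) (auto simp: relpow_add)
qed

lemma sym_relpow:
  assumes "sym E" shows "sym (E ^^ n)"
proof -
  have "(E ^^ n)\<inverse> = E ^^ n" using assms by (induction n) (simp_all add: converse_relcomp sym_conv_converse_eq relpow_commute)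
  then show ?thesis by (simp add: sym_conv_converse_eq)
qed

lemma reach_within_sym: "sym E \<Longrightarrow> (x, y) \<in> reach_within E n \<Longrightarrow> (y, x) \<in> reach_within E n"
  by (meson reach_withinE reach_withinI sym_relpow symD)

lemma reach_within_map:
  assumes edge: "\<And>u v. (u, v) \<in> E \<Longrightarrow> (f u, f v) \<in> reach_within F k"
    and xy: "(x, y) \<in> reach_within E n"
  shows "(f x, f y) \<in> reach_within F (k * n)"
proof -
  obtain m where m: "m \<le> n" "(x, y) \<in> E ^^ m" using xy by (rule reach_withinE)
  have "(f x, f y) \<in> reach_within F (k * m)" using m(2)
  proof (induction m arbitrary: y)
    case 0 then show ?case by (simp add: reach_within_refl)
  next
    case (Suc m)
    then obtain z where "(x, z) \<in> E ^^ m" "(z, y) \<in> E" by auto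
    then show ?case using reach_within_trans[OF Suc.IH edge] by (simp add: add.commute)
  qed
  then show ?thesis using m(1) by (simp add: reach_within_mono)
qed

lemma reach_within_rtrancl: "(x, y) \<in> reach_within E n \<Longrightarrow> (x, y) \<in> E\<^sup>*"
  by (meson reach_withinE relpow_imp_rtrancl)

lemma hop_relpow: "(x, y) \<in> E\<^sup>* \<Longrightarrow> (x, y) \<in> E ^^ hop E x y"
  unfolding hop_def by (rule LeastI_ex) (simp add: rtrancl_is_UN_relpow)

lemma hop_le: "(x, y) \<in> E ^^ n \<Longrightarrow> hop E x y \<le> n"
  unfolding hop_def by (rule Least_le)

lemma hop_le_iff: "(x, y) \<in> E\<^sup>* \<Longrightarrow> hop E x y \<le> n \<longleftrightarrow> (x, y) \<in> reach_within E n"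
  by (meson hop_le hop_relpow order_trans reach_withinE reach_withinI)

locale connected_relation =
  fixes V :: "'v set" and E :: "'v rel"
  assumes edges_in: "E \<subseteq> V \<times> V" and sym_edges: "sym E"
    and conn: "x \<in> V \<Longrightarrow> y \<in> V \<Longrightarrow> (x, y) \<in> E\<^sup>*"
begin

lemma hop_le_reach_within: "x \<in> V \<Longrightarrow> y \<in> V \<Longrightarrow> hop E x y \<le> n \<longleftrightarrow> (x, y) \<in> reach_within E n"
  by (intro hop_le_iff conn)

sublocale nat_pseudometric V "hop E"
proof
  show "hop E x x = 0" for x using hop_le[of x x 0 E] by simp
  show "hop E x y = hop E y x" if "x \<in> V" "y \<in> V" for x y
    using that hop_le_reach_within reach_within_sym[OF sym_edges] by (meson order_antisym order_refl)
  show "hop E x z \<le> hop E x y + hop E y z" if "x \<in> V" "y \<in> V" "z \<in> V" for x y z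
    using that hop_le_reach_within reach_within_trans by (meson order_refl)
qed

text \<open>A strict shortcut between two members of the chain would give a shortcut between its ends.\<close>
lemma shortest_chain_isometric:
  assumes c: "\<And>i. i \<le> n \<Longrightarrow> c i \<in> V" "\<And>i. i < n \<Longrightarrow> (c i, c (Suc i)) \<in> E" and n: "hop E (c 0) (c n) = n"
  shows "isometric_path V (hop E) c n"
proof -
  have le: "hop E (c i) (c j) \<le> j - i" if "i \<le> j" "j \<le> n" for i j
  proof (rule hop_le)
    show "(c i, c j) \<in> E ^^ (j - i)" unfolding relpow_fun_conv
      using that c(2) by (intro exI[of _ "\<lambda>m. c (i + m)"]) auto
  qed
  have "hop E (c i) (c j) = j - i" if "i \<le> j" "j \<le> n" for i j
    using le[OF that] le[of 0 i] le[of j n] that n c(1)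
      tri[of "c 0" "c i" "c n"] tri[of "c i" "c j" "c n"] by simp
  then show ?thesis using c(1) unfolding isometric_path_def by blast
qed

lemma isometric_path_exists:
  assumes "x \<in> V" "y \<in> V"
  shows "\<exists>c n. isometric_path V (hop E) c n \<and> c 0 = x \<and> c n = y"
proof -
  obtain c where c: "c 0 = x" "c (hop E x y) = y" "\<And>i. i < hop E x y \<Longrightarrow> (c i, c (Suc i)) \<in> E"
    using hop_relpow[OF conn[OF assms]] unfolding relpow_fun_conv by blast
  have "c i \<in> V" if "i \<le> hop E x y" for i
  proof (cases i)
    case 0 then show ?thesis using c assms by simp
  next
    case (Suc j) then show ?thesis using c(3)[of j] that edges_in by auto
  qed
  then have "isometric_path V (hop E) c (hop E x y)" using c by (intro shortest_chain_isometric) auto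
  then show ?thesis using c by blast
qed

end

text \<open>For graphs it suffices to control edges. Connectedness of the domain is a consequence, since edge
paths of the codomain are carried back by \<open>fbar\<close>.\<close>
locale graph_quasi_isometry = codomain: connected_relation V2 E2
  for V2 :: "'w set" and E2 :: "'w rel" +
  fixes V1 :: "'v set" and E1 :: "'v rel" and f :: "'v \<Rightarrow> 'w" and fbar :: "'w \<Rightarrow> 'v" and k :: nat
  assumes edges_in: "E1 \<subseteq> V1 \<times> V1" and sym_edges: "sym E1"
    and f_in: "u \<in> V1 \<Longrightarrow> f u \<in> V2" and fbar_in: "w \<in> V2 \<Longrightarrow> fbar w \<in> V1"
    and f_edge: "(u, v) \<in> E1 \<Longrightarrow> (f u, f v) \<in> reach_within E2 k"
    and fbar_edge: "(w, z) \<in> E2 \<Longrightarrow> (fbar w, fbar z) \<in> reach_within E1 k"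
    and fbar_f: "u \<in> V1 \<Longrightarrow> (fbar (f u), u) \<in> reach_within E1 k"
    and f_fbar: "w \<in> V2 \<Longrightarrow> (f (fbar w), w) \<in> reach_within E2 k"
begin

lemma reach_within_lift:
  assumes "u \<in> V1" "v \<in> V1" "(f u, f v) \<in> reach_within E2 n"
  shows "(u, v) \<in> reach_within E1 (k + k * n + k)"
  using reach_within_trans[OF reach_within_trans[OF reach_within_sym[OF sym_edges fbar_f]
        reach_within_map[of E2 fbar, OF fbar_edge]] fbar_f] assms by blast

sublocale domain: connected_relation V1 E1
proof
  show "E1 \<subseteq> V1 \<times> V1" "sym E1" by (fact edges_in, fact sym_edges)
  show "(u, v) \<in> E1\<^sup>*" if "u \<in> V1" "v \<in> V1" for u v
  proof -
    have "(f u, f v) \<in> reach_within E2 (hop E2 (f u) (f v))"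
      using codomain.hop_le_reach_within f_in that by blast
    from reach_within_lift[OF that this] show ?thesis by (rule reach_within_rtrancl)
  qed
qed

lemma hop_image_le: "u \<in> V1 \<Longrightarrow> v \<in> V1 \<Longrightarrow> hop E2 (f u) (f v) \<le> k * hop E1 u v"
  using codomain.hop_le_reach_within[OF f_in f_in] domain.hop_le_reach_within
    reach_within_map[of E1 f, OF f_edge] by (meson order_refl)

lemma hop_preimage_le:
  assumes "u \<in> V1" "v \<in> V1" "hop E2 (f u) (f v) \<le> n" shows "hop E1 u v \<le> k + k * n + k"
  using codomain.hop_le_reach_within[OF f_in f_in] domain.hop_le_reach_within
    reach_within_lift assms by meson

text \<open>The points that \<open>f\<close> sends close to some geodesic from \<open>f x\<close> to \<open>f y\<close> serve as guess for a geodesic from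
\<open>x\<close> to \<open>y\<close>. Slimness of these sets is slimness of triangles in the codomain, read through \<open>f\<close>.\<close>
lemma slim_triangles_domain:
  assumes "slim_triangles V2 (hop E2) \<delta>"
  shows "\<exists>\<delta>. slim_triangles V1 (hop E1) \<delta>"
proof -
  define L where "L x y = {v \<in> V1. \<exists>c n i. isometric_path V2 (hop E2) c n \<and> c 0 = f x \<and> c n = f y \<and>
    i \<le> n \<and> hop E2 (f v) (c i) \<le> k}" for x y
  define D where "D n = k + k * n + k" for n
  define h where "h = D (2 * k + \<delta> + 1)"
  have LI: "u \<in> L x y" if "u \<in> V1" "isometric_path V2 (hop E2) c n" "c 0 = f x" "c n = f y" "i \<le> n"
    "hop E2 (f u) (c i) \<le> k" for u x y c n i
    unfolding L_def using that by blast
  have D: "hop E1 u v \<le> h" if "u \<in> V1" "v \<in> V1" "hop E2 (f u) (f v) \<le> 2 * k + \<delta> + 1" for u v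
    unfolding h_def D_def using hop_preimage_le[OF that] .
  have lift: "\<exists>v\<in>V1. hop E2 (f v) w \<le> k" if "w \<in> V2" for w
    using that fbar_in f_fbar codomain.hop_le_reach_within f_in by meson
  have "guessed_geodesics V1 (hop E1) L h"
  proof
    show "L x y \<subseteq> V1" for x y unfolding L_def by blast
  next
    fix x y z v assume V: "x \<in> V1" "y \<in> V1" "z \<in> V1" and "v \<in> L x y"
    then obtain c n i where v: "v \<in> V1" and c: "isometric_path V2 (hop E2) c n" "c 0 = f x" "c n = f y"
      and i: "i \<le> n" "hop E2 (f v) (c i) \<le> k"
      unfolding L_def by blast
    obtain a l where a: "isometric_path V2 (hop E2) a l" "a 0 = f z" "a l = f x"
      using codomain.isometric_path_exists f_in V by metis
    obtain b m where b: "isometric_path V2 (hop E2) b m" "b 0 = f y" "b m = f z"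
      using codomain.isometric_path_exists f_in V by metis
    have ci: "c i \<in> V2" using codomain.isometric_path_in[OF c(1) i(1)] .
    have "(\<exists>j\<le>m. hop E2 (c i) (b j) \<le> \<delta>) \<or> (\<exists>j\<le>l. hop E2 (c i) (a j) \<le> \<delta>)"
      by (rule slim_trianglesD[OF assms c(1) b(1) a(1)]) (use a b c i in auto)
    then obtain w where w: "w \<in> V2" "hop E2 (c i) w \<le> \<delta>"
      and L: "\<And>u. u \<in> V1 \<Longrightarrow> hop E2 (f u) w \<le> k \<Longrightarrow> u \<in> L x z \<union> L z y"
    proof (elim disjE exE conjE)
      fix j assume j: "j \<le> m" "hop E2 (c i) (b j) \<le> \<delta>"
      have "u \<in> L z y" if "u \<in> V1" "hop E2 (f u) (b j) \<le> k" for u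
        by (rule LI[OF that(1) codomain.isometric_path_rev[OF b(1)], of _ _ "m - j"]) (use that j b in auto)
      with j codomain.isometric_path_in[OF b(1)] show ?thesis by (intro that[of "b j"]) auto
    next
      fix j assume j: "j \<le> l" "hop E2 (c i) (a j) \<le> \<delta>"
      have "u \<in> L x z" if "u \<in> V1" "hop E2 (f u) (a j) \<le> k" for u
        by (rule LI[OF that(1) codomain.isometric_path_rev[OF a(1)], of _ _ "l - j"]) (use that j a in auto)
      with j codomain.isometric_path_in[OF a(1)] show ?thesis by (intro that[of "a j"]) auto
    qed
    obtain u where u: "u \<in> V1" "hop E2 (f u) w \<le> k" using lift w by blast
    have W: "f u \<in> V2" "f v \<in> V2" using f_in u v by auto
    have "hop E2 (f u) (f v) \<le> 2 * k + \<delta> + 1"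
      using codomain.tri[OF W(1) w(1) W(2)] codomain.tri[OF w(1) ci W(2)]
        codomain.sym[OF w(1) ci] codomain.sym[OF ci W(2)] u(2) w(2) i(2) by linarith
    then show "\<exists>u\<in>L x z \<union> L z y. hop E1 u v \<le> h" using D[OF u(1) v] L[OF u] by blast
  next
    fix x y v assume V: "x \<in> V1" "y \<in> V1" and le: "hop E1 x y \<le> 1" and "v \<in> L x y"
    then obtain c n i where v: "v \<in> V1" and c: "isometric_path V2 (hop E2) c n" "c 0 = f x" "c n = f y"
      and i: "i \<le> n" "hop E2 (f v) (c i) \<le> k"
      unfolding L_def by blast
    have ci: "c i \<in> V2" using codomain.isometric_path_in[OF c(1) i(1)] .
    have W: "f x \<in> V2" "f v \<in> V2" using f_in V v by auto
    have "k * hop E1 x y \<le> k" using le mult_le_mono2[of _ 1 k] by simp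
    moreover have "n = hop E2 (f x) (f y)" "i = hop E2 (f x) (c i)"
      using codomain.isometric_path_dist[OF c(1), of 0 n] codomain.isometric_path_dist[OF c(1), of 0 i] c i
      by auto
    ultimately have "hop E2 (f x) (c i) \<le> k" using hop_image_le[OF V] i by linarith
    then have "hop E2 (f x) (f v) \<le> 2 * k + \<delta> + 1"
      using codomain.tri[OF W(1) ci W(2)] codomain.sym[OF ci W(2)] i(2) by linarith
    then show "hop E1 x v \<le> h" using D V v by blast
  next
    fix x y assume V: "x \<in> V1" "y \<in> V1"
    obtain c n where c: "isometric_path V2 (hop E2) c n" "c 0 = f x" "c n = f y"
      using codomain.isometric_path_exists f_in V by metis
    have cV: "c i \<in> V2" if "i \<le> n" for i using codomain.isometric_path_in[OF c(1) that] .
    have "\<forall>i. \<exists>v. i \<le> n \<longrightarrow> v \<in> V1 \<and> hop E2 (f v) (c i) \<le> k" using lift cV by blast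
    then obtain g where g: "\<And>i. i \<le> n \<Longrightarrow> g i \<in> V1" "\<And>i. i \<le> n \<Longrightarrow> hop E2 (f (g i)) (c i) \<le> k"
      by metis
    have g_near: "hop E1 u (g i) \<le> h" if "u \<in> V1" "hop E2 (f u) (c j) \<le> k" "i \<le> n" "j \<le> n" "j \<le> Suc i" "i \<le> Suc j" for u i j
    proof -
      have W: "f u \<in> V2" "f (g i) \<in> V2" using f_in that g by auto
      have "hop E2 (c j) (c i) \<le> 1"
        using codomain.isometric_path_dist[OF c(1), of i j] codomain.isometric_path_dist[OF c(1), of j i]
          codomain.sym[OF cV cV, of i j] that by (cases "i \<le> j") auto
      then have "hop E2 (f u) (f (g i)) \<le> 2 * k + \<delta> + 1"
        using codomain.tri[OF W(1) cV[OF that(4)] W(2)] codomain.tri[OF cV[OF that(4)] cV[OF that(3)] W(2)]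
          codomain.sym[OF cV[OF that(3)] W(2)] g(2)[OF that(3)] that(2) by linarith
      then show ?thesis using D that(1) g(1)[OF that(3)] by blast
    qed
    have end0: "hop E2 (f x) (c 0) \<le> k" "hop E2 (f y) (c n) \<le> k"
      using c codomain.refl f_in V by simp_all
    \<comment> \<open>The chain is padded by the endpoints, since \<open>c 0 = f x\<close> does not determine \<open>x\<close>.\<close>
    define e where "e i = (if i = 0 then x else if i = n + 2 then y else g (i - 1))" for i
    have "e i \<in> L x y" if "i \<le> n + 2" for i
    proof -
      have "i = 0 \<or> i = n + 2 \<or> (\<exists>j\<le>n. i = Suc j)" using that by (cases i) auto
      then consider "i = 0" | "i = n + 2" | j where "i = Suc j" "j \<le> n" by blast
      then show ?thesis
      proof cases
        case 1
        then show ?thesis using LI[OF V(1) c, of 0] end0 by (simp add: e_def)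
      next
        case 2
        then show ?thesis using LI[OF V(2) c, of n] end0 by (simp add: e_def)
      next
        case 3
        then show ?thesis using LI[OF g(1) c _ g(2)] by (simp add: e_def)
      qed
    qed
    moreover have "hop E1 (e i) (e (Suc i)) \<le> h" if "i < n + 2" for i
    proof -
      have "i = 0 \<or> i = n + 1 \<or> (\<exists>j<n. i = Suc j)" using that by (cases i) auto
      then consider "i = 0" | "i = n + 1" | j where "i = Suc j" "j < n" by blast
      then show ?thesis
      proof cases
        case 1
        then show ?thesis unfolding e_def using g_near[OF V(1) end0(1)] by simp
      next
        case 2
        then show ?thesis unfolding e_def
          using g_near[OF V(2) end0(2), of n] domain.sym[OF V(2) g(1)[of n]] by simp
      next
        case 3
        then show ?thesis unfolding e_def using g_near[OF g(1)[of j] g(2)[of j], of "Suc j"] by simp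
      qed
    qed
    ultimately show "\<exists>e m. e 0 = x \<and> e m = y \<and> (\<forall>i\<le>m. e i \<in> L x y) \<and> (\<forall>i<m. hop E1 (e i) (e (Suc i)) \<le> h)"
      by (intro exI[of _ e] exI[of _ "n + 2"]) (simp add: e_def)
  qed
  then show ?thesis by (rule guessed_geodesics.slim)
qed

end

section \<open>Shortest-path distance of digraphs\<close>

lemma (in wf_digraph) awalk_of_length_iff:
  "(\<exists>p. awalk u p v \<and> length p = n) \<longleftrightarrow> u \<in> verts G \<and> (u, v) \<in> arcs_ends G ^^ n"
proof (induction n arbitrary: u)
  case 0
  then show ?case by (auto simp: awalk_Nil_iff)
next
  case (Suc n)
  have "(\<exists>p. awalk u p v \<and> length p = Suc n) \<longleftrightarrow>
    (\<exists>e\<in>arcs G. u = tail G e \<and> (\<exists>p. awalk (head G e) p v \<and> length p = n))"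
  proof -
    have "(\<exists>p. awalk u p v \<and> length p = Suc n) \<longleftrightarrow> (\<exists>e p. awalk u (e # p) v \<and> length p = n)"
      by (metis length_Suc_conv)
    then show ?thesis unfolding awalk_Cons_iff by blast
  qed
  also have "\<dots> \<longleftrightarrow> (\<exists>e\<in>arcs G. u = tail G e \<and> (head G e, v) \<in> arcs_ends G ^^ n)"
    unfolding Suc by auto
  also have "\<dots> \<longleftrightarrow> u \<in> verts G \<and> (u, v) \<in> arcs_ends G ^^ Suc n"
    unfolding relpow_commute[symmetric] relpow.simps by (auto simp: arcs_ends_conv)
  finally show ?case .
qed

text \<open>The infimum over walks is attained because walk lengths are natural numbers.\<close>
lemma graph_dist_le_iff:
  assumes "wf_digraph \<Gamma>"
  shows "graph_dist \<Gamma> u v \<le> ereal r \<longleftrightarrow> u \<in> verts \<Gamma> \<and> (\<exists>n. real n \<le> r \<and> (u, v) \<in> arcs_ends \<Gamma> ^^ n)"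
proof -
  interpret wf_digraph \<Gamma> by fact
  have cost: "awalk_cost (\<lambda>_. 1) p = real (length p)" for p :: "'b list"
    unfolding awalk_cost_def by (induction p) auto
  have eq: "graph_dist \<Gamma> u v = (INF n \<in> {n. \<exists>p. awalk u p v \<and> length p = n}. ereal (real n))"
    unfolding graph_dist_def \<mu>_def cost by (rule INF_eq) auto
  define N where "N = {n. \<exists>p. awalk u p v \<and> length p = n}"
  have "(INF n\<in>N. ereal (real n)) \<le> ereal r \<longleftrightarrow> (\<exists>n\<in>N. real n \<le> r)"
  proof (cases "N = {}")
    case True then show ?thesis by (simp add: top_ereal_def)
  next
    case False
    define m where "m = (LEAST n. n \<in> N)"
    have m: "m \<in> N" "\<And>n. n \<in> N \<Longrightarrow> m \<le> n"
      unfolding m_def using False by (auto intro: LeastI Least_le)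
    have "(INF n\<in>N. ereal (real n)) = ereal (real m)"
      by (rule antisym) (use m in \<open>auto intro: INF_lower2 INF_greatest\<close>)
    then show ?thesis using m by (force intro: order_trans)
  qed
  then show ?thesis unfolding eq N_def[symmetric] unfolding N_def awalk_of_length_iff by auto
qed

lemma connected_pair_graph_iff:
  assumes "pair_sym_digraph P"
  shows "Digraph_Component.connected (with_proj P) \<longleftrightarrow> pverts P \<noteq> {} \<and> connected_relation (pverts P) (parcs P)"
proof -
  interpret pair_sym_digraph P by fact
  have parcs: "parcs (mk_symmetric (with_proj P)) = parcs P"
    using adj_mk_symmetric_eq sym_arcs by simp
  have "parcs P \<subseteq> pverts P \<times> pverts P" using wellformed' by auto
  moreover have "sym (parcs P)" using sym_arcs by (simp add: symmetric_def)
  moreover have "u \<rightarrow>\<^sup>*\<^bsub>with_proj (mk_symmetric (with_proj P))\<^esub> v \<longleftrightarrow> u \<rightarrow>\<^sup>*\<^bsub>with_proj P\<^esub> v" for u v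
    using reachable_mk_symmetric_eq sym_arcs by blast
  ultimately show ?thesis
    unfolding Digraph_Component.connected_def strongly_connected_def connected_relation_def
    by (auto simp: reachable_conv)
qed

lemma (in wf_digraph) awalk_verts_chain:
  "awalk u p v \<Longrightarrow> awalk_verts u p ! 0 = u \<and> awalk_verts u p ! length p = v \<and>
     (\<forall>i<length p. (awalk_verts u p ! i, awalk_verts u p ! Suc i) \<in> arcs_ends G)"
proof (induction p arbitrary: u)
  case Nil
  then show ?case by (simp add: awalk_Nil_iff)
next
  case (Cons e p)
  then have e: "e \<in> arcs G" "tail G e = u" and p: "awalk (head G e) p v" by (auto simp: awalk_Cons_iff)
  note IH = Cons.IH[OF p]
  have "(awalk_verts u (e # p) ! i, awalk_verts u (e # p) ! Suc i) \<in> arcs_ends G" if "i < Suc (length p)" for i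
  proof (cases i)
    case 0
    then show ?thesis using IH e by (auto simp: arcs_ends_conv)
  next
    case (Suc j)
    then show ?thesis using IH that by simp
  qed
  then show ?case using IH e by simp
qed

lemma (in wf_digraph) chain_awalk:
  "(\<forall>i\<le>n. c i \<in> verts G) \<Longrightarrow> (\<forall>i<n. (c i, c (Suc i)) \<in> arcs_ends G) \<Longrightarrow>
     \<exists>p. awalk (c 0) p (c n) \<and> length p = n \<and> set (awalk_verts (c 0) p) = c ` {..n}"
proof (induction n arbitrary: c)
  case 0
  then show ?case by (intro exI[of _ "[]"]) (auto simp: awalk_Nil_iff)
next
  case (Suc n)
  from Suc.IH[of "c \<circ> Suc"] Suc.prems
  obtain p where p: "awalk (c 1) p (c (Suc n))" "length p = n" "set (awalk_verts (c 1) p) = c ` Suc ` {..n}"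
    by (auto simp: image_comp)
  obtain e where e: "e \<in> arcs G" "tail G e = c 0" "head G e = c 1"
    using Suc.prems by (auto simp: arcs_ends_conv)
  have "set (awalk_verts (c 0) (e # p)) = c ` {..Suc n}"
    using p e by (simp add: atMost_Suc_eq_insert_0)
  moreover have "awalk (c 0) (e # p) (c (Suc n))" using p e by (simp add: awalk_Cons_iff)
  ultimately show ?case using p by (intro exI[of _ "e # p"]) auto
qed

text \<open>Up to the choice between lists of arcs and sequences of vertices, both sides express the same
condition; a real \<open>\<delta>\<close> may be rounded up since distances are integers.\<close>
lemma hyperbolic_graph_iff_slim_triangles:
  assumes P: "pair_sym_digraph P" and c: "connected_relation (pverts P) (parcs P)"
  shows "hyperbolic_graph (with_proj P) \<longleftrightarrow> (\<exists>\<delta>. slim_triangles (pverts P) (hop (parcs P)) \<delta>)"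
proof -
  interpret pair_sym_digraph P by fact
  interpret connected_relation "pverts P" "parcs P" by fact
  let ?\<Gamma> = "with_proj P" and ?V = "pverts P" and ?d = "hop (parcs P)"
  have wf: "wf_digraph ?\<Gamma>" ..
  have le: "graph_dist ?\<Gamma> u v \<le> ereal r \<longleftrightarrow> real (?d u v) \<le> r" if "u \<in> ?V" "v \<in> ?V" for u v r
  proof -
    have "(\<exists>n. real n \<le> r \<and> (u, v) \<in> parcs P ^^ n) \<longleftrightarrow> real (?d u v) \<le> r"
    proof
      assume "\<exists>n. real n \<le> r \<and> (u, v) \<in> parcs P ^^ n"
      then obtain n where "real n \<le> r" "(u, v) \<in> parcs P ^^ n" by blast
      with hop_le[OF this(2)] show "real (?d u v) \<le> r" by linarith
    qed (use hop_relpow[OF conn[OF that]] in blast)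
    then show ?thesis using that unfolding graph_dist_le_iff[OF wf] by simp
  qed
  have dist: "graph_dist ?\<Gamma> u v = ereal (real (?d u v))" if uv: "u \<in> ?V" "v \<in> ?V" for u v
  proof (rule antisym)
    show "graph_dist ?\<Gamma> u v \<le> ereal (real (?d u v))" using le[OF uv] by simp
    show "ereal (real (?d u v)) \<le> graph_dist ?\<Gamma> u v"
      using le[OF uv, of "real (?d u v) - 1"] le[OF uv] by (cases "graph_dist ?\<Gamma> u v") auto
  qed
  have geodesicD: "\<exists>c. isometric_path ?V ?d c (length p) \<and> c 0 = x \<and> c (length p) = y \<and>
      set (pre_digraph.awalk_verts ?\<Gamma> x p) = c ` {..length p}" if "geodesic ?\<Gamma> x p y" for x p y
  proof -
    define vs where "vs = pre_digraph.awalk_verts ?\<Gamma> x p"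
    have w: "pre_digraph.awalk ?\<Gamma> x p y" and gd: "graph_dist ?\<Gamma> x y = ereal (real (length p))"
      using that unfolding geodesic_def by auto
    have xy: "x \<in> ?V" "y \<in> ?V" using w awalk_hd_in_verts awalk_last_in_verts by auto
    have len: "?d x y = length p" using gd dist[OF xy] by simp
    have length: "length vs = Suc (length p)" unfolding vs_def by (rule pre_digraph.length_awalk_verts)
    have chain: "vs ! 0 = x" "vs ! length p = y" "\<And>i. i < length p \<Longrightarrow> (vs ! i, vs ! Suc i) \<in> parcs P"
      using wf_digraph.awalk_verts_chain[OF wf w] unfolding vs_def by auto
    have set: "set vs = (\<lambda>i. vs ! i) ` {..length p}"
      unfolding set_conv_nth length by (auto simp: less_Suc_eq_le)
    have "set vs \<subseteq> ?V"
      using wf_digraph.awalk_verts_in_verts[OF wf] w unfolding vs_def pre_digraph.awalk_def by auto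
    then have "isometric_path ?V ?d (\<lambda>i. vs ! i) (length p)"
      using chain len unfolding set by (intro shortest_chain_isometric) auto
    then show ?thesis using chain(1,2) set unfolding vs_def[symmetric]
      by (intro exI[of _ "\<lambda>i. vs ! i"]) simp
  qed
  have geodesicI: "\<exists>p. geodesic ?\<Gamma> (c 0) p (c n) \<and> set (pre_digraph.awalk_verts ?\<Gamma> (c 0) p) = c ` {..n}"
    if iso: "isometric_path ?V ?d c n" for c n
  proof -
    have V: "c i \<in> ?V" if "i \<le> n" for i using isometric_path_in[OF iso that] .
    have "(c i, c (Suc i)) \<in> parcs P" if "i < n" for i
      using hop_relpow[OF conn[OF V V], of i "Suc i"] isometric_path_dist[OF iso, of i "Suc i"] that by simp
    then obtain p where p: "pre_digraph.awalk ?\<Gamma> (c 0) p (c n)" "length p = n"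
      "set (pre_digraph.awalk_verts ?\<Gamma> (c 0) p) = c ` {..n}"
      using chain_awalk[of n c] V by auto
    then have "geodesic ?\<Gamma> (c 0) p (c n)"
      unfolding geodesic_def using dist[OF V V, of 0 n] isometric_path_dist[OF iso, of 0 n] by simp
    with p show ?thesis by blast
  qed
  show ?thesis
  proof
    assume "hyperbolic_graph ?\<Gamma>"
    then obtain \<delta> where "\<forall>x y z p q r. geodesic ?\<Gamma> x p y \<and> geodesic ?\<Gamma> y q z \<and> geodesic ?\<Gamma> z r x \<longrightarrow>
        (\<forall>u \<in> set (pre_digraph.awalk_verts ?\<Gamma> x p).
          \<exists>v \<in> set (pre_digraph.awalk_verts ?\<Gamma> y q) \<union> set (pre_digraph.awalk_verts ?\<Gamma> z r).
            graph_dist ?\<Gamma> u v \<le> ereal \<delta>)"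
      unfolding hyperbolic_graph_def by (elim exE)
    note \<delta> = this[rule_format, OF conjI, OF _ conjI]
    have "(\<exists>j\<le>m. ?d (a i) (b j) \<le> nat \<lceil>\<delta>\<rceil>) \<or> (\<exists>j\<le>n. ?d (a i) (c j) \<le> nat \<lceil>\<delta>\<rceil>)"
      if a: "isometric_path ?V ?d a l" and b: "isometric_path ?V ?d b m" and c: "isometric_path ?V ?d c n"
        and ends: "a l = b 0" "b m = c 0" "c n = a 0" and i: "i \<le> l" for a l b m c n i
    proof -
      obtain p where p: "geodesic ?\<Gamma> (a 0) p (a l)" "set (pre_digraph.awalk_verts ?\<Gamma> (a 0) p) = a ` {..l}"
        using geodesicI[OF a] by blast
      obtain q where q: "geodesic ?\<Gamma> (a l) q (b m)" "set (pre_digraph.awalk_verts ?\<Gamma> (a l) q) = b ` {..m}"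
        using geodesicI[OF b] ends by auto
      obtain r where r: "geodesic ?\<Gamma> (b m) r (a 0)" "set (pre_digraph.awalk_verts ?\<Gamma> (b m) r) = c ` {..n}"
        using geodesicI[OF c] ends by auto
      have "a i \<in> set (pre_digraph.awalk_verts ?\<Gamma> (a 0) p)" using p i by auto
      from \<delta>[OF p(1) q(1) r(1) this] obtain v where v: "v \<in> b ` {..m} \<union> c ` {..n}"
        "graph_dist ?\<Gamma> (a i) v \<le> ereal \<delta>" unfolding q(2) r(2) by (elim bexE)
      have "a i \<in> ?V" "v \<in> ?V" using v i isometric_path_in a b c by auto
      then have "real (?d (a i) v) \<le> \<delta>" using v(2) le by blast
      then have "?d (a i) v \<le> nat \<lceil>\<delta>\<rceil>" by linarith
      with v(1) show ?thesis by auto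
    qed
    then show "\<exists>\<delta>. slim_triangles ?V ?d \<delta>" unfolding slim_triangles_def by blast
  next
    assume "\<exists>\<delta>. slim_triangles ?V ?d \<delta>"
    then obtain \<delta> where \<delta>: "slim_triangles ?V ?d \<delta>" by blast
    have "\<exists>v \<in> set (pre_digraph.awalk_verts ?\<Gamma> y q) \<union> set (pre_digraph.awalk_verts ?\<Gamma> z r).
          graph_dist ?\<Gamma> u v \<le> ereal (real \<delta>)"
      if g: "geodesic ?\<Gamma> x p y" "geodesic ?\<Gamma> y q z" "geodesic ?\<Gamma> z r x"
        and u: "u \<in> set (pre_digraph.awalk_verts ?\<Gamma> x p)" for x y z p q r u
    proof -
      obtain a where a: "isometric_path ?V ?d a (length p)" "a 0 = x" "a (length p) = y"
        "set (pre_digraph.awalk_verts ?\<Gamma> x p) = a ` {..length p}" using geodesicD[OF g(1)] by blast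
      obtain b where b: "isometric_path ?V ?d b (length q)" "b 0 = y" "b (length q) = z"
        "set (pre_digraph.awalk_verts ?\<Gamma> y q) = b ` {..length q}" using geodesicD[OF g(2)] by blast
      obtain c where c: "isometric_path ?V ?d c (length r)" "c 0 = z" "c (length r) = x"
        "set (pre_digraph.awalk_verts ?\<Gamma> z r) = c ` {..length r}" using geodesicD[OF g(3)] by blast
      obtain i where i: "i \<le> length p" "u = a i" using u a(4) by auto
      have "(\<exists>j\<le>length q. ?d (a i) (b j) \<le> \<delta>) \<or> (\<exists>j\<le>length r. ?d (a i) (c j) \<le> \<delta>)"
        by (rule slim_trianglesD[OF \<delta> a(1) b(1) c(1)]) (use a b c i in auto)
      then obtain v where v: "v \<in> b ` {..length q} \<union> c ` {..length r}" "?d u v \<le> \<delta>" using i by blast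
      have "u \<in> ?V" "v \<in> ?V" using v i isometric_path_in a b c by auto
      then show ?thesis using v b(4) c(4) dist by (intro bexI[of _ v]) auto
    qed
    then show "hyperbolic_graph ?\<Gamma>" unfolding hyperbolic_graph_def
      by (intro exI[of _ "real \<delta>"] allI impI ballI) (elim conjE)
  qed
qed

section \<open>Word metrics\<close>

text \<open>With the Cayley graph as a relation, word metrics become hop distances and inherit the
pseudometric laws.\<close>
definition cayley_arcs :: "('a, 'm) monoid_scheme \<Rightarrow> 'a set \<Rightarrow> 'a rel" where
  "cayley_arcs G S = {(g, g \<otimes>\<^bsub>G\<^esub> s) | g s. g \<in> carrier G \<and> s \<in> S \<union> set_inv\<^bsub>G\<^esub> S}"

context group
begin

lemma letters_in_carrier: "S \<subseteq> carrier G \<Longrightarrow> S \<union> set_inv S \<subseteq> carrier G"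
  by (auto simp: SET_INV_def)

lemma word_in_carrier: "set w \<subseteq> carrier G \<Longrightarrow> foldr (\<otimes>) w \<one> \<in> carrier G"
  by (induction w) auto

lemma cayley_arcs_relpow_iff:
  assumes S: "S \<subseteq> carrier G"
  shows "x \<in> carrier G \<Longrightarrow> (x, y) \<in> cayley_arcs G S ^^ n \<longleftrightarrow>
    (\<exists>w. length w = n \<and> set w \<subseteq> S \<union> set_inv S \<and> y = x \<otimes> foldr (\<otimes>) w \<one>)"
proof (induction n arbitrary: x)
  case 0
  then show ?case by auto
next
  case (Suc n)
  note L = letters_in_carrier[OF S]
  have "(x, y) \<in> cayley_arcs G S ^^ Suc n \<longleftrightarrow>
    (\<exists>s \<in> S \<union> set_inv S. (x \<otimes> s, y) \<in> cayley_arcs G S ^^ n)"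
    unfolding relpow_commute[symmetric] relpow.simps using Suc.prems by (auto simp: cayley_arcs_def)
  also have "\<dots> \<longleftrightarrow> (\<exists>s w. s \<in> S \<union> set_inv S \<and> length w = n \<and> set w \<subseteq> S \<union> set_inv S \<and>
      y = (x \<otimes> s) \<otimes> foldr (\<otimes>) w \<one>)"
    using Suc.IH Suc.prems L by blast
  also have "\<dots> \<longleftrightarrow> (\<exists>s w. s \<in> S \<union> set_inv S \<and> length w = n \<and> set w \<subseteq> S \<union> set_inv S \<and>
      y = x \<otimes> foldr (\<otimes>) (s # w) \<one>)"
  proof -
    have "(x \<otimes> s) \<otimes> foldr (\<otimes>) w \<one> = x \<otimes> foldr (\<otimes>) (s # w) \<one>"
      if "s \<in> S \<union> set_inv S" "set w \<subseteq> S \<union> set_inv S" for s w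
      using Suc.prems word_in_carrier[OF subset_trans[OF that(2) L]] subsetD[OF L that(1)] by (simp add: m_assoc)
    then show ?thesis by (intro ex_cong1 conj_cong refl) simp
  qed
  also have "\<dots> \<longleftrightarrow> (\<exists>w. length w = Suc n \<and> set w \<subseteq> S \<union> set_inv S \<and> y = x \<otimes> foldr (\<otimes>) w \<one>)"
  proof
    assume "\<exists>w. length w = Suc n \<and> set w \<subseteq> S \<union> set_inv S \<and> y = x \<otimes> foldr (\<otimes>) w \<one>"
    then obtain w' where w': "length w' = Suc n" "set w' \<subseteq> S \<union> set_inv S" "y = x \<otimes> foldr (\<otimes>) w' \<one>"
      by (elim exE conjE)
    then obtain s w where "w' = s # w" by (cases w') auto
    with w' have "length w = n" "set (s # w) \<subseteq> S \<union> set_inv S" "y = x \<otimes> foldr (\<otimes>) (s # w) \<one>"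
      by simp_all
    then show "\<exists>s w. s \<in> S \<union> set_inv S \<and> length w = n \<and> set w \<subseteq> S \<union> set_inv S \<and>
      y = x \<otimes> foldr (\<otimes>) (s # w) \<one>" by (intro exI[of _ s] exI[of _ w]) simp
  next
    assume "\<exists>s w. s \<in> S \<union> set_inv S \<and> length w = n \<and> set w \<subseteq> S \<union> set_inv S \<and>
      y = x \<otimes> foldr (\<otimes>) (s # w) \<one>"
    then obtain s w where "s \<in> S \<union> set_inv S" "length w = n" "set w \<subseteq> S \<union> set_inv S"
      "y = x \<otimes> foldr (\<otimes>) (s # w) \<one>" by blast
    then show "\<exists>w. length w = Suc n \<and> set w \<subseteq> S \<union> set_inv S \<and> y = x \<otimes> foldr (\<otimes>) w \<one>"
      by (intro exI[of _ "s # w"]) simp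
  qed
  finally show ?case .
qed

lemma word_dist_hop:
  assumes S: "S \<subseteq> carrier G" and xy: "x \<in> carrier G" "y \<in> carrier G"
  shows "word_dist G S x y = real (hop (cayley_arcs G S) x y)"
proof -
  have eq: "foldr (\<otimes>) w \<one> = inv x \<otimes> y \<longleftrightarrow> y = x \<otimes> foldr (\<otimes>) w \<one>" if w: "set w \<subseteq> S \<union> set_inv S" for w
  proof -
    have "foldr (\<otimes>) w \<one> \<in> carrier G"
      using word_in_carrier subset_trans[OF w letters_in_carrier[OF S]] .
    then show ?thesis using xy by (auto simp: m_assoc[symmetric])
  qed
  have "(\<exists>w. length w = n \<and> set w \<subseteq> S \<union> set_inv S \<and> foldr (\<otimes>) w \<one> = inv x \<otimes> y) \<longleftrightarrow>
      (x, y) \<in> cayley_arcs G S ^^ n" for n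
    unfolding cayley_arcs_relpow_iff[OF S xy(1)] using eq by blast
  then show ?thesis unfolding word_dist_def word_length_def hop_def by simp
qed

lemma generating_word:
  assumes "S \<subseteq> carrier G" "g \<in> generate G S"
  shows "\<exists>w. set w \<subseteq> S \<union> set_inv S \<and> foldr (\<otimes>) w \<one> = g"
  using assms(2)
proof induction
  case one
  show ?case by (intro exI[of _ "[]"]) auto
next
  case (incl h)
  then show ?case using assms(1) by (intro exI[of _ "[h]"]) auto
next
  case (inv h)
  then show ?case using assms(1) by (intro exI[of _ "[inv h]"]) (auto simp: SET_INV_def)
next
  case (eng g h)
  then obtain v w where vw: "set v \<subseteq> S \<union> set_inv S" "foldr (\<otimes>) v \<one> = g"
    "set w \<subseteq> S \<union> set_inv S" "foldr (\<otimes>) w \<one> = h" by blast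
  have "foldr (\<otimes>) (v @ w) \<one> = foldr (\<otimes>) v \<one> \<otimes> foldr (\<otimes>) w \<one>"
    using vw(1)
  proof (induction v)
    case Nil
    then show ?case using word_in_carrier[OF subset_trans[OF vw(3) letters_in_carrier[OF assms(1)]]] by simp
  next
    case (Cons s v)
    then have "s \<in> carrier G" "foldr (\<otimes>) v \<one> \<in> carrier G"
      using word_in_carrier[of v] letters_in_carrier[OF assms(1)] by auto
    then show ?case using Cons word_in_carrier[OF subset_trans[OF vw(3) letters_in_carrier[OF assms(1)]]]
      by (simp add: m_assoc)
  qed
  then show ?case using vw by (intro exI[of _ "v @ w"]) auto
qed

lemma cayley_connected_relation:
  assumes "generating_set G S"
  shows "connected_relation (carrier G) (cayley_arcs G S)"
proof
  have S: "S \<subseteq> carrier G" and gen: "generate G S = carrier G" using assms by (auto simp: generating_set_def)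
  note L = letters_in_carrier[OF S]
  show "cayley_arcs G S \<subseteq> carrier G \<times> carrier G" using L by (auto simp: cayley_arcs_def)
  show "sym (cayley_arcs G S)"
  proof (rule symI)
    fix x y assume "(x, y) \<in> cayley_arcs G S"
    then obtain s where s: "x \<in> carrier G" "s \<in> S \<union> set_inv S" "y = x \<otimes> s" by (auto simp: cayley_arcs_def)
    have "inv s \<in> S \<union> set_inv S" using s(2) S by (auto simp: SET_INV_def)
    moreover have "y \<in> carrier G" "x = y \<otimes> inv s" using s L by (auto simp: m_assoc subset_iff)
    ultimately show "(y, x) \<in> cayley_arcs G S" by (auto simp: cayley_arcs_def)
  qed
  show "(x, y) \<in> (cayley_arcs G S)\<^sup>*" if xy: "x \<in> carrier G" "y \<in> carrier G" for x y
  proof -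
    obtain w where w: "set w \<subseteq> S \<union> set_inv S" "foldr (\<otimes>) w \<one> = inv x \<otimes> y"
      using generating_word[OF S, of "inv x \<otimes> y"] gen xy by auto
    have "y = x \<otimes> foldr (\<otimes>) w \<one>" unfolding w(2) using xy by (simp add: m_assoc[symmetric])
    then have "(x, y) \<in> cayley_arcs G S ^^ length w" unfolding cayley_arcs_relpow_iff[OF S xy(1)] using w by blast
    then show ?thesis by (rule relpow_imp_rtrancl)
  qed
qed

lemma word_dist_le_iff:
  assumes "generating_set G S" "x \<in> carrier G" "y \<in> carrier G"
  shows "word_dist G S x y \<le> real n \<longleftrightarrow> (x, y) \<in> reach_within (cayley_arcs G S) n"
  using connected_relation.hop_le_reach_within[OF cayley_connected_relation] assms word_dist_hop
  by (simp add: generating_set_def)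

lemma word_dist_nonneg: "0 \<le> word_dist G S x y"
  by (simp add: word_dist_def)

lemma word_dist_refl:
  assumes "generating_set G S" "x \<in> carrier G"
  shows "word_dist G S x x = 0"
  using word_dist_le_iff[OF assms assms(2), of 0] word_dist_nonneg[of S x x] reach_within_refl by force

lemma word_dist_sym:
  assumes "generating_set G S" "x \<in> carrier G" "y \<in> carrier G"
  shows "word_dist G S x y = word_dist G S y x"
proof -
  interpret C: connected_relation "carrier G" "cayley_arcs G S" by (rule cayley_connected_relation) fact
  show ?thesis using C.sym[OF assms(2,3)] assms word_dist_hop by (simp add: generating_set_def)
qed

lemma word_dist_triangle:
  assumes "generating_set G S" "x \<in> carrier G" "y \<in> carrier G" "z \<in> carrier G"
  shows "word_dist G S x z \<le> word_dist G S x y + word_dist G S y z"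
proof -
  interpret C: connected_relation "carrier G" "cayley_arcs G S" by (rule cayley_connected_relation) fact
  show ?thesis using C.tri[OF assms(2-4)] assms word_dist_hop by (simp add: generating_set_def)
qed

lemma word_dist_left_mult:
  assumes "g \<in> carrier G" "x \<in> carrier G" "y \<in> carrier G"
  shows "word_dist G S (g \<otimes> x) (g \<otimes> y) = word_dist G S x y"
proof -
  have "inv (g \<otimes> x) \<otimes> (g \<otimes> y) = inv x \<otimes> (inv g \<otimes> (g \<otimes> y))"
    using assms by (simp add: inv_mult_group m_assoc)
  also have "inv g \<otimes> (g \<otimes> y) = y" using assms by (simp add: m_assoc[symmetric])
  finally show ?thesis unfolding word_dist_def by simp
qed

lemma finite_word_ball:
  assumes "generating_set G S" "finite S" "x \<in> carrier G"
  shows "finite {y \<in> carrier G. word_dist G S x y \<le> r}"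
proof -
  have "finite ((cayley_arcs G S ^^ n) `` {x})" for n
  proof (induction n)
    case (Suc n)
    have "finite (S \<union> set_inv S)" using assms(2) by (simp add: SET_INV_def)
    then have "finite (\<Union>y \<in> (cayley_arcs G S ^^ n) `` {x}. (\<lambda>s. y \<otimes> s) ` (S \<union> set_inv S))"
      using Suc by blast
    moreover have "(cayley_arcs G S ^^ Suc n) `` {x} \<subseteq> \<dots>" by (auto simp: cayley_arcs_def)
    ultimately show ?case by (rule finite_subset[rotated])
  qed simp
  then have "finite (\<Union>n\<le>nat \<lfloor>r\<rfloor>. (cayley_arcs G S ^^ n) `` {x})" by blast
  moreover have "{y \<in> carrier G. word_dist G S x y \<le> r} \<subseteq> (\<Union>n\<le>nat \<lfloor>r\<rfloor>. (cayley_arcs G S ^^ n) `` {x})"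
  proof safe
    fix y assume y: "y \<in> carrier G" "word_dist G S x y \<le> r"
    have "word_dist G S x y \<le> real (nat \<lfloor>r\<rfloor>)" using y(2) unfolding word_dist_def
      by (metis le_nat_floor of_nat_le_iff)
    then have "(x, y) \<in> reach_within (cayley_arcs G S) (nat \<lfloor>r\<rfloor>)"
      using word_dist_le_iff[OF assms(1,3) y(1)] by blast
    then show "y \<in> (\<Union>n\<le>nat \<lfloor>r\<rfloor>. (cayley_arcs G S ^^ n) `` {x})" by (auto simp: reach_within_def)
  qed
  ultimately show ?thesis by (rule finite_subset[rotated])
qed

lemma word_dist_change_generators:
  assumes S: "generating_set G S" "finite S" and T: "generating_set G T"
  shows "\<exists>k::nat. \<forall>x \<in> carrier G. \<forall>y \<in> carrier G. word_dist G T x y \<le> real k * word_dist G S x y"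
proof -
  interpret C: connected_relation "carrier G" "cayley_arcs G S" by (rule cayley_connected_relation) fact
  interpret D: connected_relation "carrier G" "cayley_arcs G T" by (rule cayley_connected_relation) fact
  have sub: "S \<subseteq> carrier G" "T \<subseteq> carrier G" using S T by (auto simp: generating_set_def)
  have fin: "finite (S \<union> set_inv S)" using S(2) by (simp add: SET_INV_def)
  define k where "k = (\<Sum>s \<in> S \<union> set_inv S. word_length G T s)"
  have edge: "(x, y) \<in> reach_within (cayley_arcs G T) k" if xy: "(x, y) \<in> cayley_arcs G S" for x y
  proof -
    obtain s where s: "x \<in> carrier G" "s \<in> S \<union> set_inv S" "y = x \<otimes> s" using xy by (auto simp: cayley_arcs_def)
    have y: "y \<in> carrier G" using C.edges_in xy by auto
    have "s \<in> carrier G" using s letters_in_carrier[OF sub(1)] by auto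
    then have "inv x \<otimes> y = s" using s by (simp add: m_assoc[symmetric])
    moreover have "word_length G T s \<le> k" unfolding k_def using s(2) fin by (intro member_le_sum) auto
    ultimately have "word_dist G T x y \<le> real k" unfolding word_dist_def by simp
    then show ?thesis using word_dist_le_iff[OF T s(1) y] by blast
  qed
  have "word_dist G T x y \<le> real k * word_dist G S x y" if xy: "x \<in> carrier G" "y \<in> carrier G" for x y
  proof -
    have "(x, y) \<in> reach_within (cayley_arcs G S) (hop (cayley_arcs G S) x y)"
      using C.hop_le_reach_within[OF xy] by blast
    then have "(x, y) \<in> reach_within (cayley_arcs G T) (k * hop (cayley_arcs G S) x y)"
      using reach_within_map[of "cayley_arcs G S" "\<lambda>x. x", OF edge] by blast
    then have "word_dist G T x y \<le> real (k * hop (cayley_arcs G S) x y)" using word_dist_le_iff[OF T xy] by blast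
    then show ?thesis using word_dist_hop[OF sub(1) xy] by simp
  qed
  then show ?thesis by blast
qed

end

section \<open>Coarse equivalence of subsets and commensurators\<close>

definition coarsely_close :: "('a \<Rightarrow> 'b \<Rightarrow> real) \<Rightarrow> real \<Rightarrow> 'a set \<Rightarrow> 'b set \<Rightarrow> bool" where
  "coarsely_close d r X Y \<longleftrightarrow> (\<forall>x\<in>X. \<exists>y\<in>Y. d x y \<le> r) \<and> (\<forall>y\<in>Y. \<exists>x\<in>X. d x y \<le> r)"

lemma coarsely_closeD1: "coarsely_close d r X Y \<Longrightarrow> x \<in> X \<Longrightarrow> \<exists>y\<in>Y. d x y \<le> r"
  and coarsely_closeD2: "coarsely_close d r X Y \<Longrightarrow> y \<in> Y \<Longrightarrow> \<exists>x\<in>X. d x y \<le> r"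
  by (auto simp: coarsely_close_def)

lemma coarsely_closeI:
  "(\<And>x. x \<in> X \<Longrightarrow> \<exists>y\<in>Y. d x y \<le> r) \<Longrightarrow> (\<And>y. y \<in> Y \<Longrightarrow> \<exists>x\<in>X. d x y \<le> r) \<Longrightarrow> coarsely_close d r X Y"
  by (auto simp: coarsely_close_def)

lemma coarsely_close_mono:
  assumes "coarsely_close d r X Y" "r \<le> s" shows "coarsely_close d s X Y"
  using assms unfolding coarsely_close_def by (meson order_trans)

lemma hausdorff_dist_less_imp_close: "hausdorff_dist d X Y < ereal M \<Longrightarrow> coarsely_close d M X Y"
proof -
  assume "hausdorff_dist d X Y < ereal M"
  then obtain r where "coarsely_close d r X Y" "r \<le> M"
    unfolding hausdorff_dist_def INF_less_iff coarsely_close_def by force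
  then show ?thesis by (rule coarsely_close_mono)
qed

lemma (in group) cancel_left [simp]:
  assumes "x \<in> carrier G" "y \<in> carrier G"
  shows "inv x \<otimes> (x \<otimes> y) = y" "x \<otimes> (inv x \<otimes> y) = y"
  using assms by (simp_all add: m_assoc[symmetric])

lemma (in group) mem_l_coset_iff:
  "g \<in> carrier G \<Longrightarrow> X \<subseteq> carrier G \<Longrightarrow> y \<in> g <# X \<longleftrightarrow> y \<in> carrier G \<and> inv g \<otimes> y \<in> X"
  unfolding l_coset_def by (auto intro!: bexI[of _ "inv g \<otimes> y"] simp: subset_iff)

lemma (in group) mem_conjugate_by_iff:
  assumes "g \<in> carrier G" "X \<subseteq> carrier G"
  shows "y \<in> conjugate_by G g X \<longleftrightarrow> y \<in> carrier G \<and> inv g \<otimes> y \<otimes> g \<in> X"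
proof -
  have "y \<in> conjugate_by G g X \<longleftrightarrow> (\<exists>x\<in>X. y = g \<otimes> x \<otimes> inv g)"
    unfolding conjugate_by_def l_coset_def r_coset_def by auto
  also have "\<dots> \<longleftrightarrow> y \<in> carrier G \<and> inv g \<otimes> y \<otimes> g \<in> X"
  proof
    assume "\<exists>x\<in>X. y = g \<otimes> x \<otimes> inv g"
    then obtain x where x: "x \<in> X" "y = g \<otimes> x \<otimes> inv g" by blast
    then have "x \<in> carrier G" using assms by auto
    then show "y \<in> carrier G \<and> inv g \<otimes> y \<otimes> g \<in> X" using x assms by (simp add: m_assoc)
  next
    assume y: "y \<in> carrier G \<and> inv g \<otimes> y \<otimes> g \<in> X"
    then have "y = g \<otimes> (inv g \<otimes> y \<otimes> g) \<otimes> inv g" using assms by (simp add: m_assoc)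
    then show "\<exists>x\<in>X. y = g \<otimes> x \<otimes> inv g" using y by blast
  qed
  finally show ?thesis .
qed

lemma (in group) subgroup_conjugate_by:
  assumes g: "g \<in> carrier G" and K: "subgroup K G"
  shows "subgroup (conjugate_by G g K) G"
proof -
  note mem = mem_conjugate_by_iff[OF g subgroup.subset[OF K]]
  show ?thesis
  proof (rule subgroupI)
    show "conjugate_by G g K \<subseteq> carrier G" using mem by blast
    have "\<one> \<in> conjugate_by G g K" unfolding mem using g subgroup.one_closed[OF K] by simp
    then show "conjugate_by G g K \<noteq> {}" by blast
    fix x assume x: "x \<in> conjugate_by G g K"
    have "inv (inv g \<otimes> x \<otimes> g) = inv g \<otimes> inv x \<otimes> g" using x mem g by (simp add: inv_mult_group m_assoc)
    then show "inv x \<in> conjugate_by G g K" using subgroup.m_inv_closed[OF K] x unfolding mem by (metis inv_closed)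
    fix y assume y: "y \<in> conjugate_by G g K"
    have "(inv g \<otimes> x \<otimes> g) \<otimes> (inv g \<otimes> y \<otimes> g) = inv g \<otimes> (x \<otimes> y) \<otimes> g"
      using x y mem g by (simp add: m_assoc)
    then show "x \<otimes> y \<in> conjugate_by G g K" using subgroup.m_closed[OF K] x y unfolding mem by (metis m_closed)
  qed
qed

lemma (in group) mem_left_cosets_iff: "X \<in> left_cosets G \<P> \<longleftrightarrow> (\<exists>g\<in>carrier G. \<exists>P\<in>\<P>. X = g <# P)"
  unfolding left_cosets_def LCOSETS_def by auto

locale fg_group = group G for G (structure) +
  fixes A
  assumes finite_generators: "finite A" and generators: "generating_set G A"
begin

abbreviation wdist where "wdist \<equiv> word_dist G A"

lemmas dist_refl = word_dist_refl[OF generators]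
lemmas dist_sym = word_dist_sym[OF generators]
lemmas dist_triangle = word_dist_triangle[OF generators]
lemmas finite_ball = finite_word_ball[OF generators finite_generators]

lemma dist_right_mult: "x \<in> carrier G \<Longrightarrow> g \<in> carrier G \<Longrightarrow> wdist x (x \<otimes> g) = wdist \<one> g"
  using word_dist_left_mult[of x \<one> g] by simp

definition coarsely_equal :: "'a set \<Rightarrow> 'a set \<Rightarrow> bool" (infix "\<simeq>" 50) where
  "X \<simeq> Y \<longleftrightarrow> X \<subseteq> carrier G \<and> Y \<subseteq> carrier G \<and> (\<exists>r. coarsely_close wdist r X Y)"

lemma coarsely_close_sym:
  assumes "X \<subseteq> carrier G" "Y \<subseteq> carrier G" "coarsely_close wdist r X Y"
  shows "coarsely_close wdist r Y X"
  using assms(3) unfolding coarsely_close_def by (metis assms(1,2) dist_sym subsetD)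

lemma coarsely_close_trans:
  assumes "X \<subseteq> carrier G" "Y \<subseteq> carrier G" "Z \<subseteq> carrier G"
    and XY: "coarsely_close wdist r X Y" and YZ: "coarsely_close wdist s Y Z"
  shows "coarsely_close wdist (r + s) X Z"
proof (rule coarsely_closeI)
  fix x assume x: "x \<in> X"
  obtain y where y: "y \<in> Y" "wdist x y \<le> r" using coarsely_closeD1[OF XY x] by blast
  obtain z where z: "z \<in> Z" "wdist y z \<le> s" using coarsely_closeD1[OF YZ y(1)] by blast
  have "x \<in> carrier G" "y \<in> carrier G" "z \<in> carrier G" using x y z assms(1-3) by auto
  then have "wdist x z \<le> r + s" using dist_triangle[of x y z] x y z by linarith
  then show "\<exists>z\<in>Z. wdist x z \<le> r + s" using z by blast
next
  fix z assume z: "z \<in> Z"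
  obtain y where y: "y \<in> Y" "wdist y z \<le> s" using coarsely_closeD2[OF YZ z] by blast
  obtain x where x: "x \<in> X" "wdist x y \<le> r" using coarsely_closeD2[OF XY y(1)] by blast
  have "x \<in> carrier G" "y \<in> carrier G" "z \<in> carrier G" using x y z assms(1-3) by auto
  then have "wdist x z \<le> r + s" using dist_triangle[of x y z] x y z by linarith
  then show "\<exists>x\<in>X. wdist x z \<le> r + s" using x by blast
qed

lemma coarsely_close_left_mult:
  assumes "g \<in> carrier G" "X \<subseteq> carrier G" "Y \<subseteq> carrier G" "coarsely_close wdist r X Y"
  shows "coarsely_close wdist r (g <# X) (g <# Y)"
proof -
  have "wdist (g \<otimes> x) (g \<otimes> y) = wdist x y" if "x \<in> X" "y \<in> Y" for x y
    using that assms word_dist_left_mult by blast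
  then show ?thesis using assms(4) unfolding coarsely_close_def l_coset_def by fastforce
qed

lemma coarsely_equal_refl: "X \<subseteq> carrier G \<Longrightarrow> X \<simeq> X"
  unfolding coarsely_equal_def coarsely_close_def using dist_refl
  by (metis order_refl subsetD)

lemma coarsely_equal_sym: "X \<simeq> Y \<Longrightarrow> Y \<simeq> X"
  unfolding coarsely_equal_def using coarsely_close_sym by blast

lemma coarsely_equal_trans: "X \<simeq> Y \<Longrightarrow> Y \<simeq> Z \<Longrightarrow> X \<simeq> Z"
  unfolding coarsely_equal_def using coarsely_close_trans by blast

lemma coarsely_equal_left_mult: "g \<in> carrier G \<Longrightarrow> X \<simeq> Y \<Longrightarrow> g <# X \<simeq> g <# Y"
  unfolding coarsely_equal_def using coarsely_close_left_mult l_coset_subset_G by blast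

lemma coarsely_equal_left_mult_iff:
  assumes "g \<in> carrier G" "X \<subseteq> carrier G" "Y \<subseteq> carrier G"
  shows "g <# X \<simeq> g <# Y \<longleftrightarrow> X \<simeq> Y"
  using coarsely_equal_left_mult[of g X Y] coarsely_equal_left_mult[of "inv g" "g <# X" "g <# Y"] assms
  by (auto simp: lcos_m_assoc lcos_mult_one)

definition coarse_stabilizer :: "'a set \<Rightarrow> 'a set" where
  "coarse_stabilizer X = {w \<in> carrier G. w <# X \<simeq> X}"

lemma subgroup_coarse_stabilizer:
  assumes X: "X \<subseteq> carrier G"
  shows "subgroup (coarse_stabilizer X) G"
proof (rule subgroupI)
  have "\<one> \<in> coarse_stabilizer X"
    unfolding coarse_stabilizer_def using coarsely_equal_refl[OF X] lcos_mult_one[OF X] by simp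
  then show "coarse_stabilizer X \<noteq> {}" by blast
  show "coarse_stabilizer X \<subseteq> carrier G" by (auto simp: coarse_stabilizer_def)
  fix v assume v: "v \<in> coarse_stabilizer X"
  then have vG: "v \<in> carrier G" and vX: "v <# X \<simeq> X" by (auto simp: coarse_stabilizer_def)
  from coarsely_equal_left_mult[OF inv_closed[OF vG] vX] have "X \<simeq> inv v <# X"
    using vG X by (simp add: lcos_m_assoc lcos_mult_one)
  then show "inv v \<in> coarse_stabilizer X"
    using vG coarsely_equal_sym by (auto simp: coarse_stabilizer_def)
  fix w assume "w \<in> coarse_stabilizer X"
  then have wG: "w \<in> carrier G" and wX: "w <# X \<simeq> X" by (auto simp: coarse_stabilizer_def)
  have "(v \<otimes> w) <# X \<simeq> v <# X"
    using coarsely_equal_left_mult[OF vG wX] vG wG X by (simp add: lcos_m_assoc)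
  then show "v \<otimes> w \<in> coarse_stabilizer X"
    using coarsely_equal_trans vX vG wG by (auto simp: coarse_stabilizer_def)
qed

lemma coarse_stabilizer_cong:
  assumes "X \<simeq> Y" shows "coarse_stabilizer X = coarse_stabilizer Y"
proof -
  have "w <# X \<simeq> X \<longleftrightarrow> w <# Y \<simeq> Y" if "w \<in> carrier G" for w
    using coarsely_equal_left_mult[OF that assms] assms
    by (meson coarsely_equal_sym coarsely_equal_trans)
  then show ?thesis unfolding coarse_stabilizer_def by auto
qed

lemma coarse_stabilizer_left_mult:
  assumes g: "g \<in> carrier G" and X: "X \<subseteq> carrier G"
  shows "coarse_stabilizer (g <# X) = conjugate_by G g (coarse_stabilizer X)"
proof (rule Set.set_eqI)
  fix w
  have sub: "coarse_stabilizer X \<subseteq> carrier G" by (auto simp: coarse_stabilizer_def)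
  have "w <# (g <# X) \<simeq> g <# X \<longleftrightarrow> (inv g \<otimes> w \<otimes> g) <# X \<simeq> X" if w: "w \<in> carrier G"
  proof -
    have "w <# (g <# X) = g <# ((inv g \<otimes> w \<otimes> g) <# X)"
      using w g X by (simp add: lcos_m_assoc m_assoc)
    then show ?thesis
      using coarsely_equal_left_mult_iff[OF g _ X, of "(inv g \<otimes> w \<otimes> g) <# X"] w g X l_coset_subset_G by simp
  qed
  then show "w \<in> coarse_stabilizer (g <# X) \<longleftrightarrow> w \<in> conjugate_by G g (coarse_stabilizer X)"
    unfolding mem_conjugate_by_iff[OF g sub] by (auto simp: coarse_stabilizer_def g)
qed

lemma conjugate_by_coarsely_equal:
  assumes g: "g \<in> carrier G" and X: "X \<subseteq> carrier G"
  shows "conjugate_by G g X \<simeq> g <# X"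
proof -
  have "wdist (y \<otimes> inv g) y = wdist \<one> g" if "y \<in> carrier G" for y
    using dist_right_mult[of "y \<otimes> inv g" g] that g by (simp add: m_assoc)
  moreover have "g <# X \<subseteq> carrier G" using l_coset_subset_G[OF X g] .
  moreover have "conjugate_by G g X = (\<lambda>y. y \<otimes> inv g) ` (g <# X)"
    unfolding conjugate_by_def r_coset_def by auto
  ultimately have near: "conjugate_by G g X = (\<lambda>y. y \<otimes> inv g) ` (g <# X)"
    "\<And>y. y \<in> g <# X \<Longrightarrow> wdist (y \<otimes> inv g) y \<le> wdist \<one> g" by auto
  have "coarsely_close wdist (wdist \<one> g) (conjugate_by G g X) (g <# X)"
    unfolding near(1) by (rule coarsely_closeI) (use near(2) in blast)+
  then show ?thesis
    unfolding coarsely_equal_def using mem_conjugate_by_iff[OF g X] l_coset_subset_G[OF X g] by blast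
qed

text \<open>Moving a bounded distance in the word metric means multiplying on the right by one of finitely many
elements. If the left cosets of the intersection are finitely many, their representatives take \<open>k\<close> into
\<open>K'\<close>. Conversely choose \<open>u k\<close> in a finite ball with \<open>inv k \<otimes> u k \<in> K'\<close>, that is, a short move from
\<open>inv k\<close> into \<open>K'\<close>; equal values \<open>u k = u l\<close> put \<open>inv k \<otimes> l\<close> into \<open>K'\<close>, so finitely many cosets
occur.\<close>
lemma finite_index_Int_iff:
  assumes K: "subgroup K G" and K': "subgroup K' G"
  shows "finite_index_in G (K \<inter> K') K \<longleftrightarrow> (\<exists>r. \<forall>k\<in>K. \<exists>j\<in>K'. wdist k j \<le> r)"
proof -
  let ?J = "K \<inter> K'"
  have J: "subgroup ?J G" by (rule subgroups_Inter_pair[OF K K'])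
  have sub: "K \<subseteq> carrier G" "K' \<subseteq> carrier G" using K K' subgroup.subset by auto
  have cosets: "lcosets\<^bsub>G\<lparr>carrier := K\<rparr>\<^esub> ?J = (\<lambda>k. k <# ?J) ` K"
    unfolding LCOSETS_def l_coset_def by auto
  have "subgroup ?J (G\<lparr>carrier := K\<rparr>)" by (rule subgroup_incl[OF J K]) blast
  then have fi: "finite_index_in G ?J K \<longleftrightarrow> finite ((\<lambda>k. k <# ?J) ` K)"
    unfolding finite_index_in_def cosets by simp
  show ?thesis unfolding fi
  proof
    assume fin: "finite ((\<lambda>k. k <# ?J) ` K)"
    define rep where "rep c = (SOME y. y \<in> c)" for c :: "'a set"
    define r where "r = (\<Sum>c\<in>(\<lambda>k. k <# ?J) ` K. wdist \<one> (rep c))"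
    have "\<exists>j\<in>K'. wdist k j \<le> r" if k: "k \<in> K" for k
    proof -
      define c where "c = inv k <# ?J"
      have c: "c \<in> (\<lambda>k. k <# ?J) ` K" unfolding c_def using subgroup.m_inv_closed[OF K k] by blast
      have kG: "k \<in> carrier G" using k sub by auto
      have "rep c \<in> c" unfolding rep_def c_def using lcos_self[OF _ J, of "inv k"] kG by (intro someI) auto
      then have rep: "rep c \<in> carrier G" "k \<otimes> rep c \<in> ?J"
        using mem_l_coset_iff[of "inv k" ?J] kG sub unfolding c_def by auto
      have "wdist k (k \<otimes> rep c) = wdist \<one> (rep c)" by (rule dist_right_mult[OF kG rep(1)])
      also have "\<dots> \<le> r" unfolding r_def using c fin word_dist_nonneg by (intro member_le_sum) auto
      finally show ?thesis using rep by blast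
    qed
    then show "\<exists>r. \<forall>k\<in>K. \<exists>j\<in>K'. wdist k j \<le> r" by blast
  next
    assume "\<exists>r. \<forall>k\<in>K. \<exists>j\<in>K'. wdist k j \<le> r"
    then obtain r where r: "\<And>k. k \<in> K \<Longrightarrow> \<exists>j\<in>K'. wdist k j \<le> r" by blast
    have "\<exists>u. u \<in> carrier G \<and> wdist \<one> u \<le> r \<and> inv k \<otimes> u \<in> K'" if k: "k \<in> K" for k
    proof -
      have kG: "k \<in> carrier G" using k sub by auto
      obtain j where j: "j \<in> K'" "wdist (inv k) j \<le> r" using r[OF subgroup.m_inv_closed[OF K k]] by blast
      have jG: "j \<in> carrier G" using j sub by auto
      have "wdist \<one> (k \<otimes> j) \<le> r" using word_dist_left_mult[of k "inv k" j] kG jG j by simp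
      then show ?thesis using j kG jG by (intro exI[of _ "k \<otimes> j"]) simp
    qed
    then obtain u where u: "\<And>k. k \<in> K \<Longrightarrow> u k \<in> carrier G \<and> wdist \<one> (u k) \<le> r \<and> inv k \<otimes> u k \<in> K'"
      by metis
    have eq: "k <# ?J = l <# ?J" if kl: "k \<in> K" "l \<in> K" "u k = u l" for k l
    proof -
      have G: "k \<in> carrier G" "l \<in> carrier G" "u k \<in> carrier G" using kl sub u by auto
      have "(inv k \<otimes> u k) \<otimes> inv (inv l \<otimes> u l) \<in> K'"
        using u kl subgroup.m_closed[OF K'] subgroup.m_inv_closed[OF K'] by blast
      moreover have "(inv k \<otimes> u k) \<otimes> inv (inv l \<otimes> u l) = inv k \<otimes> l"
        unfolding kl(3)[symmetric] using G by (simp add: inv_mult_group m_assoc)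
      moreover have "inv k \<otimes> l \<in> K" using kl subgroup.m_closed[OF K] subgroup.m_inv_closed[OF K] by blast
      ultimately have "l \<in> k <# ?J" using mem_l_coset_iff[of k ?J l] G sub by auto
      then show ?thesis by (rule l_repr_independence[OF _ G(1) J])
    qed
    have "finite (u ` K)"
      by (rule finite_subset[OF _ finite_ball[OF one_closed, of r]]) (use u in auto)
    moreover have "(\<lambda>k. k <# ?J) ` K \<subseteq> (\<lambda>b. (SOME k. k \<in> K \<and> u k = b) <# ?J) ` (u ` K)"
    proof
      fix c assume "c \<in> (\<lambda>k. k <# ?J) ` K"
      then obtain k where k: "k \<in> K" "c = k <# ?J" by blast
      have "(SOME l. l \<in> K \<and> u l = u k) \<in> K \<and> u (SOME l. l \<in> K \<and> u l = u k) = u k"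
        by (rule someI[of _ k]) (use k in simp)
      then have "c = (SOME l. l \<in> K \<and> u l = u k) <# ?J" unfolding k(2) by (intro eq) (use k in auto)
      then show "c \<in> (\<lambda>b. (SOME k. k \<in> K \<and> u k = b) <# ?J) ` (u ` K)" using k by blast
    qed
    ultimately show "finite ((\<lambda>k. k <# ?J) ` K)" by (meson finite_imageI finite_subset)
  qed
qed

text \<open>Finite index of the intersection on both sides says that \<open>K\<close> and its conjugate are coarsely equal,
and right multiplication by \<open>inv g\<close> moves \<open>g <# K\<close> to the conjugate by a bounded distance.\<close>
lemma commensurator_eq_coarse_stabilizer:
  assumes K: "subgroup K G"
  shows "commensurator G K = coarse_stabilizer K"
proof -
  have KG: "K \<subseteq> carrier G" by (rule subgroup.subset[OF K])
  have "finite_index_in G (K \<inter> conjugate_by G g K) K \<and> finite_index_in G (K \<inter> conjugate_by G g K) (conjugate_by G g K)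
    \<longleftrightarrow> g <# K \<simeq> K" if g: "g \<in> carrier G" for g
  proof -
    let ?K' = "conjugate_by G g K"
    have K': "subgroup ?K' G" by (rule subgroup_conjugate_by[OF g K])
    have K'G: "?K' \<subseteq> carrier G" by (rule subgroup.subset[OF K'])
    have "finite_index_in G (K \<inter> ?K') K \<and> finite_index_in G (K \<inter> ?K') ?K' \<longleftrightarrow>
      (\<exists>r. \<forall>k\<in>K. \<exists>j\<in>?K'. wdist k j \<le> r) \<and> (\<exists>r. \<forall>j\<in>?K'. \<exists>k\<in>K. wdist j k \<le> r)"
      using finite_index_Int_iff[OF K K'] finite_index_Int_iff[OF K' K] by (simp add: Int_commute)
    also have "\<dots> \<longleftrightarrow> ?K' \<simeq> K"
    proof
      assume "(\<exists>r. \<forall>k\<in>K. \<exists>j\<in>?K'. wdist k j \<le> r) \<and> (\<exists>r. \<forall>j\<in>?K'. \<exists>k\<in>K. wdist j k \<le> r)"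
      then obtain r s where r: "\<forall>k\<in>K. \<exists>j\<in>?K'. wdist k j \<le> r" and s: "\<forall>j\<in>?K'. \<exists>k\<in>K. wdist j k \<le> s" by blast
      have "coarsely_close wdist (max r s) ?K' K"
      proof (rule coarsely_closeI)
        show "\<exists>k\<in>K. wdist j k \<le> max r s" if "j \<in> ?K'" for j using s that by (meson max.coboundedI2)
        show "\<exists>j\<in>?K'. wdist j k \<le> max r s" if "k \<in> K" for k
          using r that dist_sym[of k] KG K'G by (metis max.coboundedI1 subsetD)
      qed
      then show "?K' \<simeq> K" unfolding coarsely_equal_def using KG K'G by blast
    next
      assume "?K' \<simeq> K"
      then obtain r where r: "coarsely_close wdist r ?K' K" unfolding coarsely_equal_def by blast
      show "(\<exists>r. \<forall>k\<in>K. \<exists>j\<in>?K'. wdist k j \<le> r) \<and> (\<exists>r. \<forall>j\<in>?K'. \<exists>k\<in>K. wdist j k \<le> r)"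
        using r coarsely_close_sym[OF K'G KG r] unfolding coarsely_close_def by blast
    qed
    also have "\<dots> \<longleftrightarrow> g <# K \<simeq> K"
      using conjugate_by_coarsely_equal[OF g KG] coarsely_equal_sym coarsely_equal_trans by blast
    finally show ?thesis .
  qed
  then show ?thesis unfolding commensurator_def coarse_stabilizer_def by blast
qed

text \<open>This description removes conjugates and indices from the definition of a refinement: conjugate
stabilisers are stabilisers of translates.\<close>
lemma commensurators_of_conjugates_eq:
  assumes "\<And>P. P \<in> \<P> \<Longrightarrow> subgroup P G"
  shows "commensurators_of_conjugates G \<P> = coarse_stabilizer ` left_cosets G \<P>"
proof -
  have "commensurator G (conjugate_by G g P) = coarse_stabilizer (g <# P)" if "g \<in> carrier G" "P \<in> \<P>" for g P
    using commensurator_eq_coarse_stabilizer[OF subgroup_conjugate_by] that assms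
      coarse_stabilizer_cong[OF conjugate_by_coarsely_equal] subgroup.subset by metis
  then have "{commensurator G (conjugate_by G g P) | g P. g \<in> carrier G \<and> P \<in> \<P>} =
    {coarse_stabilizer (g <# P) | g P. g \<in> carrier G \<and> P \<in> \<P>}"
    by (intro Collect_cong ex_cong1) auto
  also have "\<dots> = coarse_stabilizer ` {g <# P | g P. g \<in> carrier G \<and> P \<in> \<P>}" by blast
  also have "{g <# P | g P. g \<in> carrier G \<and> P \<in> \<P>} = left_cosets G \<P>"
    unfolding set_eq_iff mem_left_cosets_iff by blast
  finally show ?thesis unfolding commensurators_of_conjugates_def .
qed

end

section \<open>Refinements\<close>

text \<open>The assumption \<open>uniform\<close> upgrades coarse equality of cosets to a bound that is the same for all pairs.
In the application it comes from the quasi-isometry of pairs together with fineness.\<close>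
locale uniformly_separated_cosets = fg_group G A for G (structure) and A +
  fixes \<P> :: "'a set set" and M :: real
  assumes subgroups: "P \<in> \<P> \<Longrightarrow> subgroup P G" and infinite_subgroups: "P \<in> \<P> \<Longrightarrow> infinite P"
    and uniform: "X \<in> left_cosets G \<P> \<Longrightarrow> Y \<in> left_cosets G \<P> \<Longrightarrow> X \<simeq> Y \<Longrightarrow> coarsely_close wdist M X Y"
begin

lemma left_coset_subset: "X \<in> left_cosets G \<P> \<Longrightarrow> X \<subseteq> carrier G"
  unfolding mem_left_cosets_iff by (elim bexE) (simp add: l_coset_subset_G subgroup.subset[OF subgroups])

lemma left_coset_mult:
  "g \<in> carrier G \<Longrightarrow> X \<in> left_cosets G \<P> \<Longrightarrow> g <# X \<in> left_cosets G \<P>"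
proof -
  assume g: "g \<in> carrier G" and "X \<in> left_cosets G \<P>"
  then obtain h P where h: "h \<in> carrier G" "P \<in> \<P>" "X = h <# P" unfolding mem_left_cosets_iff by blast
  have "g <# X = (g \<otimes> h) <# P"
    unfolding h(3) using lcos_m_assoc[OF subgroup.subset[OF subgroups[OF h(2)]] g h(1)] .
  then show ?thesis unfolding mem_left_cosets_iff using g h by blast
qed

lemma coset_translate_subset_stabilizer:
  assumes "g \<in> carrier G" "P \<in> \<P>"
  shows "(\<lambda>y. y \<otimes> inv g) ` (g <# P) \<subseteq> coarse_stabilizer (g <# P)"
proof safe
  fix y assume y: "y \<in> g <# P"
  note P = subgroups[OF assms(2)]
  note PG = subgroup.subset[OF P]
  have yG: "y \<in> carrier G" "inv g \<otimes> y \<in> P" using y mem_l_coset_iff[OF assms(1) PG] by auto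
  have "(y \<otimes> inv g) <# (g <# P) = y <# P" using yG assms(1) PG by (simp add: lcos_m_assoc m_assoc)
  also have "y <# P = g <# P" using l_repr_independence[OF y assms(1) P] by simp
  finally show "y \<otimes> inv g \<in> coarse_stabilizer (g <# P)"
    unfolding coarse_stabilizer_def using yG(1) assms(1) coarsely_equal_refl l_coset_subset_G[OF PG] by simp
qed

lemma infinite_coarse_stabilizer:
  assumes "X \<in> left_cosets G \<P>" shows "infinite (coarse_stabilizer X)"
proof
  obtain g P where X: "g \<in> carrier G" "P \<in> \<P>" "X = g <# P" using assms unfolding mem_left_cosets_iff by blast
  note PG = subgroup.subset[OF subgroups[OF X(2)]]
  assume "finite (coarse_stabilizer X)"
  then have "finite ((\<lambda>y. y \<otimes> inv g) ` (g <# P))"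
    using coset_translate_subset_stabilizer[OF X(1,2)] X(3) finite_subset by blast
  moreover have "(\<lambda>y. y \<otimes> inv g) ` (g <# P) = (\<lambda>p. g \<otimes> p \<otimes> inv g) ` P"
    unfolding l_coset_def by auto
  moreover have "inj_on (\<lambda>p. g \<otimes> p \<otimes> inv g) P"
    using X(1) PG by (intro inj_onI) (auto simp: subset_iff)
  ultimately show False using infinite_subgroups[OF X(2)] finite_imageD by metis
qed

text \<open>An element \<open>w\<close> of the stabiliser moves \<open>g \<in> X\<close> into \<open>w <# X\<close>, which by uniformity is within distance
\<open>M\<close> of \<open>X\<close>; thus \<open>w\<close> itself is near \<open>X\<close>. Conversely, \<open>X\<close> translated on the right by \<open>inv g\<close>
lies in the stabiliser. In particular the original subgroup is coarsely equal to its commensurator.\<close>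
lemma coarse_stabilizer_coarsely_equal:
  assumes "X \<in> left_cosets G \<P>" shows "coarse_stabilizer X \<simeq> X"
proof -
  obtain g P where X: "g \<in> carrier G" "P \<in> \<P>" "X = g <# P" using assms unfolding mem_left_cosets_iff by blast
  note XG = left_coset_subset[OF assms]
  have gX: "g \<in> X" unfolding X(3) by (rule lcos_self[OF X(1) subgroups[OF X(2)]])
  have "coarsely_close wdist (wdist \<one> g + \<bar>M\<bar>) (coarse_stabilizer X) X"
  proof (rule coarsely_closeI)
    fix w assume "w \<in> coarse_stabilizer X"
    then have w: "w \<in> carrier G" "w <# X \<simeq> X" by (auto simp: coarse_stabilizer_def)
    have close: "coarsely_close wdist M (w <# X) X" using uniform[OF left_coset_mult[OF w(1) assms] assms w(2)] .
    have "w \<otimes> g \<in> w <# X" using gX unfolding l_coset_def by blast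
    from coarsely_closeD1[OF close this] obtain y where y: "y \<in> X" "wdist (w \<otimes> g) y \<le> M" by blast
    have "wdist w y \<le> wdist w (w \<otimes> g) + wdist (w \<otimes> g) y"
      using w(1) X(1) subsetD[OF XG y(1)] by (intro dist_triangle m_closed)
    then have "wdist w y \<le> wdist \<one> g + \<bar>M\<bar>" using dist_right_mult[OF w(1) X(1)] y(2) by linarith
    then show "\<exists>y\<in>X. wdist w y \<le> wdist \<one> g + \<bar>M\<bar>" using y by blast
  next
    fix y assume y: "y \<in> X"
    then have yG: "y \<in> carrier G" using XG by blast
    have "y \<otimes> inv g \<in> coarse_stabilizer X" using coset_translate_subset_stabilizer[OF X(1,2)] y unfolding X(3) by blast
    moreover have "wdist (y \<otimes> inv g) y = wdist \<one> g"
      using dist_right_mult[of "y \<otimes> inv g" g] yG X(1) by (simp add: m_assoc)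
    ultimately show "\<exists>w\<in>coarse_stabilizer X. wdist w y \<le> wdist \<one> g + \<bar>M\<bar>"
      by (intro bexI[of _ "y \<otimes> inv g"]) auto
  qed
  then show ?thesis unfolding coarsely_equal_def using XG by (auto simp: coarse_stabilizer_def)
qed

end

locale refined_cosets = uniformly_separated_cosets G A \<P> M for G (structure) and A \<P> M +
  fixes \<R> :: "'a set set"
  assumes finite_subgroups: "finite \<P>" and refinement: "is_refinement G \<P> \<R>"
begin

lemma refinement_eq:
  "\<R> \<subseteq> coarse_stabilizer ` left_cosets G \<P>"
  "X \<in> left_cosets G \<P> \<Longrightarrow> \<exists>!R. R \<in> \<R> \<and> (\<exists>g\<in>carrier G. R = conjugate_by G g (coarse_stabilizer X))"
  using refinement commensurators_of_conjugates_eq[OF subgroups] unfolding is_refinement_def by auto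

lemma refinement_member:
  assumes "R \<in> \<R>"
  obtains X where "X \<in> left_cosets G \<P>" "R = coarse_stabilizer X" "R \<simeq> X"
  using refinement_eq(1) assms coarse_stabilizer_coarsely_equal by blast

lemma refinement_subgroup: "R \<in> \<R> \<Longrightarrow> subgroup R G"
  by (elim refinement_member) (simp add: subgroup_coarse_stabilizer left_coset_subset)

lemma refinement_infinite: "R \<in> \<R> \<Longrightarrow> infinite R"
  by (elim refinement_member) (simp add: infinite_coarse_stabilizer)

lemma refined_coset_subset: "Z \<in> left_cosets G \<R> \<Longrightarrow> Z \<subseteq> carrier G"
  unfolding mem_left_cosets_iff
  by (elim bexE) (simp add: l_coset_subset_G subgroup.subset[OF refinement_subgroup])

text \<open>Each member of \<open>\<P>\<close> contributes a single conjugacy class of commensurators. Finiteness is what makes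
the distance between refined cosets and cosets uniform.\<close>
lemma finite_refinement: "finite \<R>"
proof (rule finite_surj[OF finite_subgroups])
  define F where "F P = (THE R. R \<in> \<R> \<and> (\<exists>g\<in>carrier G. R = conjugate_by G g (coarse_stabilizer P)))" for P
  show "\<R> \<subseteq> F ` \<P>"
  proof
    fix R assume R: "R \<in> \<R>"
    then obtain X where X: "X \<in> left_cosets G \<P>" "R = coarse_stabilizer X" using refinement_eq(1) by blast
    then obtain g P where g: "g \<in> carrier G" "P \<in> \<P>" "R = coarse_stabilizer (g <# P)"
      unfolding mem_left_cosets_iff by blast
    note PG = subgroup.subset[OF subgroups[OF g(2)]]
    have "P \<in> left_cosets G \<P>" unfolding mem_left_cosets_iff using g(2) lcos_mult_one[OF PG] by force
    from refinement_eq(2)[OF this] have "F P = R"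
      unfolding F_def by (rule the1_equality) (use R g coarse_stabilizer_left_mult[OF g(1) PG] in blast)
    then show "R \<in> F ` \<P>" using g(2) by blast
  qed
qed

lemma refined_coset_close_to_coset:
  "\<exists>r. \<forall>Z\<in>left_cosets G \<R>. \<exists>X\<in>left_cosets G \<P>. coarsely_close wdist r Z X"
proof -
  have "\<exists>X r. X \<in> left_cosets G \<P> \<and> coarsely_close wdist r R X" if "R \<in> \<R>" for R
    using refinement_member[OF that] unfolding coarsely_equal_def by metis
  then obtain F r where F: "\<And>R. R \<in> \<R> \<Longrightarrow> F R \<in> left_cosets G \<P>" "\<And>R. R \<in> \<R> \<Longrightarrow> coarsely_close wdist (r R) R (F R)"
    by metis
  define s where "s = (\<Sum>R\<in>\<R>. \<bar>r R\<bar>)"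
  have "\<exists>X\<in>left_cosets G \<P>. coarsely_close wdist s Z X" if Z: "Z \<in> left_cosets G \<R>" for Z
  proof -
    obtain x R where x: "x \<in> carrier G" "R \<in> \<R>" "Z = x <# R" using Z unfolding mem_left_cosets_iff by blast
    have "\<bar>r R\<bar> \<le> s" unfolding s_def using x(2) finite_refinement by (intro member_le_sum) auto
    then have "coarsely_close wdist s R (F R)" using coarsely_close_mono[OF F(2)[OF x(2)]] by auto
    then have "coarsely_close wdist s Z (x <# F R)" unfolding x(3)
      using coarsely_close_left_mult x F left_coset_subset subgroup.subset[OF refinement_subgroup] by metis
    then show ?thesis using left_coset_mult[OF x(1) F(1)[OF x(2)]] by blast
  qed
  then show ?thesis by blast
qed

lemma coset_coarsely_equal_refined_coset:
  assumes X: "X \<in> left_cosets G \<P>"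
  shows "\<exists>Z\<in>left_cosets G \<R>. Z \<simeq> X"
proof -
  note XG = left_coset_subset[OF X]
  obtain R k where R: "R \<in> \<R>" "k \<in> carrier G" "R = conjugate_by G k (coarse_stabilizer X)"
    using refinement_eq(2)[OF X] by blast
  have "R = coarse_stabilizer (k <# X)" using R coarse_stabilizer_left_mult XG by simp
  then have "R \<simeq> k <# X" using coarse_stabilizer_coarsely_equal[OF left_coset_mult[OF R(2) X]] by simp
  from coarsely_equal_left_mult[OF inv_closed[OF R(2)] this] have "inv k <# R \<simeq> X"
    using R(2) XG by (simp add: lcos_m_assoc lcos_mult_one)
  moreover have "inv k <# R \<in> left_cosets G \<R>" unfolding mem_left_cosets_iff using R by blast
  ultimately show ?thesis by blast
qed

text \<open>If \<open>x <# R\<close> and \<open>y <# S\<close> are coarsely equal, the stabilisers of their coarse classes, which are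
conjugates of \<open>R\<close> and \<open>S\<close>, agree. A refinement has one member per conjugacy class, so \<open>R = S\<close>, and then
\<open>inv y \<otimes> x\<close> stabilises the coarse class of \<open>R\<close>, that is, it lies in \<open>R\<close>.\<close>
lemma refined_cosets_coarsely_equal_imp_eq:
  assumes Z: "Z \<in> left_cosets G \<R>" "Z' \<in> left_cosets G \<R>" and eq: "Z \<simeq> Z'"
  shows "Z = Z'"
proof -
  obtain x R where x: "x \<in> carrier G" "R \<in> \<R>" "Z = x <# R" using Z unfolding mem_left_cosets_iff by blast
  obtain y S where y: "y \<in> carrier G" "S \<in> \<R>" "Z' = y <# S" using Z unfolding mem_left_cosets_iff by blast
  obtain X where X: "X \<in> left_cosets G \<P>" "R = coarse_stabilizer X" "R \<simeq> X" using refinement_member[OF x(2)] .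
  obtain Y where Y: "Y \<in> left_cosets G \<P>" "S = coarse_stabilizer Y" "S \<simeq> Y" using refinement_member[OF y(2)] .
  note XG = left_coset_subset[OF X(1)] and YG = left_coset_subset[OF Y(1)]
  have transfer: "(inv y \<otimes> x) <# X \<simeq> Y'" if "x <# R \<simeq> y <# S" "S \<simeq> Y'" "Y' \<subseteq> carrier G" for Y'
  proof -
    have "x <# X \<simeq> x <# R" using coarsely_equal_left_mult[OF x(1) X(3)] coarsely_equal_sym by blast
    moreover have "y <# S \<simeq> y <# Y'" using coarsely_equal_left_mult[OF y(1) that(2)] .
    ultimately have "x <# X \<simeq> y <# Y'" using that(1) coarsely_equal_trans by blast
    from coarsely_equal_left_mult[OF inv_closed[OF y(1)] this] show ?thesis
      using x(1) y(1) XG that(3) by (simp add: lcos_m_assoc lcos_mult_one)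
  qed
  have RS: "x <# R \<simeq> y <# S" using eq x y by simp
  have "S = coarse_stabilizer ((inv y \<otimes> x) <# X)"
    unfolding Y(2) using coarse_stabilizer_cong[OF transfer[OF RS Y(3) YG]] by simp
  then have "S = conjugate_by G (inv y \<otimes> x) (coarse_stabilizer X)"
    using coarse_stabilizer_left_mult[OF _ XG] x(1) y(1) by simp
  moreover have "R = conjugate_by G \<one> (coarse_stabilizer X)"
    using coarse_stabilizer_left_mult[OF one_closed XG] X(2) lcos_mult_one[OF XG] by simp
  ultimately have "R = S" using refinement_eq(2)[OF X(1)] x y by (metis inv_closed m_closed one_closed)
  then have "(inv y \<otimes> x) <# X \<simeq> X" using transfer[OF RS _ XG] X(3) by simp
  then have "inv y \<otimes> x \<in> R" using X(2) x(1) y(1) by (simp add: coarse_stabilizer_def)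
  then have "x \<in> y <# R" using mem_l_coset_iff[OF y(1) subgroup.subset[OF refinement_subgroup[OF x(2)]]] x(1) by simp
  then show ?thesis using l_repr_independence[OF _ y(1) refinement_subgroup[OF x(2)]] x y \<open>R = S\<close> by simp
qed

end

section \<open>Coned-off Cayley graphs\<close>

text \<open>The vertices in \<open>W\<close> are deleted. A set, rather than a single vertex, allows for the whole graph as
the case \<open>W = {}\<close>, so that one estimate serves for both hyperbolicity and fineness.\<close>
definition avoiding :: "'v rel \<Rightarrow> 'v set \<Rightarrow> 'v rel" where
  "avoiding E W = {(x, y) \<in> E. x \<notin> W \<and> y \<notin> W}"

lemma avoiding_empty [simp]: "avoiding E {} = E"
  by (auto simp: avoiding_def)

lemma sym_avoiding: "sym E \<Longrightarrow> sym (avoiding E W)"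
  by (auto simp: avoiding_def sym_def)

lemma fine_at_iff:
  assumes P: "pair_sym_digraph P" and v: "(v, v) \<notin> parcs P"
  shows "fine_at (with_proj P) v \<longleftrightarrow> (\<forall>x n. (v, x) \<in> parcs P \<longrightarrow>
    finite {y. (v, y) \<in> parcs P \<and> (x, y) \<in> reach_within (avoiding (parcs P) {v}) n})"
proof -
  interpret pair_sym_digraph P by fact
  let ?\<Delta> = "pre_digraph.del_vert (with_proj P) v"
  have wf: "wf_digraph ?\<Delta>" by (rule wf_digraph_del_vert)
  have ends: "arcs_ends ?\<Delta> = avoiding (parcs P) {v}"
    unfolding arcs_ends_conv del_vert_simps avoiding_def by force
  have le: "angle (with_proj P) v x y \<le> ereal r \<longleftrightarrow> (\<exists>m. real m \<le> r \<and> (x, y) \<in> avoiding (parcs P) {v} ^^ m)"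
    if "(v, x) \<in> parcs P" for x y r
  proof -
    have "x \<in> verts ?\<Delta>" using that v wellformed' by (auto simp: del_vert_simps)
    then show ?thesis unfolding angle_def graph_dist_le_iff[OF wf] ends by blast
  qed
  show ?thesis
  proof
    assume f: "fine_at (with_proj P) v"
    show "\<forall>x n. (v, x) \<in> parcs P \<longrightarrow>
      finite {y. (v, y) \<in> parcs P \<and> (x, y) \<in> reach_within (avoiding (parcs P) {v}) n}"
    proof (intro allI impI)
      fix x n assume x: "(v, x) \<in> parcs P"
      have "finite {y. (v, y) \<in> parcs P \<and> angle (with_proj P) v x y \<le> ereal (real n)}"
        using f x unfolding fine_at_def by simp
      then show "finite {y. (v, y) \<in> parcs P \<and> (x, y) \<in> reach_within (avoiding (parcs P) {v}) n}"
        by (rule finite_subset[rotated]) (auto simp: le[OF x] elim!: reach_withinE)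
    qed
  next
    assume fin: "\<forall>x n. (v, x) \<in> parcs P \<longrightarrow>
      finite {y. (v, y) \<in> parcs P \<and> (x, y) \<in> reach_within (avoiding (parcs P) {v}) n}"
    have "finite {y. (v, y) \<in> parcs P \<and> angle (with_proj P) v x y \<le> ereal r}" if x: "(v, x) \<in> parcs P" for x r
    proof (rule finite_subset)
      show "finite {y. (v, y) \<in> parcs P \<and> (x, y) \<in> reach_within (avoiding (parcs P) {v}) (nat \<lfloor>r\<rfloor>)}"
        using fin x by blast
      show "{y. (v, y) \<in> parcs P \<and> angle (with_proj P) v x y \<le> ereal r} \<subseteq>
        {y. (v, y) \<in> parcs P \<and> (x, y) \<in> reach_within (avoiding (parcs P) {v}) (nat \<lfloor>r\<rfloor>)}"
        unfolding le[OF x] by (auto intro: reach_withinI le_nat_floor)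
    qed
    then show "fine_at (with_proj P) v" unfolding fine_at_def by simp
  qed
qed

abbreviation coned_off_edges :: "('a, 'm) monoid_scheme \<Rightarrow> 'a set set \<Rightarrow> 'a set \<Rightarrow> ('a + 'a set) rel" where
  "coned_off_edges G \<P> S \<equiv> parcs (coned_off_cayley_graph G \<P> S)"

abbreviation coned_off_vertices :: "('a, 'm) monoid_scheme \<Rightarrow> 'a set set \<Rightarrow> 'a set \<Rightarrow> ('a + 'a set) set" where
  "coned_off_vertices G \<P> S \<equiv> pverts (coned_off_cayley_graph G \<P> S)"

lemma coned_off_vertices_eq: "coned_off_vertices G \<P> S = Inl ` carrier G \<union> Inr ` left_cosets G \<P>"
  by (simp add: coned_off_cayley_graph_def)

lemma (in group) coned_off_edges_iff:
  assumes "S \<subseteq> carrier G"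
  shows "(Inl x, Inl y) \<in> coned_off_edges G \<P> S \<longleftrightarrow>
      x \<in> carrier G \<and> y \<in> carrier G \<and> (inv x \<otimes> y \<in> S \<or> inv y \<otimes> x \<in> S)"
    and "(Inl x, Inr X) \<in> coned_off_edges G \<P> S \<longleftrightarrow> X \<in> left_cosets G \<P> \<and> x \<in> X"
    and "(Inr X, Inl x) \<in> coned_off_edges G \<P> S \<longleftrightarrow> X \<in> left_cosets G \<P> \<and> x \<in> X"
    and "(Inr X, Inr Y) \<notin> coned_off_edges G \<P> S"
proof -
  have *: "(\<exists>s\<in>S. x \<in> carrier G \<and> y = x \<otimes> s) \<longleftrightarrow> x \<in> carrier G \<and> y \<in> carrier G \<and> inv x \<otimes> y \<in> S" for x y
    using assms by (auto simp: subset_iff intro!: bexI[of _ "inv x \<otimes> y"])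
  have "(Inl x, Inl y) \<in> coned_off_edges G \<P> S \<longleftrightarrow>
    (\<exists>s\<in>S. x \<in> carrier G \<and> y = x \<otimes> s) \<or> (\<exists>s\<in>S. y \<in> carrier G \<and> x = y \<otimes> s)"
    by (auto simp: coned_off_cayley_graph_def coned_off_arcs_def)
  then show "(Inl x, Inl y) \<in> coned_off_edges G \<P> S \<longleftrightarrow>
      x \<in> carrier G \<and> y \<in> carrier G \<and> (inv x \<otimes> y \<in> S \<or> inv y \<otimes> x \<in> S)"
    unfolding * by blast
qed (auto simp: coned_off_cayley_graph_def coned_off_arcs_def)

text \<open>Paths in the Cayley graph meet no cone vertex at all.\<close>
lemma (in group) word_path_avoiding_cones:
  assumes T: "generating_set G T" and xy: "x \<in> carrier G" "y \<in> carrier G" "word_dist G T x y \<le> real n"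
    and W: "W \<subseteq> range Inr"
  shows "(Inl x, Inl y) \<in> reach_within (avoiding (coned_off_edges G \<P> T) W) n"
proof -
  have TG: "T \<subseteq> carrier G" using T by (simp add: generating_set_def)
  have edge: "(Inl u, Inl v) \<in> reach_within (avoiding (coned_off_edges G \<P> T) W) 1"
    if uv: "(u, v) \<in> cayley_arcs G T" for u v
  proof (rule reach_within_edge)
    obtain s where s: "u \<in> carrier G" "s \<in> T \<union> set_inv T" "v = u \<otimes> s" using uv by (auto simp: cayley_arcs_def)
    have sG: "s \<in> carrier G" using s letters_in_carrier[OF TG] by blast
    have "inv u \<otimes> v = s" "inv v \<otimes> u = inv s" using s sG by (simp_all add: inv_mult_group m_assoc)
    moreover have "s \<in> T \<or> inv s \<in> T" using s(2) TG by (auto simp: SET_INV_def subset_iff)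
    ultimately have "(Inl u, Inl v) \<in> coned_off_edges G \<P> T"
      unfolding coned_off_edges_iff[OF TG] using s sG by auto
    then show "(Inl u, Inl v) \<in> avoiding (coned_off_edges G \<P> T) W" using W by (auto simp: avoiding_def)
  qed
  show ?thesis
    using reach_within_map[of "cayley_arcs G T" Inl, OF edge] xy word_dist_le_iff[OF T xy(1,2)] by simp
qed

section \<open>Transporting a hyperbolically embedded collection\<close>

text \<open>The constants of the various hypotheses are merged into one pair \<open>L\<close>, \<open>C\<close>.\<close>
locale uniform_pair_quasi_isometry =
  G: fg_group G A + H: fg_group H B
  for G :: "('a, 'm) monoid_scheme" (structure) and A and H :: "('b, 'n) monoid_scheme" and B +
  fixes \<P> :: "'a set set" and \<Q> :: "'b set set" and T :: "'b set"
    and q :: "'a \<Rightarrow> 'b" and qbar :: "'b \<Rightarrow> 'a" and L C :: real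
  assumes T: "generating_set H T"
    and P_subgroup: "P \<in> \<P> \<Longrightarrow> subgroup P G" and P_infinite: "P \<in> \<P> \<Longrightarrow> infinite P"
    and hyperbolically_embedded: "hyperbolically_embedded_wrt H \<Q> T"
    and L: "1 \<le> L" and C: "0 \<le> C"
    and q_in: "x \<in> carrier G \<Longrightarrow> q x \<in> carrier H" and qbar_in: "h \<in> carrier H \<Longrightarrow> qbar h \<in> carrier G"
    and q_upper: "x \<in> carrier G \<Longrightarrow> y \<in> carrier G \<Longrightarrow> H.wdist (q x) (q y) \<le> L * G.wdist x y + C"
    and q_lower: "x \<in> carrier G \<Longrightarrow> y \<in> carrier G \<Longrightarrow> G.wdist x y \<le> L * H.wdist (q x) (q y) + L * C"
    and qbar_q: "x \<in> carrier G \<Longrightarrow> G.wdist (qbar (q x)) x \<le> C"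
    and q_qbar: "h \<in> carrier H \<Longrightarrow> H.wdist (q (qbar h)) h \<le> C"
    and coset_image: "X \<in> left_cosets G \<P> \<Longrightarrow> \<exists>Y\<in>left_cosets H \<Q>. coarsely_close H.wdist C (q ` X) Y"
    and coset_preimage: "Y \<in> left_cosets H \<Q> \<Longrightarrow> \<exists>X\<in>left_cosets G \<P>. coarsely_close H.wdist C (q ` X) Y"
    and uniform_action: "g \<in> carrier G \<Longrightarrow> h \<in> carrier H \<Longrightarrow> h' \<in> carrier H \<Longrightarrow>
      word_dist H T (q (g \<otimes> qbar h)) (q (g \<otimes> qbar h')) \<le> L * word_dist H T h h' + C"
begin

abbreviation distT where "distT \<equiv> word_dist H T"

lemmas distT_sym = H.word_dist_sym[OF T]
lemmas distT_triangle = H.word_dist_triangle[OF T]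

lemma T_subset: "T \<subseteq> carrier H"
  using T by (simp add: generating_set_def)

lemma Q_subgroup: "Q \<in> \<Q> \<Longrightarrow> subgroup Q H" and Q_infinite: "Q \<in> \<Q> \<Longrightarrow> infinite Q"
  using hyperbolically_embedded unfolding hyperbolically_embedded_wrt_def by blast+

lemma H_coset_subset: "Y \<in> left_cosets H \<Q> \<Longrightarrow> Y \<subseteq> carrier H"
  unfolding H.mem_left_cosets_iff by (elim bexE) (simp add: H.l_coset_subset_G subgroup.subset[OF Q_subgroup])

lemma H_coset_infinite: "Y \<in> left_cosets H \<Q> \<Longrightarrow> infinite Y"
proof -
  assume "Y \<in> left_cosets H \<Q>"
  then obtain h Q where h: "h \<in> carrier H" "Q \<in> \<Q>" "Y = h <#\<^bsub>H\<^esub> Q" unfolding H.mem_left_cosets_iff by blast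
  have "Y = (\<lambda>y. h \<otimes>\<^bsub>H\<^esub> y) ` Q" unfolding h(3) l_coset_def by blast
  moreover have "inj_on (\<lambda>y. h \<otimes>\<^bsub>H\<^esub> y) Q" using H.inj_on_g' h subgroup.subset[OF Q_subgroup[OF h(2)]] by blast
  ultimately show ?thesis using Q_infinite[OF h(2)] finite_imageD by blast
qed

abbreviation E2 where "E2 \<equiv> coned_off_edges H \<Q> T"
abbreviation V2 where "V2 \<equiv> coned_off_vertices H \<Q> T"

lemma H_graph: "pair_sym_digraph (coned_off_cayley_graph H \<Q> T)"
  by (rule coned_off_cayley_graph_sym_digraph[OF H.is_group Q_subgroup T_subset])

lemma H_connected: "connected_relation V2 E2"
  using hyperbolically_embedded connected_pair_graph_iff[OF H_graph]
  unfolding hyperbolically_embedded_wrt_def by blast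

lemma H_slim: "\<exists>\<delta>. slim_triangles V2 (hop E2) \<delta>"
  using hyperbolically_embedded hyperbolic_graph_iff_slim_triangles[OF H_graph H_connected]
  unfolding hyperbolically_embedded_wrt_def by blast

lemmas E2_iff = H.coned_off_edges_iff[OF T_subset]

lemma H_fine:
  assumes "Y \<in> left_cosets H \<Q>" "y \<in> Y"
  shows "finite {z \<in> Y. (Inl y, Inl z) \<in> reach_within (avoiding E2 {Inr Y}) n}"
proof -
  have "fine_at (with_proj (coned_off_cayley_graph H \<Q> T)) (Inr Y)"
    using hyperbolically_embedded assms unfolding hyperbolically_embedded_wrt_def by blast
  then have "finite {w. (Inr Y, w) \<in> E2 \<and> (Inl y, w) \<in> reach_within (avoiding E2 {Inr Y}) n}"
    using fine_at_iff[OF H_graph E2_iff(4)] E2_iff(3)[of Y y] assms by simp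
  then have "finite (Inl ` {z \<in> Y. (Inl y, Inl z) \<in> reach_within (avoiding E2 {Inr Y}) n} :: ('b + 'b set) set)"
    by (rule finite_subset[rotated]) (use assms E2_iff in auto)
  then show ?thesis by (rule finite_imageD) simp
qed

lemma path_avoiding_cones:
  "x \<in> carrier H \<Longrightarrow> y \<in> carrier H \<Longrightarrow> distT x y \<le> real n \<Longrightarrow> W \<subseteq> range Inr \<Longrightarrow>
    (Inl x, Inl y) \<in> reach_within (avoiding E2 W) n"
  by (rule H.word_path_avoiding_cones[OF T])

lemma sym_E2: "sym (avoiding E2 W)"
  using H_connected by (intro sym_avoiding) (simp add: connected_relation_def)

text \<open>A Lipschitz constant from the word metric of the finite set \<open>B\<close> to that of \<open>T\<close>.\<close>
definition \<kappa> :: nat where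
  "\<kappa> = (SOME k. \<forall>x\<in>carrier H. \<forall>y\<in>carrier H. distT x y \<le> real k * H.wdist x y)"

lemma distT_le: "x \<in> carrier H \<Longrightarrow> y \<in> carrier H \<Longrightarrow> distT x y \<le> real \<kappa> * H.wdist x y"
  using someI_ex[OF H.word_dist_change_generators[OF H.generators H.finite_generators T], folded \<kappa>_def]
  by simp

lemma distT_le_trans: "x \<in> carrier H \<Longrightarrow> y \<in> carrier H \<Longrightarrow> H.wdist x y \<le> r \<Longrightarrow> distT x y \<le> real \<kappa> * r"
  using distT_le by (meson mult_left_mono of_nat_0_le_iff order_trans)

text \<open>From any element of \<open>Y\<close> a path of bounded length leads to the cone vertex of \<open>Y'\<close> while avoiding the
cone vertex of \<open>Y\<close>. If the two vertices differ, all of the infinite set \<open>Y\<close> has bounded angular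
diameter, contrary to fineness at \<open>Y\<close>.\<close>
lemma H_cosets_coarsely_equal_imp_eq:
  assumes Y: "Y \<in> left_cosets H \<Q>" "Y' \<in> left_cosets H \<Q>" and eq: "H.coarsely_equal Y Y'"
  shows "Y = Y'"
proof (rule ccontr)
  assume neq: "Y \<noteq> Y'"
  note sub = H_coset_subset[OF Y(1)] H_coset_subset[OF Y(2)]
  obtain r where r: "coarsely_close H.wdist r Y Y'" using eq unfolding H.coarsely_equal_def by blast
  define n where "n = nat \<lceil>real \<kappa> * r\<rceil>"
  let ?W = "{Inr Y} :: ('b + 'b set) set"
  have to_cone: "(Inl y, Inr Y') \<in> reach_within (avoiding E2 ?W) (n + 1)" if y: "y \<in> Y" for y
  proof -
    obtain y' where y': "y' \<in> Y'" "H.wdist y y' \<le> r" using coarsely_closeD1[OF r y] by blast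
    have G: "y \<in> carrier H" "y' \<in> carrier H" using y y' sub by auto
    have "distT y y' \<le> real n" unfolding n_def using distT_le_trans[OF G y'(2)] by linarith
    then have "(Inl y, Inl y') \<in> reach_within (avoiding E2 ?W) n" using path_avoiding_cones[OF G] by blast
    moreover have "(Inl y', Inr Y') \<in> avoiding E2 ?W" using E2_iff Y y' neq by (auto simp: avoiding_def)
    ultimately show ?thesis using reach_within_trans reach_within_edge by metis
  qed
  obtain y where y: "y \<in> Y" using H_coset_infinite[OF Y(1)] by fastforce
  have "(Inl y, Inl z) \<in> reach_within (avoiding E2 ?W) ((n + 1) + (n + 1))" if "z \<in> Y" for z
    using reach_within_trans[OF to_cone[OF y] reach_within_sym[OF sym_E2 to_cone[OF that]]] .
  then have "Y \<subseteq> {z \<in> Y. (Inl y, Inl z) \<in> reach_within (avoiding E2 ?W) ((n + 1) + (n + 1))}" by blast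
  then show False using H_fine[OF Y(1) y] H_coset_infinite[OF Y(1)] finite_subset by blast
qed

lemma close_image:
  assumes "X \<subseteq> carrier G" "Y \<subseteq> carrier G" "coarsely_close G.wdist r X Y"
  shows "coarsely_close H.wdist (L * r + C) (q ` X) (q ` Y)"
proof -
  have "H.wdist (q x) (q y) \<le> L * r + C" if "x \<in> X" "y \<in> Y" "G.wdist x y \<le> r" for x y
  proof -
    have "x \<in> carrier G" "y \<in> carrier G" using that assms by auto
    moreover have "L * G.wdist x y \<le> L * r" using that(3) L by (intro mult_left_mono) auto
    ultimately show ?thesis using q_upper[of x y] by linarith
  qed
  then show ?thesis using assms(3) unfolding coarsely_close_def by fastforce
qed

lemma close_preimage:
  assumes "X \<subseteq> carrier G" "Y \<subseteq> carrier G" "coarsely_close H.wdist r (q ` X) (q ` Y)"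
  shows "coarsely_close G.wdist (L * r + L * C) X Y"
proof -
  have "G.wdist x y \<le> L * r + L * C" if "x \<in> X" "y \<in> Y" "H.wdist (q x) (q y) \<le> r" for x y
  proof -
    have "x \<in> carrier G" "y \<in> carrier G" using that assms by auto
    moreover have "L * H.wdist (q x) (q y) \<le> L * r" using that(3) L by (intro mult_left_mono) auto
    ultimately show ?thesis using q_lower[of x y] by linarith
  qed
  then show ?thesis using assms(3) unfolding coarsely_close_def by fastforce
qed

lemma q_image_subset: "X \<subseteq> carrier G \<Longrightarrow> q ` X \<subseteq> carrier H"
  using q_in by blast

text \<open>Coarsely equal cosets in \<open>G\<close> are matched with the same coset in \<open>H\<close>, and each is matched with error
\<open>C\<close>; so their images are \<open>C + C\<close> apart, whatever the original distance was.\<close>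
sublocale uniformly_separated_cosets G A \<P> "L * (C + C) + L * C"
proof (intro uniformly_separated_cosets.intro uniformly_separated_cosets_axioms.intro G.fg_group_axioms
    P_subgroup P_infinite)
  fix X Y assume X: "X \<in> left_cosets G \<P>" and Y: "Y \<in> left_cosets G \<P>" and eq: "G.coarsely_equal X Y"
  have sub: "X \<subseteq> carrier G" "Y \<subseteq> carrier G" using eq unfolding G.coarsely_equal_def by auto
  obtain X' where X': "X' \<in> left_cosets H \<Q>" "coarsely_close H.wdist C (q ` X) X'" using coset_image[OF X] by blast
  obtain Y' where Y': "Y' \<in> left_cosets H \<Q>" "coarsely_close H.wdist C (q ` Y) Y'" using coset_image[OF Y] by blast
  note sub' = H_coset_subset[OF X'(1)] H_coset_subset[OF Y'(1)] q_image_subset[OF sub(1)] q_image_subset[OF sub(2)]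
  have "H.coarsely_equal (q ` X) (q ` Y)"
    using eq close_image[OF sub] sub' unfolding G.coarsely_equal_def H.coarsely_equal_def by blast
  moreover have "H.coarsely_equal (q ` X) X'" "H.coarsely_equal (q ` Y) Y'"
    using X' Y' sub' unfolding H.coarsely_equal_def by blast+
  ultimately have "H.coarsely_equal X' Y'" using H.coarsely_equal_sym H.coarsely_equal_trans by blast
  then have "X' = Y'" using H_cosets_coarsely_equal_imp_eq X' Y' by blast
  then have "coarsely_close H.wdist (C + C) (q ` X) (q ` Y)"
    using H.coarsely_close_trans[OF sub'(3,1,4) X'(2)] H.coarsely_close_sym[OF sub'(4,2) Y'(2)] by blast
  then show "coarsely_close G.wdist (L * (C + C) + L * C) X Y" by (rule close_preimage[OF sub])
qed

text \<open>The quasi-action involves \<open>g \<otimes> qbar (q x)\<close> in place of \<open>g \<otimes> x\<close>. The two differ by a bounded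
distance, independent of \<open>g\<close> because the word metric is invariant under left multiplication.\<close>
lemma uniform_q:
  "\<exists>c. \<forall>g\<in>carrier G. \<forall>x\<in>carrier G. \<forall>y\<in>carrier G. distT (q (g \<otimes> x)) (q (g \<otimes> y)) \<le> L * distT (q x) (q y) + c"
proof -
  define e where "e = real \<kappa> * (L * C + C)"
  have near: "distT (q (g \<otimes> qbar (q x))) (q (g \<otimes> x)) \<le> e" if g: "g \<in> carrier G" and x: "x \<in> carrier G" for g x
  proof -
    have G: "qbar (q x) \<in> carrier G" using x q_in qbar_in by blast
    have "G.wdist (g \<otimes> qbar (q x)) (g \<otimes> x) \<le> C" using G.word_dist_left_mult[OF g G x] qbar_q[OF x] by simp
    then have "L * G.wdist (g \<otimes> qbar (q x)) (g \<otimes> x) \<le> L * C" using L by (intro mult_left_mono) auto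
    then have "H.wdist (q (g \<otimes> qbar (q x))) (q (g \<otimes> x)) \<le> L * C + C"
      using q_upper[OF G.m_closed[OF g G] G.m_closed[OF g x]] by linarith
    then show ?thesis unfolding e_def using distT_le_trans q_in g G x by simp
  qed
  have "distT (q (g \<otimes> x)) (q (g \<otimes> y)) \<le> L * distT (q x) (q y) + (C + 2 * e)"
    if g: "g \<in> carrier G" and x: "x \<in> carrier G" and y: "y \<in> carrier G" for g x y
  proof -
    let ?a = "q (g \<otimes> x)" and ?b = "q (g \<otimes> qbar (q x))" and ?c = "q (g \<otimes> qbar (q y))" and ?d = "q (g \<otimes> y)"
    have H: "?a \<in> carrier H" "?b \<in> carrier H" "?c \<in> carrier H" "?d \<in> carrier H" using g x y q_in qbar_in by auto
    have "distT ?a ?d \<le> distT ?a ?b + distT ?b ?c + distT ?c ?d"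
      using distT_triangle[OF H(1,2,4)] distT_triangle[OF H(2,3,4)] by linarith
    then show ?thesis using near[OF g x] near[OF g y] distT_sym[OF H(1,2)]
        uniform_action[OF g q_in[OF x] q_in[OF y]] by linarith
  qed
  then show ?thesis by blast
qed

lemma finite_q_preimage:
  assumes "finite F" shows "finite {x \<in> carrier G. q x \<in> F}"
proof -
  have "finite {x \<in> carrier G. q x = h}" for h
  proof (cases "\<exists>x\<in>carrier G. q x = h")
    case True
    then obtain x where x: "x \<in> carrier G" "q x = h" by blast
    have "G.wdist x y \<le> L * C" if "y \<in> carrier G" "q y = h" for y
      using q_lower[OF x(1) that(1)] x(2) that(2) H.dist_refl[OF q_in[OF x(1)]] by simp
    then show ?thesis by (intro finite_subset[OF _ G.finite_ball[OF x(1), of "L * C"]]) auto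
  next
    case False
    then have empty: "{x \<in> carrier G. q x = h} = {}" by blast
    show ?thesis unfolding empty by simp
  qed
  then have "finite (\<Union>h\<in>F. {x \<in> carrier G. q x = h})" using assms by blast
  then show ?thesis by (rule finite_subset[rotated]) blast
qed

end

locale refined_pair_quasi_isometry =
  uniform_pair_quasi_isometry G A H B \<P> \<Q> T q qbar L C
  for G :: "('a, 'm) monoid_scheme" (structure) and A and H :: "('b, 'n) monoid_scheme" and B
    and \<P> \<Q> T q qbar L C +
  fixes \<R> :: "'a set set"
  assumes P_finite: "finite \<P>" and refines: "is_refinement G \<P> \<R>"
begin

sublocale refined_cosets G A \<P> "L * (C + C) + L * C" \<R>
  by (intro refined_cosets.intro refined_cosets_axioms.intro uniformly_separated_cosets_axioms P_finite refines)

text \<open>The map picks some coset in \<open>H/\<Q>\<close> coarsely equal to \<open>q ` Z\<close>, which is determined by \<open>Z\<close>. It is injective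
since distinct refined cosets are coarsely distinct, and surjective since every coset in \<open>G/\<P>\<close>
is coarsely equal to a refined one.\<close>
lemma coset_correspondence:
  "\<exists>\<psi> r. bij_betw \<psi> (left_cosets G \<R>) (left_cosets H \<Q>) \<and>
     (\<forall>Z\<in>left_cosets G \<R>. coarsely_close H.wdist r (q ` Z) (\<psi> Z))"
proof -
  obtain s where s: "\<And>Z. Z \<in> left_cosets G \<R> \<Longrightarrow> \<exists>X\<in>left_cosets G \<P>. coarsely_close G.wdist s Z X"
    using refined_coset_close_to_coset by blast
  have "\<exists>Y. Y \<in> left_cosets H \<Q> \<and> coarsely_close H.wdist (L * s + C + C) (q ` Z) Y" if Z: "Z \<in> left_cosets G \<R>" for Z
  proof -
    obtain X where X: "X \<in> left_cosets G \<P>" "coarsely_close G.wdist s Z X" using s[OF Z] by blast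
    obtain Y where Y: "Y \<in> left_cosets H \<Q>" "coarsely_close H.wdist C (q ` X) Y" using coset_image[OF X(1)] by blast
    note sub = refined_coset_subset[OF Z] left_coset_subset[OF X(1)]
    show ?thesis
      using H.coarsely_close_trans[OF q_image_subset[OF sub(1)] q_image_subset[OF sub(2)] H_coset_subset[OF Y(1)]
          close_image[OF sub X(2)] Y(2)] Y(1) by blast
  qed
  then obtain \<psi> where \<psi>: "\<And>Z. Z \<in> left_cosets G \<R> \<Longrightarrow> \<psi> Z \<in> left_cosets H \<Q>"
    "\<And>Z. Z \<in> left_cosets G \<R> \<Longrightarrow> coarsely_close H.wdist (L * s + C + C) (q ` Z) (\<psi> Z)"
    by metis
  have eq: "H.coarsely_equal (q ` Z) (\<psi> Z)" if "Z \<in> left_cosets G \<R>" for Z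
    unfolding H.coarsely_equal_def
    using \<psi>[OF that] q_image_subset[OF refined_coset_subset[OF that]] H_coset_subset by blast
  have "inj_on \<psi> (left_cosets G \<R>)"
  proof (rule inj_onI)
    fix Z Z' assume Z: "Z \<in> left_cosets G \<R>" "Z' \<in> left_cosets G \<R>" and same: "\<psi> Z = \<psi> Z'"
    have "H.coarsely_equal (q ` Z) (q ` Z')"
      using eq[OF Z(1)] eq[OF Z(2)] same H.coarsely_equal_sym H.coarsely_equal_trans by metis
    then have "G.coarsely_equal Z Z'"
      using close_preimage[OF refined_coset_subset[OF Z(1)] refined_coset_subset[OF Z(2)]]
        refined_coset_subset[OF Z(1)] refined_coset_subset[OF Z(2)]
      unfolding H.coarsely_equal_def G.coarsely_equal_def by blast
    then show "Z = Z'" by (rule refined_cosets_coarsely_equal_imp_eq[OF Z])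
  qed
  moreover have "Y \<in> \<psi> ` left_cosets G \<R>" if Y: "Y \<in> left_cosets H \<Q>" for Y
  proof -
    obtain X where X: "X \<in> left_cosets G \<P>" "coarsely_close H.wdist C (q ` X) Y" using coset_preimage[OF Y] by blast
    obtain Z where Z: "Z \<in> left_cosets G \<R>" "G.coarsely_equal Z X" using coset_coarsely_equal_refined_coset[OF X(1)] by blast
    note sub = refined_coset_subset[OF Z(1)] left_coset_subset[OF X(1)]
    have "H.coarsely_equal (q ` Z) (q ` X)"
      using Z(2) close_image[OF sub] q_image_subset[OF sub(1)] q_image_subset[OF sub(2)]
      unfolding H.coarsely_equal_def G.coarsely_equal_def by blast
    moreover have "H.coarsely_equal (q ` X) Y"
      using X(2) q_image_subset[OF sub(2)] H_coset_subset[OF Y] unfolding H.coarsely_equal_def by blast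
    ultimately have "H.coarsely_equal (\<psi> Z) Y" using eq[OF Z(1)] H.coarsely_equal_sym H.coarsely_equal_trans by metis
    then have "\<psi> Z = Y" using H_cosets_coarsely_equal_imp_eq \<psi>(1)[OF Z(1)] Y by blast
    then show ?thesis using Z(1) by blast
  qed
  ultimately have "bij_betw \<psi> (left_cosets G \<R>) (left_cosets H \<Q>)" using \<psi>(1) by (auto simp: bij_betw_def)
  then show ?thesis using \<psi>(2) by blast
qed

text \<open>Translating a pair \<open>(x, y)\<close> to \<open>(\<one>, inv x \<otimes> y)\<close> and back changes the \<open>T\<close>-distance of the images in
a controlled way. The threshold for membership in \<open>S\<close> is \<open>L * D + c\<close> rather than \<open>D\<close> to make up for the first of
these translations, and the second one accounts for \<open>N\<close>.\<close>
lemma pulled_back_generators: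
  "\<exists>S N. S \<subseteq> carrier G \<and>
     (\<forall>x\<in>carrier G. \<forall>y\<in>carrier G. distT (q x) (q y) \<le> D \<longrightarrow> inv x \<otimes> y \<in> S) \<and>
     (\<forall>x\<in>carrier G. \<forall>y\<in>carrier G. inv x \<otimes> y \<in> S \<longrightarrow> distT (q x) (q y) \<le> N)"
proof -
  obtain c where c: "\<And>g x y. g \<in> carrier G \<Longrightarrow> x \<in> carrier G \<Longrightarrow> y \<in> carrier G \<Longrightarrow>
      distT (q (g \<otimes> x)) (q (g \<otimes> y)) \<le> L * distT (q x) (q y) + c"
    using uniform_q by blast
  define S where "S = {s \<in> carrier G. distT (q \<one>) (q s) \<le> L * D + c}"
  have "inv x \<otimes> y \<in> S" if xy: "x \<in> carrier G" "y \<in> carrier G" "distT (q x) (q y) \<le> D" for x y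
  proof -
    have "distT (q \<one>) (q (inv x \<otimes> y)) \<le> L * distT (q x) (q y) + c" using c[of "inv x" x y] xy by simp
    also have "\<dots> \<le> L * D + c" using xy(3) L by (simp add: mult_left_mono)
    finally show ?thesis unfolding S_def using xy by simp
  qed
  moreover have "distT (q x) (q y) \<le> L * (L * D + c) + c"
    if xy: "x \<in> carrier G" "y \<in> carrier G" "inv x \<otimes> y \<in> S" for x y
  proof -
    have "distT (q x) (q y) \<le> L * distT (q \<one>) (q (inv x \<otimes> y)) + c" using c[of x \<one> "inv x \<otimes> y"] xy by simp
    also have "\<dots> \<le> L * (L * D + c) + c" using xy(3) L unfolding S_def by (simp add: mult_left_mono)
    finally show ?thesis .
  qed
  ultimately show ?thesis by (intro exI[of _ S] exI[of _ "L * (L * D + c) + c"]) (auto simp: S_def)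
qed

lemma hyperbolically_embedded_refinement: "hyperbolically_embedded G \<R>"
proof -
  obtain \<psi> r0 where bij: "bij_betw \<psi> (left_cosets G \<R>) (left_cosets H \<Q>)"
    and r0: "\<And>Z. Z \<in> left_cosets G \<R> \<Longrightarrow> coarsely_close H.wdist r0 (q ` Z) (\<psi> Z)"
    using coset_correspondence by blast
  define r where "r = \<bar>r0\<bar>"
  have close: "coarsely_close H.wdist r (q ` Z) (\<psi> Z)" if "Z \<in> left_cosets G \<R>" for Z
    unfolding r_def using coarsely_close_mono[OF r0[OF that]] by auto
  have r: "0 \<le> r" by (simp add: r_def)
  have \<psi>_in: "\<psi> Z \<in> left_cosets H \<Q>" if "Z \<in> left_cosets G \<R>" for Z using bij that by (rule bij_betw_apply)
  have \<psi>_inj: "\<psi> Z = \<psi> Z' \<longleftrightarrow> Z = Z'" if "Z \<in> left_cosets G \<R>" "Z' \<in> left_cosets G \<R>" for Z Z'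
    using bij that unfolding bij_betw_def inj_on_def by blast
  \<comment> \<open>\<open>D\<close> bounds the \<open>T\<close>-distances that have to be bridged by one element of \<open>S\<close>: between the images of
  lifted endpoints of an edge of the Cayley graph, between a lifted element of a coset and the
  corresponding refined coset, and between \<open>x\<close> and \<open>qbar (q x)\<close>.\<close>
  define D where "D = 2 * (real \<kappa> * C) + real \<kappa> * (r + C) + 1"
  have D: "2 * (real \<kappa> * C) + 1 \<le> D" "real \<kappa> * (r + C) \<le> D" "real \<kappa> * C \<le> D"
    unfolding D_def using r C by simp_all
  obtain S N where S: "S \<subseteq> carrier G"
    and S_near: "\<And>x y. x \<in> carrier G \<Longrightarrow> y \<in> carrier G \<Longrightarrow> distT (q x) (q y) \<le> D \<Longrightarrow> inv x \<otimes> y \<in> S"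
    and S_bounded: "\<And>x y. x \<in> carrier G \<Longrightarrow> y \<in> carrier G \<Longrightarrow> inv x \<otimes> y \<in> S \<Longrightarrow> distT (q x) (q y) \<le> N"
    using pulled_back_generators[of D] by blast
  define E1 where "E1 = coned_off_edges G \<R> S"
  define V1 where "V1 = coned_off_vertices G \<R> S"
  note E1_iff = G.coned_off_edges_iff[OF S, of _ _ \<R>, folded E1_def]
  have G_graph: "pair_sym_digraph (coned_off_cayley_graph G \<R> S)"
    by (rule coned_off_cayley_graph_sym_digraph[OF G.is_group refinement_subgroup S])
  interpret \<Gamma>1: pair_sym_digraph "coned_off_cayley_graph G \<R> S" by (rule G_graph)
  have E1_in: "E1 \<subseteq> V1 \<times> V1" unfolding E1_def V1_def using \<Gamma>1.wellformed' by auto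
  have sym_E1: "sym E1" unfolding E1_def using \<Gamma>1.sym_arcs by (simp add: symmetric_def)
  have V1_iff: "Inl x \<in> V1 \<longleftrightarrow> x \<in> carrier G" "Inr Z \<in> V1 \<longleftrightarrow> Z \<in> left_cosets G \<R>" for x Z
    unfolding V1_def coned_off_vertices_eq by auto
  have V2_iff: "Inl x \<in> V2 \<longleftrightarrow> x \<in> carrier H" "Inr Y \<in> V2 \<longleftrightarrow> Y \<in> left_cosets H \<Q>" for x Y
    unfolding coned_off_vertices_eq by auto
  define f where "f u = (case u of Inl x \<Rightarrow> Inl (q x) | Inr Z \<Rightarrow> Inr (\<psi> Z))" for u
  define fbar where "fbar w = (case w of Inl h \<Rightarrow> Inl (qbar h) | Inr Y \<Rightarrow> Inr (the_inv_into (left_cosets G \<R>) \<psi> Y))" for w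
  have f_simps: "f (Inl x) = Inl (q x)" "f (Inr Z) = Inr (\<psi> Z)"
    and fbar_simps: "fbar (Inl h) = Inl (qbar h)" "fbar (Inr Y) = Inr (the_inv_into (left_cosets G \<R>) \<psi> Y)" for x Z h Y
    by (simp_all add: f_def fbar_def)
  have inverse: "the_inv_into (left_cosets G \<R>) \<psi> (\<psi> Z) = Z" if "Z \<in> left_cosets G \<R>" for Z
    using bij that by (simp add: bij_betw_def the_inv_into_f_f)
  have inverse': "the_inv_into (left_cosets G \<R>) \<psi> Y \<in> left_cosets G \<R>"
      "\<psi> (the_inv_into (left_cosets G \<R>) \<psi> Y) = Y" if "Y \<in> left_cosets H \<Q>" for Y
    using bij that by (auto simp: bij_betw_def f_the_inv_into_f intro: the_inv_into_into)
  define m where "m = nat \<lceil>real \<kappa> * r\<rceil>"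
  define k where "k = nat \<lceil>N\<rceil> + (m + 1) + nat \<lceil>real \<kappa> * C\<rceil> + 2"
  have to_cone: "\<exists>y\<in>\<psi> Z. H.wdist (q x) y \<le> r \<and> y \<in> carrier H \<and>
      (Inl (q x), Inl y) \<in> reach_within (avoiding E2 W) m"
    if Z: "Z \<in> left_cosets G \<R>" and x: "x \<in> Z" and W: "W \<subseteq> range Inr" for Z x W
  proof -
    obtain y where y: "y \<in> \<psi> Z" "H.wdist (q x) y \<le> r" using coarsely_closeD1[OF close[OF Z]] x by blast
    have H: "q x \<in> carrier H" "y \<in> carrier H"
      using q_in refined_coset_subset[OF Z] x H_coset_subset[OF \<psi>_in[OF Z]] y by auto
    have "distT (q x) y \<le> real m" unfolding m_def using distT_le_trans[OF H y(2)] by linarith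
    from path_avoiding_cones[OF H this W] show ?thesis using y H(2) by blast
  qed
  have Inl_edge: "(f (Inl x), f (Inl y)) \<in> reach_within (avoiding E2 W) k"
    if xy: "(Inl x, Inl y) \<in> E1" and W: "W \<subseteq> range Inr" for x y W
  proof -
    have G: "x \<in> carrier G" "y \<in> carrier G" "inv x \<otimes> y \<in> S \<or> inv y \<otimes> x \<in> S"
      using xy unfolding E1_iff by auto
    have "distT (q x) (q y) \<le> N"
      using G(3) S_bounded[OF G(1,2)] S_bounded[OF G(2,1)] distT_sym[OF q_in[OF G(1)] q_in[OF G(2)]] by auto
    then have "distT (q x) (q y) \<le> real k" unfolding k_def by linarith
    then show ?thesis unfolding f_simps using path_avoiding_cones[OF q_in[OF G(1)] q_in[OF G(2)]] W by blast
  qed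
  have cone_edge: "(f (Inl x), f (Inr Z)) \<in> reach_within (avoiding E2 W) k"
    if xZ: "(Inl x, Inr Z) \<in> E1" and W: "W \<subseteq> range Inr" "f (Inr Z) \<notin> W" for x Z W
  proof -
    have Z: "Z \<in> left_cosets G \<R>" "x \<in> Z" using xZ unfolding E1_iff by auto
    obtain y where y: "y \<in> \<psi> Z" "(Inl (q x), Inl y) \<in> reach_within (avoiding E2 W) m"
      using to_cone[OF Z W(1)] by blast
    have "(Inl y, Inr (\<psi> Z)) \<in> E2" using E2_iff(2) \<psi>_in[OF Z(1)] y(1) by blast
    then have "(Inl y, Inr (\<psi> Z)) \<in> avoiding E2 W" using W unfolding f_simps avoiding_def by auto
    from reach_within_trans[OF y(2) reach_within_edge[OF this]]
    show ?thesis unfolding f_simps by (rule reach_within_mono) (simp add: k_def)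
  qed
  \<comment> \<open>The set \<open>W\<close> is empty for the quasi-isometry and a single cone vertex for fineness.\<close>
  have f_edge: "(f u, f v) \<in> reach_within (avoiding E2 W) k"
    if uv: "(u, v) \<in> E1" and W: "W \<subseteq> range Inr" "f u \<notin> W" "f v \<notin> W" for u v W
  proof (cases u)
    case (Inl x)
    show ?thesis
    proof (cases v)
      case (Inl y)
      then show ?thesis using Inl_edge uv W \<open>u = Inl x\<close> by blast
    next
      case (Inr Z)
      then show ?thesis using cone_edge uv W \<open>u = Inl x\<close> by blast
    qed
  next
    case (Inr Z)
    show ?thesis
    proof (cases v)
      case (Inl y)
      have "(v, u) \<in> E1" using uv sym_E1 by (blast dest: symD)
      then have "(f v, f u) \<in> reach_within (avoiding E2 W) k" using cone_edge W Inl Inr by blast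
      then show ?thesis by (rule reach_within_sym[OF sym_E2])
    next
      case (Inr Z')
      then show ?thesis using uv \<open>u = Inr Z\<close> E1_iff(4) by blast
    qed
  qed
  have near_edge: "(Inl x, Inl y) \<in> E1" if "x \<in> carrier G" "y \<in> carrier G" "distT (q x) (q y) \<le> D" for x y
    unfolding E1_iff using that S_near by blast
  have q_qbar_T: "distT (q (qbar h)) h \<le> real \<kappa> * C" if "h \<in> carrier H" for h
    using distT_le_trans[OF q_in[OF qbar_in[OF that]] that q_qbar[OF that]] .
  have Inl_edge': "(fbar (Inl h), fbar (Inl h')) \<in> reach_within E1 1" if hh: "(Inl h, Inl h') \<in> E2" for h h'
  proof -
    have H: "h \<in> carrier H" "h' \<in> carrier H" "inv\<^bsub>H\<^esub> h \<otimes>\<^bsub>H\<^esub> h' \<in> T \<or> inv\<^bsub>H\<^esub> h' \<otimes>\<^bsub>H\<^esub> h \<in> T"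
      using hh unfolding E2_iff by auto
    note G = qbar_in[OF H(1)] qbar_in[OF H(2)]
    have arc: "distT x (x \<otimes>\<^bsub>H\<^esub> t) \<le> 1" if "x \<in> carrier H" "t \<in> T" for x t
    proof -
      have "(x, x \<otimes>\<^bsub>H\<^esub> t) \<in> cayley_arcs H T" using that by (auto simp: cayley_arcs_def)
      moreover have "x \<otimes>\<^bsub>H\<^esub> t \<in> carrier H" using that T_subset by blast
      ultimately show ?thesis using H.word_dist_le_iff[OF T that(1), of _ 1] reach_within_edge by simp
    qed
    have "distT h h' \<le> 1"
      using H(3) arc[OF H(1), of "inv\<^bsub>H\<^esub> h \<otimes>\<^bsub>H\<^esub> h'"] arc[OF H(2), of "inv\<^bsub>H\<^esub> h' \<otimes>\<^bsub>H\<^esub> h"]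
        distT_sym[OF H(1,2)] H(1,2) by auto
    moreover have "distT (q (qbar h)) (q (qbar h')) \<le> distT (q (qbar h)) h + distT h h' + distT (q (qbar h')) h'"
      using distT_triangle[OF q_in[OF G(1)] H(1) q_in[OF G(2)]] distT_triangle[OF H(1) H(2) q_in[OF G(2)]]
        distT_sym[OF H(2) q_in[OF G(2)]] by linarith
    ultimately have "distT (q (qbar h)) (q (qbar h')) \<le> D"
      using q_qbar_T[OF H(1)] q_qbar_T[OF H(2)] D(1) by linarith
    then have "(Inl (qbar h), Inl (qbar h')) \<in> E1" by (rule near_edge[OF G])
    then show ?thesis unfolding fbar_simps by (rule reach_within_edge)
  qed
  have cone_edge': "(fbar (Inl h), fbar (Inr Y)) \<in> reach_within E1 2" if hY: "(Inl h, Inr Y) \<in> E2" for h Y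
  proof -
    have Y: "Y \<in> left_cosets H \<Q>" "h \<in> Y" using hY unfolding E2_iff by auto
    define Z where "Z = the_inv_into (left_cosets G \<R>) \<psi> Y"
    have Z: "Z \<in> left_cosets G \<R>" "\<psi> Z = Y" unfolding Z_def using inverse'[OF Y(1)] by auto
    obtain x where x: "x \<in> Z" "H.wdist (q x) h \<le> r" using coarsely_closeD2[OF close[OF Z(1)], of h] Y Z(2) by blast
    have G: "x \<in> carrier G" "h \<in> carrier H" "qbar h \<in> carrier G"
      using x refined_coset_subset[OF Z(1)] H_coset_subset[OF Y(1)] Y(2) qbar_in by auto
    have "H.wdist (q (qbar h)) (q x) \<le> r + C"
      using H.dist_triangle[OF q_in[OF G(3)] G(2) q_in[OF G(1)]] q_qbar[OF G(2)] x(2)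
        H.dist_sym[OF G(2) q_in[OF G(1)]] by linarith
    then have "distT (q (qbar h)) (q x) \<le> D"
      using distT_le_trans[OF q_in[OF G(3)] q_in[OF G(1)]] D(2) order_trans by blast
    then have "(Inl (qbar h), Inl x) \<in> E1" by (rule near_edge[OF G(3) G(1)])
    moreover have "(Inl x, Inr Z) \<in> E1" unfolding E1_iff using x Z by blast
    ultimately have "(Inl (qbar h), Inr Z) \<in> reach_within E1 (1 + 1)"
      using reach_within_trans reach_within_edge by metis
    then show ?thesis unfolding fbar_simps Z_def[symmetric] by (simp add: numeral_2_eq_2)
  qed
  interpret QI: graph_quasi_isometry V2 E2 V1 E1 f fbar k
  proof (intro graph_quasi_isometry.intro graph_quasi_isometry_axioms.intro H_connected E1_in sym_E1)
    show "f u \<in> V2" if "u \<in> V1" for u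
      using that q_in \<psi>_in by (cases u) (auto simp: V1_iff V2_iff f_simps)
    show "fbar w \<in> V1" if "w \<in> V2" for w
      using that qbar_in inverse' by (cases w) (auto simp: V1_iff V2_iff fbar_simps)
    show "(f u, f v) \<in> reach_within E2 k" if "(u, v) \<in> E1" for u v
      using f_edge[OF that, of "{}"] by simp
    have k2: "1 \<le> k" "2 \<le> k" by (simp_all add: k_def)
    show "(fbar w, fbar z) \<in> reach_within E1 k" if wz: "(w, z) \<in> E2" for w z
    proof (cases w)
      case (Inl h)
      show ?thesis
      proof (cases z)
        case (Inl h')
        then show ?thesis using reach_within_mono[OF Inl_edge'[of h h'] k2(1)] wz \<open>w = Inl h\<close> by simp
      next
        case (Inr Y)
        then show ?thesis using reach_within_mono[OF cone_edge'[of h Y] k2(2)] wz \<open>w = Inl h\<close> by simp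
      qed
    next
      case (Inr Y)
      show ?thesis
      proof (cases z)
        case (Inl h)
        have "(z, w) \<in> E2" using wz sym_E2[of "{}"] by (auto dest: symD)
        then have "(fbar z, fbar w) \<in> reach_within E1 k"
          using reach_within_mono[OF cone_edge'[of h Y] k2(2)] Inl Inr by simp
        then show ?thesis by (rule reach_within_sym[OF sym_E1])
      next
        case (Inr Y')
        then show ?thesis using wz \<open>w = Inr Y\<close> E2_iff(4) by blast
      qed
    qed
    show "(fbar (f u), u) \<in> reach_within E1 k" if u: "u \<in> V1" for u
    proof (cases u)
      case (Inl x)
      have x: "x \<in> carrier G" using u Inl V1_iff by blast
      have G: "qbar (q x) \<in> carrier G" using x q_in qbar_in by blast
      have "distT (q (qbar (q x))) (q x) \<le> D" using q_qbar_T[OF q_in[OF x]] D(3) by linarith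
      then have "(fbar (f u), u) \<in> E1" unfolding Inl f_simps fbar_simps by (rule near_edge[OF G x])
      from reach_within_mono[OF reach_within_edge[OF this] k2(1)] show ?thesis .
    next
      case (Inr Z)
      then have "fbar (f u) = u" using u V1_iff inverse by (simp add: f_simps fbar_simps)
      then show ?thesis by (simp add: reach_within_refl)
    qed
    show "(f (fbar w), w) \<in> reach_within E2 k" if w: "w \<in> V2" for w
    proof (cases w)
      case (Inl h)
      have h: "h \<in> carrier H" using w Inl V2_iff by blast
      have "distT (q (qbar h)) h \<le> real k" using q_qbar_T[OF h] unfolding k_def by linarith
      then show ?thesis unfolding Inl f_simps fbar_simps
        using path_avoiding_cones[OF q_in[OF qbar_in[OF h]] h, of k "{}"] by simp
    next
      case (Inr Y)
      then have "f (fbar w) = w" using w V2_iff inverse' by (simp add: f_simps fbar_simps)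
      then show ?thesis by (simp add: reach_within_refl)
    qed
  qed
  have conn: "connected_relation V1 E1" by (rule QI.domain.connected_relation_axioms)
  have "Inl \<one> \<in> V1" unfolding V1_iff by simp
  then have "V1 \<noteq> {}" by blast
  then have "Digraph_Component.connected (with_proj (coned_off_cayley_graph G \<R> S))"
    using connected_pair_graph_iff[OF G_graph] conn unfolding V1_def E1_def by blast
  moreover have "hyperbolic_graph (with_proj (coned_off_cayley_graph G \<R> S))"
    using H_slim QI.slim_triangles_domain hyperbolic_graph_iff_slim_triangles[OF G_graph] conn
    unfolding V1_def E1_def by blast
  moreover have "fine_at (with_proj (coned_off_cayley_graph G \<R> S)) (Inr Z)" if Z: "Z \<in> left_cosets G \<R>" for Z
  proof -
    let ?W1 = "{Inr Z} :: ('a + 'a set) set" and ?W2 = "{Inr (\<psi> Z)} :: ('b + 'b set) set"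
    have "finite {w. (Inr Z, w) \<in> E1 \<and> (u, w) \<in> reach_within (avoiding E1 ?W1) n}"
      if u: "(Inr Z, u) \<in> E1" for u n
    proof -
      obtain x where x: "u = Inl x" "x \<in> Z" using u E1_iff(3,4) by (cases u) auto
      obtain x' where x': "x' \<in> \<psi> Z" "(Inl (q x), Inl x') \<in> reach_within (avoiding E2 ?W2) m"
        using to_cone[OF Z x(2), of ?W2] by blast
      \<comment> \<open>A bounded angle at \<open>Z\<close> becomes a bounded angle at \<open>\<psi> Z\<close>, where only a finite set \<open>F\<close> can be reached.
      Neighbours of \<open>Z\<close> are sent near \<open>F\<close>, and \<open>q\<close> is finite-to-one.\<close>
      define F where "F = {z \<in> \<psi> Z. (Inl x', Inl z) \<in> reach_within (avoiding E2 ?W2) (m + k * n + m)}"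
      have F: "finite F" unfolding F_def by (rule H_fine[OF \<psi>_in[OF Z] x'(1)])
      define F' where "F' = (\<Union>z\<in>F. {h \<in> carrier H. H.wdist z h \<le> r})"
      have "F \<subseteq> carrier H" unfolding F_def using H_coset_subset[OF \<psi>_in[OF Z]] by blast
      then have F': "finite F'" unfolding F'_def using F H.finite_ball by blast
      have avoid: "(f v, f w) \<in> reach_within (avoiding E2 ?W2) k" if "(v, w) \<in> avoiding E1 ?W1" for v w
      proof -
        have vw: "(v, w) \<in> E1" "v \<noteq> Inr Z" "w \<noteq> Inr Z" using that by (auto simp: avoiding_def)
        have other: "f t \<notin> ?W2" if "t \<in> V1" "t \<noteq> Inr Z" for t
          using that \<psi>_inj Z by (cases t) (auto simp: f_simps V1_iff)
        have "v \<in> V1" "w \<in> V1" using vw(1) E1_in by auto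
        then show ?thesis using vw other by (intro f_edge) auto
      qed
      have in_F': "q y \<in> F'" if y: "y \<in> Z" "(u, Inl y) \<in> reach_within (avoiding E1 ?W1) n" for y
      proof -
        obtain y' where y': "y' \<in> \<psi> Z" "H.wdist (q y) y' \<le> r" "y' \<in> carrier H"
          "(Inl (q y), Inl y') \<in> reach_within (avoiding E2 ?W2) m"
          using to_cone[OF Z y(1), of ?W2] by blast
        have "(f u, f (Inl y)) \<in> reach_within (avoiding E2 ?W2) (k * n)"
          using reach_within_map[of "avoiding E1 ?W1" f, OF avoid] y(2) by blast
        then have "(Inl (q x), Inl (q y)) \<in> reach_within (avoiding E2 ?W2) (k * n)" unfolding x(1) f_simps .
        then have "(Inl x', Inl y') \<in> reach_within (avoiding E2 ?W2) (m + k * n + m)"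
          using reach_within_trans[OF reach_within_trans[OF reach_within_sym[OF sym_E2 x'(2)]] y'(4)] by blast
        then have "y' \<in> F" unfolding F_def using y' by blast
        moreover have "q y \<in> carrier H" using q_in y refined_coset_subset[OF Z] by blast
        ultimately show ?thesis unfolding F'_def using y'(2,3) H.dist_sym[of "q y" y'] by auto
      qed
      have "{w. (Inr Z, w) \<in> E1 \<and> (u, w) \<in> reach_within (avoiding E1 ?W1) n} \<subseteq> Inl ` {y \<in> carrier G. q y \<in> F'}"
      proof (intro subsetI)
        fix w assume "w \<in> {w. (Inr Z, w) \<in> E1 \<and> (u, w) \<in> reach_within (avoiding E1 ?W1) n}"
        then have w: "(Inr Z, w) \<in> E1" "(u, w) \<in> reach_within (avoiding E1 ?W1) n" by auto
        obtain y where y: "w = Inl y" "y \<in> Z" using w(1) E1_iff(3,4) by (cases w) auto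
        then show "w \<in> Inl ` {y \<in> carrier G. q y \<in> F'}"
          using in_F'[OF y(2)] w(2) subsetD[OF refined_coset_subset[OF Z] y(2)] by simp
      qed
      then show ?thesis using finite_q_preimage[OF F'] finite_subset finite_imageI by blast
    qed
    then show ?thesis using fine_at_iff[OF G_graph] E1_iff(4) unfolding E1_def by blast
  qed
  ultimately have "hyperbolically_embedded_wrt G \<R> S"
    unfolding hyperbolically_embedded_wrt_def using S refinement_subgroup refinement_infinite by blast
  then show ?thesis unfolding hyperbolically_embedded_def by blast
qed

end

theorem corollaryD:
  fixes G :: "('a, 'm) monoid_scheme" and H :: "('b, 'n) monoid_scheme"
    and A :: "'a set" and B T :: "'b set"
    and \<P> \<P>star :: "'a set set" and \<Q> :: "'b set set"
    and q :: "'a \<Rightarrow> 'b" and qbar :: "'b \<Rightarrow> 'a"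
  assumes "group G" and "group H"
    and "finite A" and "generating_set G A"
    and "finite B" and "generating_set H B"
    and "finite \<P>" and "\<forall>P\<in>\<P>. subgroup P G \<and> infinite P"
    and "finite \<Q>" and "\<forall>Q\<in>\<Q>. subgroup Q H \<and> infinite Q"
    and "generating_set H T"
    and "quasi_isometry_of_pairs G A \<P> H B \<Q> q"
    and "quasi_inverse (carrier G) (word_dist G A) (carrier H) (word_dist H B) q qbar"
    and "uniform_quasi_action G H T q qbar"
    and "hyperbolically_embedded_wrt H \<Q> T"
    and "is_refinement G \<P> \<P>star"
  shows "hyperbolically_embedded G \<P>star"
proof -
  interpret G: fg_group G A using assms by (simp add: fg_group_def fg_group_axioms_def)
  interpret H: fg_group H B using assms by (simp add: fg_group_def fg_group_axioms_def)
  obtain L1 C1 M where pairs: "quasi_isometry_of_pairs_const L1 C1 M G A \<P> H B \<Q> q"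
    using assms(12) unfolding quasi_isometry_of_pairs_def by blast
  then have qi: "quasi_isometry L1 C1 (carrier G) G.wdist (carrier H) H.wdist q"
    and dom: "Domain (coset_relation G \<P> H B \<Q> M q) = left_cosets G \<P>"
    and ran: "Range (coset_relation G \<P> H B \<Q> M q) = left_cosets H \<Q>"
    unfolding quasi_isometry_of_pairs_const_def by auto
  obtain L2 C2 K1 K2 where qi_bar: "quasi_isometry L2 C2 (carrier H) H.wdist (carrier G) G.wdist qbar"
    and K1: "\<forall>x\<in>carrier G. G.wdist (qbar (q x)) x \<le> K1" and K2: "\<forall>y\<in>carrier H. H.wdist (q (qbar y)) y \<le> K2"
    using assms(13) unfolding quasi_inverse_def by blast
  obtain L3 C3 where act: "\<forall>g\<in>carrier G. quasi_isometry L3 C3 (carrier H) (word_dist H T) (carrier H) (word_dist H T)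
      (\<lambda>h. q (g \<otimes>\<^bsub>G\<^esub> qbar h))"
    using assms(14) unfolding uniform_quasi_action_def by blast
  define L where "L = max L1 L3"
  define C where "C = Max {C1, M, K1, K2, C3}"
  have L: "L1 \<le> L" "L3 \<le> L" "1 \<le> L" and L1: "1 \<le> L1" "0 \<le> C1" using qi unfolding L_def quasi_isometry_def by auto
  have C: "C1 \<le> C" "M \<le> C" "K1 \<le> C" "K2 \<le> C" "C3 \<le> C" unfolding C_def by auto
  have rel: "coarsely_close H.wdist C (q ` X) Y" "X \<in> left_cosets G \<P>" "Y \<in> left_cosets H \<Q>"
    if "(X, Y) \<in> coset_relation G \<P> H B \<Q> M q" for X Y
    using that coarsely_close_mono[OF hausdorff_dist_less_imp_close C(2)] unfolding coset_relation_def by auto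
  interpret refined_pair_quasi_isometry G A H B \<P> \<Q> T q qbar L C \<P>star
  proof (intro refined_pair_quasi_isometry.intro uniform_pair_quasi_isometry.intro
      uniform_pair_quasi_isometry_axioms.intro refined_pair_quasi_isometry_axioms.intro
      G.fg_group_axioms H.fg_group_axioms)
    show "generating_set H T" "hyperbolically_embedded_wrt H \<Q> T" "finite \<P>" "is_refinement G \<P> \<P>star" by fact+
    show "subgroup P G" "infinite P" if "P \<in> \<P>" for P using assms(8) that by auto
    show "1 \<le> L" "0 \<le> C" using L C L1 by linarith+
    show "q x \<in> carrier H" if "x \<in> carrier G" for x using qi that unfolding quasi_isometry_def by auto
    show "qbar h \<in> carrier G" if "h \<in> carrier H" for h using qi_bar that unfolding quasi_isometry_def by auto
    show "H.wdist (q x) (q y) \<le> L * G.wdist x y + C" if "x \<in> carrier G" "y \<in> carrier G" for x y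
    proof -
      have "H.wdist (q x) (q y) \<le> L1 * G.wdist x y + C1" using qi that unfolding quasi_isometry_def by blast
      also have "\<dots> \<le> L * G.wdist x y + C"
        using L(1) C(1) G.word_dist_nonneg by (intro add_mono mult_right_mono)
      finally show ?thesis .
    qed
    show "G.wdist x y \<le> L * H.wdist (q x) (q y) + L * C" if "x \<in> carrier G" "y \<in> carrier G" for x y
    proof -
      have "G.wdist x y / L1 - C1 \<le> H.wdist (q x) (q y)" using qi that unfolding quasi_isometry_def by blast
      then have "G.wdist x y \<le> L1 * (H.wdist (q x) (q y) + C1)" using L1(1) by (simp add: field_simps)
      also have "\<dots> \<le> L * (H.wdist (q x) (q y) + C)"
        using L C L1 H.word_dist_nonneg[of B "q x" "q y"] by (intro mult_mono) auto
      finally show ?thesis by (simp add: distrib_left)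
    qed
    show "G.wdist (qbar (q x)) x \<le> C" if "x \<in> carrier G" for x using K1 C(3) that by (meson order_trans)
    show "H.wdist (q (qbar h)) h \<le> C" if "h \<in> carrier H" for h using K2 C(4) that by (meson order_trans)
    show "\<exists>Y\<in>left_cosets H \<Q>. coarsely_close H.wdist C (q ` X) Y" if "X \<in> left_cosets G \<P>" for X
      using that dom rel by (metis DomainE)
    show "\<exists>X\<in>left_cosets G \<P>. coarsely_close H.wdist C (q ` X) Y" if "Y \<in> left_cosets H \<Q>" for Y
      using that ran rel by (metis RangeE)
    show "word_dist H T (q (g \<otimes>\<^bsub>G\<^esub> qbar h)) (q (g \<otimes>\<^bsub>G\<^esub> qbar h')) \<le> L * word_dist H T h h' + C"
      if "g \<in> carrier G" "h \<in> carrier H" "h' \<in> carrier H" for g h h'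
    proof -
      have "word_dist H T (q (g \<otimes>\<^bsub>G\<^esub> qbar h)) (q (g \<otimes>\<^bsub>G\<^esub> qbar h')) \<le> L3 * word_dist H T h h' + C3"
        using act that unfolding quasi_isometry_def by blast
      also have "\<dots> \<le> L * word_dist H T h h' + C"
        using L(2) C(5) H.word_dist_nonneg by (intro add_mono mult_right_mono)
      finally show ?thesis .
    qed
  qed
  show ?thesis by (rule hyperbolically_embedded_refinement)
qed

end
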